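(* Let $\overline\lambda\ge8\pi$ be fixed. There exists $\rho_0>0$ depending on $\overline\lambda$ such that for any $\rho<\rho_0$ and for each $\lambda\in[0,\overline\lambda)$ there exists a solution $u_\lambda$ of $P(\lambda,\Omega_\rho)$ which satisfies $$u_\lambda(x,y;\lambda)=\rho\,\phi_0(x,y;\lambda)+\rho^2\phi_1(x,y;\lambda)+\rho^3\phi_2(x,y;\lambda),\qquad(x,y)\in\Omega_\rho,$$ where $\{\phi_0,\phi_1,\phi_2\}\subset C^2_0(\Omega_\rho)$. Moreover $$\phi_0(x,y;\lambda,\rho)=\mu_0(\lambda,\rho)\,\psi_0(x,y;\rho),\qquad\psi_0(x,y;\rho)=\frac{1}{2(1+\rho^2)}\big(1-(\rho^2x^2+y^2)\big),$$ with $\mu_0$ a smooth function which satisfies $$\mu_0(\lambda,\rho)=\frac{\lambda}{\pi}-\frac{\lambda^2}{4\pi^2}\rho+O(\rho^2),$$ $$D^{(1)}_\lambda\mu_0(\lambda,\rho)=\frac1\pi-\frac{\lambda}{2\pi^2}\rho+O(\rho^2),\qquad D^{(2)}_\lambda\mu_0(\lambda,\rho)=-\frac{1}{2\pi^2}\rho+O(\rho^2).$$ In particular the following uniform estimates hold: $$\|D^{(k)}_\lambda\phi_0\|_{C^2_0(\Omega_\rho)}+\|D^{(k)}_\lambda\phi_1\|_{C^2_0(\Omega_\rho)}+\|D^{(k)}_\lambda\phi_2\|_{C^2_0(\Omega_\rho)}\le\overline M_k,\qquad k=0,1,2,$$ for suitable constants $\overline M_k$, $k=0,1,2$, depending only on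 $\overline\lambda$. Finally, this set of solutions is a smooth branch which coincides with a portion of $\mathcal{G}_{\rho,1}$.
   Context: For $\rho\in(0,1]$, $\Omega_\rho=\{(x,y)\in\mathbb{R}^2:\rho^2x^2+y^2\le1\}$ is the canonical ellipse (the problems below are posed in its interior). $P(\lambda,\Omega)$: $-\Delta u=\lambda e^u/\int_\Omega e^u$ in $\Omega$, $u=0$ on $\partial\Omega$. $Q(\mu,\Omega)$: $-\Delta u=\mu e^u$ in $\Omega$, $u=0$ on $\partial\Omega$. $C^2_0(\Omega_\rho)$ denotes the $C^2$ functions on $\overline{\Omega_\rho}$ vanishing on the boundary, with the $C^2$ norm. $D^{(k)}_\lambda=\partial^k/\partial\lambda^k$, $k=0,1,2$. $O(\rho^m)$ denotes quantities uniformly bounded by $C_m\rho^m$ with $C_m>0$ depending only on $\overline\lambda$. The branch $\mathcal{G}_{\rho,1}$. Let $\overline\mu_\rho=\frac{(1+\rho^2)^2}{2}$ and, for $\mu\in(0,\overline\mu_\rho]$, let $\gamma^\pm_\rho(\mu)>0$ be given by $$(\gamma^+_\rho(\mu))^2=\frac{2(1+\rho^2)-\mu-2\sqrt{(1+\rho^2)^2-2\mu}}{\mu+4(1-\rho^2)},\qquad(\gamma^-_\rho(\mu))^2=\frac{\mu-2(1+\rho^2)+2\sqrt{(1+\rho^2)^2-2\rho^2\mu}}{4(1-\rho^2)-\mu}.$$ With $v_{\rho,\gamma}(x,y)=2\log\frac{1+\gamma^2}{1+\gamma^2(\rho^2x^2+y^2)}$, for $\rho$ small let $u_{\rho,\mu}$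 be the solution of $Q(\mu,\Omega_\rho)$, obtained by the sub-supersolution method, satisfying $v_{\rho,\gamma^-_\rho(\mu)}\le u_{\rho,\mu}\le v_{\rho,\gamma^+_\rho(\mu)}$ in $\Omega_\rho$. It solves $P(\lambda,\Omega_\rho)$ with $\lambda=\lambda_\rho(\mu):=\mu\int_{\Omega_\rho}e^{u_{\rho,\mu}}$. Put $\lambda_{\rho,1}:=\lambda_\rho(\overline\mu_\rho)$; for $\lambda\in(0,\lambda_{\rho,1}]$, $u^{(\lambda)}$ denotes $u_{\rho,\mu}$ with $\lambda_\rho(\mu)=\lambda$, and $u^{(0)}=0$. Then $\mathcal{G}_{\rho,1}=\{(\lambda,u^{(\lambda)}):\lambda\in[0,\lambda_{\rho,1}]\}$. *)

theory Defs
  imports "HOL-Analysis.Analysis"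
begin

type_synonym plane = "real \<times> real"

definition partial :: "plane \<Rightarrow> (plane \<Rightarrow> real) \<Rightarrow> plane \<Rightarrow> real" where
  "partial b f = (\<lambda>p. frechet_derivative f (at p) b)"

text \<open>\<open>Ck k U f\<close>: \<open>f\<close> is of class \<open>C^k\<close> on the open set \<open>U\<close>. Note that \<open>Basis = {(1,0), (0,1)}\<close>.\<close>

primrec Ck :: "nat \<Rightarrow> plane set \<Rightarrow> (plane \<Rightarrow> real) \<Rightarrow> bool" where
  "Ck 0 U f \<longleftrightarrow> continuous_on U f"
| "Ck (Suc k) U f \<longleftrightarrow>
     (\<forall>p\<in>U. f differentiable (at p)) \<and> (\<forall>b\<in>Basis. Ck k U (partial b f))"

text \<open>A function of \<open>(s,t)\<close> is smooth on a set \<open>A\<close>, not necessarily open, if it is of class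
  \<open>C^k\<close> for every \<open>k\<close> on some open neighbourhood of \<open>A\<close>.\<close>

definition smooth_near :: "plane set \<Rightarrow> (plane \<Rightarrow> real) \<Rightarrow> bool" where
  "smooth_near A f \<longleftrightarrow> (\<exists>U. open U \<and> A \<subseteq> U \<and> (\<forall>k. Ck k U f))"

definition laplacian :: "(plane \<Rightarrow> real) \<Rightarrow> plane \<Rightarrow> real" where
  "laplacian f p = (\<Sum>b\<in>Basis. partial b (partial b f) p)"

definition ellipse :: "real \<Rightarrow> plane set" where
  "ellipse \<rho> = {(x, y). \<rho>\<^sup>2 * x\<^sup>2 + y\<^sup>2 \<le> 1}"

definition extends_to_closure :: "plane set \<Rightarrow> (plane \<Rightarrow> real) \<Rightarrow> bool" where
  "extends_to_closure K f \<longleftrightarrow>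
     (\<exists>g. continuous_on K g \<and> (\<forall>p\<in>interior K. g p = f p))"

text \<open>The space \<open>C^2_0(K)\<close> for a closed region \<open>K\<close>. Its elements vanish on \<open>K - interior K\<close>, and
  are set to 0 outside \<open>K\<close>, so that equality in the space is equality of HOL functions.\<close>

definition C20 :: "plane set \<Rightarrow> (plane \<Rightarrow> real) set" where
  "C20 K = {f. continuous_on K f \<and> Ck 2 (interior K) f \<and>
     (\<forall>b\<in>Basis. extends_to_closure K (partial b f)) \<and>
     (\<forall>b\<in>Basis. \<forall>c\<in>Basis. extends_to_closure K (partial b (partial c f))) \<and>
     (\<forall>p. p \<notin> interior K \<longrightarrow> f p = 0)}"

definition C2_norm :: "plane set \<Rightarrow> (plane \<Rightarrow> real) \<Rightarrow> real" where
  "C2_norm K f = (SUP p\<in>interior K. \<bar>f p\<bar>)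
     + (\<Sum>b\<in>Basis. SUP p\<in>interior K. \<bar>partial b f p\<bar>)
     + (\<Sum>b\<in>Basis. \<Sum>c\<in>Basis. SUP p\<in>interior K. \<bar>partial b (partial c f) p\<bar>)"

text \<open>\<open>curve_deriv K S k F G\<close>: as a curve in the Banach space \<open>C^2_0(K)\<close> with parameter in the
  interval \<open>S\<close>, \<open>F\<close> is \<open>k\<close> times differentiable and \<open>G\<close> is its \<open>k\<close>-th derivative
  (one-sided at an end point of \<open>S\<close>).\<close>

primrec curve_deriv ::
  "plane set \<Rightarrow> real set \<Rightarrow> nat \<Rightarrow> (real \<Rightarrow> plane \<Rightarrow> real) \<Rightarrow> (real \<Rightarrow> plane \<Rightarrow> real) \<Rightarrow> bool"
where
  "curve_deriv K S 0 F G \<longleftrightarrow> (\<forall>l\<in>S. F l \<in> C20 K \<and> G l = F l)"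
| "curve_deriv K S (Suc k) F G \<longleftrightarrow>
     (\<exists>H. curve_deriv K S k F H \<and>
       (\<forall>l\<in>S. G l \<in> C20 K \<and>
         ((\<lambda>t. C2_norm K (\<lambda>p. (H t p - H l p) / (t - l) - G l p)) \<longlongrightarrow> 0) (at l within S)))"

definition smooth_curve :: "plane set \<Rightarrow> real set \<Rightarrow> (real \<Rightarrow> plane \<Rightarrow> real) \<Rightarrow> bool" where
  "smooth_curve K S F \<longleftrightarrow> (\<forall>k. \<exists>G. curve_deriv K S k F G)"

definition solves_P :: "real \<Rightarrow> plane set \<Rightarrow> (plane \<Rightarrow> real) \<Rightarrow> bool" where
  "solves_P l K u \<longleftrightarrow> u \<in> C20 K \<and>
     (\<forall>p\<in>interior K. - laplacian u p = l * exp (u p) / integral K (\<lambda>q. exp (u q)))"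

definition solves_Q :: "real \<Rightarrow> plane set \<Rightarrow> (plane \<Rightarrow> real) \<Rightarrow> bool" where
  "solves_Q \<mu> K u \<longleftrightarrow> u \<in> C20 K \<and>
     (\<forall>p\<in>interior K. - laplacian u p = \<mu> * exp (u p))"

definition mu_bar :: "real \<Rightarrow> real" where
  "mu_bar \<rho> = (1 + \<rho>\<^sup>2)\<^sup>2 / 2"

definition gamma_plus :: "real \<Rightarrow> real \<Rightarrow> real" where
  "gamma_plus \<rho> \<mu> = sqrt ((2 * (1 + \<rho>\<^sup>2) - \<mu> - 2 * sqrt ((1 + \<rho>\<^sup>2)\<^sup>2 - 2 * \<mu>))
     / (\<mu> + 4 * (1 - \<rho>\<^sup>2)))"

definition gamma_minus :: "real \<Rightarrow> real \<Rightarrow> real" where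
  "gamma_minus \<rho> \<mu> = sqrt ((\<mu> - 2 * (1 + \<rho>\<^sup>2) + 2 * sqrt ((1 + \<rho>\<^sup>2)\<^sup>2 - 2 * \<rho>\<^sup>2 * \<mu>))
     / (4 * (1 - \<rho>\<^sup>2) - \<mu>))"

definition v_fun :: "real \<Rightarrow> real \<Rightarrow> plane \<Rightarrow> real" where
  "v_fun \<rho> \<gamma> = (\<lambda>(x, y). 2 * ln ((1 + \<gamma>\<^sup>2) / (1 + \<gamma>\<^sup>2 * (\<rho>\<^sup>2 * x\<^sup>2 + y\<^sup>2))))"

text \<open>The sub- and supersolution below enclose exactly one solution when \<open>\<rho>\<close> is small, hence the
  definite description: all solutions between them satisfy \<open>\<mu> exp u < \<pi>^2/4\<close>, which is less than
  the first Dirichlet eigenvalue of the ellipse, so two of them cannot differ.\<close>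

definition u_sub_super :: "real \<Rightarrow> real \<Rightarrow> plane \<Rightarrow> real" where
  "u_sub_super \<rho> \<mu> = (THE u. solves_Q \<mu> (ellipse \<rho>) u \<and>
     (\<forall>p\<in>ellipse \<rho>. v_fun \<rho> (gamma_minus \<rho> \<mu>) p \<le> u p \<and> u p \<le> v_fun \<rho> (gamma_plus \<rho> \<mu>) p))"

definition lambda_of_mu :: "real \<Rightarrow> real \<Rightarrow> real" where
  "lambda_of_mu \<rho> \<mu> = \<mu> * integral (ellipse \<rho>) (\<lambda>p. exp (u_sub_super \<rho> \<mu> p))"

definition lambda_1 :: "real \<Rightarrow> real" where
  "lambda_1 \<rho> = lambda_of_mu \<rho> (mu_bar \<rho>)"

definition u_of_lambda :: "real \<Rightarrow> real \<Rightarrow> plane \<Rightarrow> real" where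
  "u_of_lambda \<rho> l = (if l = 0 then (\<lambda>p. 0)
     else u_sub_super \<rho> (THE \<mu>. \<mu> \<in> {0<..mu_bar \<rho>} \<and> lambda_of_mu \<rho> \<mu> = l))"

definition branch_G1 :: "real \<Rightarrow> (real \<times> (plane \<Rightarrow> real)) set" where
  "branch_G1 \<rho> = {(l, u_of_lambda \<rho> l) | l. l \<in> {0..lambda_1 \<rho>}}"

definition psi0 :: "real \<Rightarrow> plane \<Rightarrow> real" where
  "psi0 \<rho> = (\<lambda>(x, y). 1 / (2 * (1 + \<rho>\<^sup>2)) * (1 - (\<rho>\<^sup>2 * x\<^sup>2 + y\<^sup>2)))"

end

theory Submission
  imports Defs "HOL-Library.Function_Algebras"
begin

text \<open>
  On an ellipse the Dirichlet problem with polynomial right-hand side has a polynomial solution: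
  \<open>g \<mapsto> - \<Delta>((1 - q) g)\<close> with \<open>q = \<rho>\<^sup>2 x\<^sup>2 + y\<^sup>2\<close> does not raise the degree and is injective by the maximum
  principle. Hence the formal solution of \<open>Q(\<mu>)\<close> in powers of \<open>\<mu>\<close>, and that of \<open>P(\<lambda>)\<close> in powers of
  \<open>s = \<lambda>\<rho>/\<pi>\<close>, has as \<open>k\<close>-th coefficient a polynomial of degree at most \<open>2k\<close>. The maximum principle bounds
  these coefficients uniformly, independently of \<open>\<rho>\<close>, and a Markov inequality turns this into bounds for
  their first and second derivatives at the price of a power of \<open>k\<close>, so both series converge in \<open>C\<^sup>2\<^sub>0\<close>.

  The coefficients of the series in \<open>\<mu>\<close> are nonnegative, so its partial sums stay below every supersolution;
  the supersolution \<open>1 - y\<^sup>2\<close> gives a radius of convergence of at least \<open>2/e\<close>, which exceeds the end point of the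
  branch. Thus the series is the solution between the given sub- and supersolution for all \<open>\<mu>\<close> of the branch.
  By uniqueness of small solutions the series in \<open>s\<close> lies on the same branch, and since it is a power series
  in \<open>\<lambda>\<close> its smoothness and the estimates are immediate. One can take
  \<open>\<mu>\<^sub>0 = \<lambda>/\<pi> - \<lambda>\<^sup>2\<rho>/(4\<pi>\<^sup>2)\<close> exactly, put the whole remainder into \<open>\<phi>\<^sub>1\<close> and set \<open>\<phi>\<^sub>2 = 0\<close>.
\<close>

text \<open>The two expansions have different tasks. \<open>u_of_lambda\<close> is a definite
  description over all \<mu> in \<open>{0<..mu_bar \<rho>}\<close>, so identifying even a small
  portion of the branch calls for injectivity of \<open>lambda_of_mu\<close> on that whole interval.
  This requires a series for Q that converges up to \<mu> slightly above 1/2, which is obtained from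
  the signs of its coefficients. In the series for P the nonlocal term enters with a minus sign,
  which destroys this structure; a majorant argument gives only the radius 1/48, but that suffices
  because s = \<lambda>\<rho>/pi is O(\<rho>) for bounded \<lambda>.

  The barriers 6/5 - y^2 and 1 - y^2 depend on y alone: the ellipses fill the strip |y| < 1 as
  \<rho> tends to 0, and no constant may depend on the long axis. The threshold 33/20 for \<mu> exp
  u in the uniqueness argument is squeezed from two sides: it must lie below 2 / (6/5) = 5/3, the
  ratio offered by 6/5 - y^2, and above 6/10 e < 1.64, because u <= 1 and \<mu> <= 6/10 along the
  branch.\<close>

lemma Basis_plane: "(Basis :: plane set) = {(1, 0), (0, 1)}"
  by (auto simp: Basis_prod_def)

lemma laplacian_eq: "laplacian f p = partial (1, 0) (partial (1, 0) f) p + partial (0, 1) (partial (0, 1) f) p"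
  unfolding laplacian_def Basis_plane by simp

section \<open>Partial derivatives and the second-derivative test\<close>

lemma partial_eqI: "(f has_derivative f') (at p) \<Longrightarrow> partial b f p = f' b"
  unfolding partial_def by (metis frechet_derivative_at)

lemma has_derivative_partial:
  "f differentiable (at p) \<Longrightarrow> (f has_derivative (\<lambda>h. partial h f p)) (at p)"
  unfolding partial_def by (simp add: frechet_derivative_works)

lemma partial_cong:
  assumes "open U" "p \<in> U" "\<And>x. x \<in> U \<Longrightarrow> f x = g x"
  shows "partial b f p = partial b g p"
proof -
  have "(f has_derivative f') (at p) \<longleftrightarrow> (g has_derivative f') (at p)" for f'
    using assms by (metis (no_types, lifting) has_derivative_transform_within_open)
  then show ?thesis unfolding partial_def frechet_derivative_def by simp
qed

lemma differentiable_cong: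
  assumes "open U" "p \<in> U" "\<And>x. x \<in> U \<Longrightarrow> f x = g x"
  shows "f differentiable (at p) \<longleftrightarrow> g differentiable (at p)"
  using assms unfolding differentiable_def
  by (metis (no_types, lifting) has_derivative_transform_within_open)

text \<open>Comparison arguments evaluate second derivatives only at a maximum point, so their
  continuity is not asked for. Polynomials, \<open>v_fun\<close> and elements of \<open>C20\<close>
  all qualify.\<close>

definition twice_diff :: "plane set \<Rightarrow> (plane \<Rightarrow> real) \<Rightarrow> bool" where
  "twice_diff U f \<longleftrightarrow> (\<forall>p\<in>U. f differentiable (at p)) \<and>
     (\<forall>b\<in>Basis. \<forall>p\<in>U. partial b f differentiable (at p))"

lemma Ck2_twice_diff: "Ck 2 U f \<Longrightarrow> twice_diff U f"
  unfolding twice_diff_def by (simp add: numeral_2_eq_2)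

lemma partial_lincomb:
  assumes "f differentiable (at p)" "g differentiable (at p)"
  shows "partial b (\<lambda>p. r * f p + s * g p) p = r * partial b f p + s * partial b g p"
  by (rule partial_eqI) (auto intro!: derivative_eq_intros has_derivative_partial assms)

lemma lincomb_laplacian:
  assumes U: "open U" and f: "twice_diff U f" and g: "twice_diff U g"
  shows "twice_diff U (\<lambda>p. r * f p + s * g p)"
    and "p \<in> U \<Longrightarrow> laplacian (\<lambda>p. r * f p + s * g p) p = r * laplacian f p + s * laplacian g p"
proof -
  let ?h = "\<lambda>p. r * f p + s * g p"
  have 1: "partial b ?h x = r * partial b f x + s * partial b g x" if "x \<in> U" for b x
    by (rule partial_lincomb) (use f g that in \<open>auto simp: twice_diff_def\<close>)
  have d: "partial b ?h differentiable (at p)" if "p \<in> U" "b \<in> Basis" for b p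
  proof -
    have "(\<lambda>x. r * partial b f x + s * partial b g x) differentiable (at p)"
      using f g that unfolding twice_diff_def by (auto intro!: derivative_intros)
    moreover have "partial b ?h differentiable (at p) \<longleftrightarrow> (\<lambda>x. r * partial b f x + s * partial b g x) differentiable (at p)"
      by (rule differentiable_cong[OF U that(1)]) (rule 1)
    ultimately show ?thesis by simp
  qed
  show "twice_diff U ?h"
    using f g d unfolding twice_diff_def by (auto intro!: derivative_intros)
  have 2: "partial b (partial b ?h) p = r * partial b (partial b f) p + s * partial b (partial b g) p"
    if "p \<in> U" "b \<in> Basis" for b p
  proof -
    have "partial b (partial b ?h) p = partial b (\<lambda>x. r * partial b f x + s * partial b g x) p"
      by (rule partial_cong[OF U that(1)]) (rule 1)
    also have "\<dots> = r * partial b (partial b f) p + s * partial b (partial b g) p"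
      by (rule partial_lincomb) (use f g that in \<open>auto simp: twice_diff_def\<close>)
    finally show ?thesis .
  qed
  show "p \<in> U \<Longrightarrow> laplacian ?h p = r * laplacian f p + s * laplacian g p"
    using 2[of p "(1, 0)"] 2[of p "(0, 1)"] by (simp add: laplacian_eq Basis_plane distrib_left)
qed

text \<open>Without continuous second derivatives there is no Taylor expansion around p. Instead, a
  positive second derivative in a direction b makes the directional derivative, which is 0 at p,
  positive just beyond p, so that f increases strictly along a short segment.\<close>

lemma laplacian_nonpos_at_max:
  assumes U: "open U" "p \<in> U" and f: "twice_diff U f" and max: "\<And>x. x \<in> U \<Longrightarrow> f x \<le> f p"
  shows "laplacian f p \<le> 0"
proof -
  have "partial b (partial b f) p \<le> 0" if b: "b \<in> Basis" for b
  proof (rule ccontr)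
    assume pos: "\<not> ?thesis"
    have cont: "continuous (at 0) (\<lambda>t::real. p + t *\<^sub>R b)"
      by (intro continuous_intros)
    have "\<forall>\<^sub>F t in at (0::real). p + t *\<^sub>R b \<in> U"
      using topological_tendstoD[OF cont[unfolded continuous_at] U(1)] U(2) by simp
    then obtain e where e: "e > 0" "\<And>t. t \<noteq> 0 \<Longrightarrow> \<bar>t\<bar> < e \<Longrightarrow> p + t *\<^sub>R b \<in> U"
      unfolding eventually_at by (auto simp: dist_real_def)
    have inU: "p + t *\<^sub>R b \<in> U" if "\<bar>t\<bar> < e" for t
      using e(2)[of t] that U(2) by (cases "t = 0") auto
    define g where "g = (\<lambda>t. f (p + t *\<^sub>R b))"
    define g' where "g' = (\<lambda>t. partial b f (p + t *\<^sub>R b))"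
    have lin: "partial (s *\<^sub>R b) f x = s * partial b f x" if "f differentiable (at x)" for f x s
      using linear_cmul[OF has_derivative_linear[OF has_derivative_partial[OF that]]] by simp
    have comp: "((\<lambda>t. f (p + t *\<^sub>R b)) has_real_derivative partial b f (p + t *\<^sub>R b)) (at t)"
      if "f differentiable (at (p + t *\<^sub>R b))" for f t
    proof -
      have *: "((\<lambda>t. p + t *\<^sub>R b) has_derivative (\<lambda>s. s *\<^sub>R b)) (at t)"
        by (auto intro!: derivative_eq_intros)
      show ?thesis
        using has_derivative_compose[OF * has_derivative_partial[OF that]] lin[OF that]
        by (simp add: has_field_derivative_def mult.commute[of _ "partial b f (p + t *\<^sub>R b)"])
    qed
    have g: "(g has_real_derivative g' t) (at t)" if "\<bar>t\<bar> < e" for t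
      unfolding g_def g'_def using comp[of f t] f inU[OF that] unfolding twice_diff_def by blast
    have "(g' has_real_derivative partial b (partial b f) (p + 0 *\<^sub>R b)) (at 0)"
      unfolding g'_def using comp[of "partial b f" 0] f inU[of 0] e(1) b unfolding twice_diff_def by simp
    then have g2: "(g' has_real_derivative partial b (partial b f) p) (at 0)" by simp
    have "g' 0 = 0"
      using g[of 0] e(1) max inU unfolding g_def
      by (intro DERIV_local_max[of g "g' 0" 0 e]) (auto simp: g_def)
    obtain d where d: "d > 0" "\<And>h. h > 0 \<Longrightarrow> h < d \<Longrightarrow> g' 0 < g' (0 + h)"
      using DERIV_pos_inc_right[OF g2] pos by auto
    define t where "t = min d e / 2"
    have t: "0 < t" "t < d" "t < e" using d e unfolding t_def by auto
    have "g 0 < g t"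
    proof (rule DERIV_pos_imp_increasing_open[OF t(1)])
      show "\<exists>y. (g has_real_derivative y) (at x) \<and> 0 < y" if "0 < x" "x < t" for x
        using g[of x] d(2)[of x] \<open>g' 0 = 0\<close> that t by auto
      show "continuous_on {0..t} g"
      proof (rule continuous_at_imp_continuous_on, rule ballI)
        fix x assume "x \<in> {0..t}"
        then have "\<bar>x\<bar> < e" using t by auto
        then show "isCont g x" using DERIV_isCont[OF g] by blast
      qed
    qed
    then show False using max[of "p + t *\<^sub>R b"] inU[of t] t unfolding g_def by auto
  qed
  then show ?thesis unfolding laplacian_def by (intro sum_nonpos) auto
qed

subsection \<open>Polynomial functions of bounded total degree\<close>

text \<open>The index is an upper bound for the total degree, not the degree itself, so that each
  level is a vector space; working with functions lets derivatives and integrals apply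
  directly.\<close>

inductive polyfun :: "nat \<Rightarrow> (plane \<Rightarrow> real) \<Rightarrow> bool" for n where
  monom: "i + j \<le> n \<Longrightarrow> polyfun n (\<lambda>p. c * fst p ^ i * snd p ^ j)"
| add: "polyfun n f \<Longrightarrow> polyfun n g \<Longrightarrow> polyfun n (\<lambda>p. f p + g p)"

lemma polyfun_const: "polyfun n (\<lambda>p. c)"
  using polyfun.monom[of 0 0 n c] by simp

lemma polyfun_scale: "polyfun n f \<Longrightarrow> polyfun n (\<lambda>p. r * f p)"
proof (induction rule: polyfun.induct)
  case (monom i j c)
  then show ?case using polyfun.monom[of i j n "r * c"] by (simp add: mult.assoc)
next
  case (add f g)
  then show ?case using polyfun.add by (simp add: distrib_left)
qed

lemma polyfun_mono: "polyfun n f \<Longrightarrow> n \<le> m \<Longrightarrow> polyfun m f"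
  by (induction rule: polyfun.induct) (auto intro: polyfun.intros)

lemma polyfun_diff: "polyfun n f \<Longrightarrow> polyfun n g \<Longrightarrow> polyfun n (\<lambda>p. f p - g p)"
  using polyfun.add[of n f "\<lambda>p. (-1) * g p"] polyfun_scale[of n g "-1"] by simp

lemma polyfun_mult:
  assumes "polyfun n f" "polyfun m g"
  shows "polyfun (n + m) (\<lambda>p. f p * g p)"
  using assms(1)
proof (induction rule: polyfun.induct)
  case (monom i j c)
  show ?case using assms(2)
  proof (induction rule: polyfun.induct)
    case (monom i' j' c')
    then show ?case using polyfun.monom[of "i + i'" "j + j'" "n + m" "c * c'"] \<open>i + j \<le> n\<close>
      by (simp add: power_add algebra_simps)
  next
    case (add f g)
    then show ?case using polyfun.add[OF add.IH] by (simp add: algebra_simps)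
  qed
next
  case (add f g)
  then show ?case using polyfun.add[OF add.IH] by (simp add: algebra_simps)
qed

lemma polyfun_sum: "(\<And>i. i \<in> A \<Longrightarrow> polyfun n (f i)) \<Longrightarrow> polyfun n (\<lambda>p. \<Sum>i\<in>A. f i p)"
  by (induction A rule: infinite_finite_induct) (auto intro: polyfun_const polyfun.add)

lemma polyfun_has_derivative:
  assumes "polyfun n f"
  shows "\<exists>f1 f2. polyfun (n - 1) f1 \<and> polyfun (n - 1) f2 \<and>
    (\<forall>p. (f has_derivative (\<lambda>h. fst h * f1 p + snd h * f2 p)) (at p))"
  using assms
proof (induction rule: polyfun.induct)
  case (monom i j c)
  let ?f1 = "\<lambda>p::plane. (c * real i) * fst p ^ (i - 1) * snd p ^ j"
  let ?f2 = "\<lambda>p::plane. (c * real j) * fst p ^ i * snd p ^ (j - 1)"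
  have "polyfun (n - 1) ?f1"
    using polyfun.monom[of "i - 1" j "n - 1" "c * real i"] monom polyfun_const[of "n - 1" 0] by (cases i) auto
  moreover have "polyfun (n - 1) ?f2"
    using polyfun.monom[of i "j - 1" "n - 1" "c * real j"] monom polyfun_const[of "n - 1" 0] by (cases j) auto
  moreover have "((\<lambda>p. c * fst p ^ i * snd p ^ j) has_derivative
      (\<lambda>h. fst h * ?f1 p + snd h * ?f2 p)) (at p)" for p :: plane
    by (auto intro!: derivative_eq_intros simp: fun_eq_iff algebra_simps)
  ultimately show ?case by blast
next
  case (add f g)
  then obtain f1 f2 g1 g2 where
    "polyfun (n - 1) f1" "polyfun (n - 1) f2" "polyfun (n - 1) g1" "polyfun (n - 1) g2"
    and *: "\<And>p. (f has_derivative (\<lambda>h. fst h * f1 p + snd h * f2 p)) (at p)"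
    "\<And>p. (g has_derivative (\<lambda>h. fst h * g1 p + snd h * g2 p)) (at p)"
    by blast
  then have "polyfun (n - 1) (\<lambda>p. f1 p + g1 p)" "polyfun (n - 1) (\<lambda>p. f2 p + g2 p)"
    by (auto intro: polyfun.add)
  moreover have "((\<lambda>p. f p + g p) has_derivative
      (\<lambda>h. fst h * (f1 p + g1 p) + snd h * (f2 p + g2 p))) (at p)" for p
    by (rule has_derivative_eq_rhs[OF has_derivative_add[OF *]]) (simp add: algebra_simps)
  ultimately show ?case by blast
qed

lemma polyfun_differentiable: "polyfun n f \<Longrightarrow> f differentiable (at p)"
  using polyfun_has_derivative unfolding differentiable_def by blast

lemma polyfun_partial:
  assumes "polyfun n f"
  shows "polyfun (n - 1) (partial v f)"
proof -
  obtain f1 f2 where f: "polyfun (n - 1) f1" "polyfun (n - 1) f2"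
    and d: "\<And>p. (f has_derivative (\<lambda>h. fst h * f1 p + snd h * f2 p)) (at p)"
    using polyfun_has_derivative[OF assms] by blast
  have "partial v f = (\<lambda>p. fst v * f1 p + snd v * f2 p)"
    using partial_eqI[OF d] by (intro ext) simp
  then show ?thesis using f by (auto intro: polyfun.add polyfun_scale)
qed

lemma polyfun_continuous_on: "polyfun n f \<Longrightarrow> continuous_on A f"
  by (meson continuous_at_imp_continuous_on differentiable_imp_continuous_within polyfun_differentiable)

lemma polyfun_Ck: "polyfun n f \<Longrightarrow> Ck k U f"
proof (induction k arbitrary: n f)
  case 0 then show ?case by (simp add: polyfun_continuous_on)
next
  case (Suc k) then show ?case using polyfun_differentiable polyfun_partial by fastforce
qed

lemma polyfun_twice_diff: "polyfun n f \<Longrightarrow> twice_diff U f"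
  by (rule Ck2_twice_diff) (rule polyfun_Ck)

lemma polyfun_laplacian:
  assumes "polyfun n f"
  shows "polyfun (n - 2) (laplacian f)"
proof -
  have "polyfun (n - 1 - 1) (partial v (partial v f))" for v
    by (intro polyfun_partial assms)
  then have "polyfun (n - 2) (partial v (partial v f))" for v
    by (metis Suc_1 diff_diff_left plus_1_eq_Suc)
  then have "polyfun (n - 2) (\<lambda>p. partial (1, 0) (partial (1, 0) f) p + partial (0, 1) (partial (0, 1) f) p)"
    by (rule polyfun.add) fact
  then show ?thesis unfolding laplacian_eq[abs_def] .
qed

text \<open>Restriction to lines reduces the identity theorem and the Markov inequality to
  polynomials in one variable.\<close>

lemma polyfun_line:
  assumes "polyfun n f"
  obtains q :: "real poly" where "degree q \<le> n" "\<And>t. poly q t = f (a + t *\<^sub>R v)"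
proof -
  have "\<exists>q::real poly. degree q \<le> n \<and> (\<forall>t. poly q t = f (a + t *\<^sub>R v))"
    using assms
  proof (induction rule: polyfun.induct)
    case (monom i j c)
    let ?q = "[:c:] * [:fst a, fst v:] ^ i * [:snd a, snd v:] ^ j"
    have "degree ([:fst a, fst v:] ^ i) \<le> i" "degree ([:snd a, snd v:] ^ j) \<le> j"
      by (rule order.trans[OF degree_power_le]; simp)+
    then have "degree ?q \<le> n"
      using monom degree_mult_le[of "[:c:] * [:fst a, fst v:] ^ i" "[:snd a, snd v:] ^ j"]
        degree_mult_le[of "[:c:]" "[:fst a, fst v:] ^ i"] by simp
    moreover have "poly ?q t = c * fst (a + t *\<^sub>R v) ^ i * snd (a + t *\<^sub>R v) ^ j" for t
      by (simp add: poly_power)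
    ultimately show ?case by blast
  next
    case (add f g)
    then obtain q r where "degree q \<le> n" "degree r \<le> n" "\<And>t. poly q t = f (a + t *\<^sub>R v)"
      "\<And>t. poly r t = g (a + t *\<^sub>R v)" by blast
    then show ?case by (intro exI[of _ "q + r"]) (simp add: degree_add_le)
  qed
  then show ?thesis using that by blast
qed

text \<open>On the line from a through x the restricted polynomial has infinitely many roots near a,
  hence vanishes at x as well.\<close>

lemma polyfun_eq_0:
  assumes f: "polyfun n f" and "open U" "a \<in> U" and "\<And>x. x \<in> U \<Longrightarrow> f x = 0"
  shows "f x = 0"
proof -
  obtain q where q: "\<And>t. poly q t = f (a + t *\<^sub>R (x - a))"
    using polyfun_line[OF f] by metis
  have "continuous (at 0) (\<lambda>t::real. a + t *\<^sub>R (x - a))"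
    by (intro continuous_intros)
  then have "\<forall>\<^sub>F t in at (0::real). a + t *\<^sub>R (x - a) \<in> U"
    using topological_tendstoD[of "\<lambda>t::real. a + t *\<^sub>R (x - a)"] assms(2,3) by (simp add: continuous_at)
  then obtain e where e: "e > 0" "\<And>t. t \<noteq> 0 \<Longrightarrow> \<bar>t\<bar> < e \<Longrightarrow> a + t *\<^sub>R (x - a) \<in> U"
    unfolding eventually_at by (auto simp: dist_real_def)
  have "{0<..<e} \<subseteq> {t. poly q t = 0}"
  proof
    fix t assume "t \<in> {0<..<e}"
    then have "f (a + t *\<^sub>R (x - a)) = 0"
      using e(2)[of t] assms(4) by simp
    then show "t \<in> {t. poly q t = 0}" using q[of t] by simp
  qed
  then have "infinite {t. poly q t = 0}"
    using infinite_super[OF _ infinite_Ioo[OF e(1)]] by blast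
  then have "q = 0" using poly_roots_finite by blast
  then show ?thesis using q[of 1] by simp
qed

section \<open>Geometry of the ellipse\<close>

definition quad :: "real \<Rightarrow> plane \<Rightarrow> real" where
  "quad \<rho> p = \<rho>\<^sup>2 * (fst p)\<^sup>2 + (snd p)\<^sup>2"

lemma mem_ellipse: "p \<in> ellipse \<rho> \<longleftrightarrow> quad \<rho> p \<le> 1"
  by (cases p) (simp add: ellipse_def quad_def)

lemma quad_nonneg: "0 \<le> quad \<rho> p"
  by (simp add: quad_def)

lemma quad_scaleR: "quad \<rho> (t *\<^sub>R p) = t\<^sup>2 * quad \<rho> p"
  by (simp add: quad_def power_mult_distrib algebra_simps)

lemma polyfun_quad: "polyfun 2 (quad \<rho>)"
  using polyfun.add[OF polyfun.monom[of 2 0 2 "\<rho>\<^sup>2"] polyfun.monom[of 0 2 2 1]]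
  by (simp add: quad_def[abs_def])

lemma continuous_on_quad: "continuous_on A (quad \<rho>)"
  by (rule polyfun_continuous_on[OF polyfun_quad])

lemma quad_eq_norm: "quad \<rho> p = (norm (\<rho> * fst p, snd p))\<^sup>2"
  by (simp add: quad_def norm_Pair power_mult_distrib)

lemma ellipse_eq_vimage: "ellipse \<rho> = (\<lambda>p. (\<rho> * fst p, snd p)) -` cball 0 1"
  by (auto simp: mem_ellipse quad_eq_norm abs_square_le_1)

lemma linear_stretch: "linear (\<lambda>p::plane. (\<rho> * fst p, snd p))"
  by (rule linearI) (auto simp: algebra_simps)

lemma convex_ellipse: "convex (ellipse \<rho>)"
  unfolding ellipse_eq_vimage by (rule convex_linear_vimage[OF linear_stretch]) simp

lemma compact_ellipse:
  assumes "0 < \<rho>"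
  shows "compact (ellipse \<rho>)"
proof -
  have "p \<in> (\<lambda>p. (fst p / \<rho>, snd p)) ` cball 0 1" if "p \<in> ellipse \<rho>" for p
    using assms that unfolding ellipse_eq_vimage
    by (intro image_eqI[where x = "(\<rho> * fst p, snd p)"]) auto
  moreover have "(fst p / \<rho>, snd p) \<in> ellipse \<rho>" if "p \<in> cball 0 1" for p
    using assms that unfolding ellipse_eq_vimage by simp
  ultimately have "ellipse \<rho> = (\<lambda>p. (fst p / \<rho>, snd p)) ` cball 0 1"
    by blast
  moreover have "continuous_on (cball 0 1) (\<lambda>p. (fst p / \<rho>, snd p :: real))"
    using assms by (intro continuous_intros) auto
  ultimately show ?thesis by (metis compact_cball compact_continuous_image)
qed

text \<open>\<open>quad\<close> is homogeneous of degree 2, so every dilation by a factor above 1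
  pushes a point with \<open>quad\<close> equal to 1 out of the ellipse; such a point cannot be
  interior.\<close>

lemma interior_ellipse:
  assumes "0 < \<rho>"
  shows "interior (ellipse \<rho>) = {p. quad \<rho> p < 1}"
proof (rule interior_unique)
  show "{p. quad \<rho> p < 1} \<subseteq> ellipse \<rho>" by (auto simp: mem_ellipse)
  show "open {p. quad \<rho> p < 1}"
    by (intro open_Collect_less continuous_on_quad continuous_intros)
  fix T assume T: "T \<subseteq> ellipse \<rho>" "open T"
  show "T \<subseteq> {p. quad \<rho> p < 1}"
  proof
    fix p assume p: "p \<in> T"
    have "continuous (at 1) (\<lambda>t::real. t *\<^sub>R p)" by (intro continuous_intros)
    then have "\<forall>\<^sub>F t in at (1::real). t *\<^sub>R p \<in> T"
      using topological_tendstoD[of "\<lambda>t::real. t *\<^sub>R p"] T(2) p by (simp add: continuous_at)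
    then obtain e where e: "e > 0" "\<And>t. t \<noteq> 1 \<Longrightarrow> \<bar>t - 1\<bar> < e \<Longrightarrow> t *\<^sub>R p \<in> T"
      unfolding eventually_at by (auto simp: dist_real_def)
    have "(1 + e / 2) *\<^sub>R p \<in> T" using e by auto
    then have *: "(1 + e / 2)\<^sup>2 * quad \<rho> p \<le> 1"
      using T(1) by (auto simp: mem_ellipse quad_scaleR[symmetric])
    have "quad \<rho> p < 1"
    proof (rule ccontr)
      assume "\<not> ?thesis"
      then have "(1 + e / 2)\<^sup>2 * 1 \<le> (1 + e / 2)\<^sup>2 * quad \<rho> p"
        by (intro mult_left_mono) auto
      moreover have "1 < (1 + e / 2)\<^sup>2" using e by (intro one_less_power) auto
      ultimately show False using * by linarith
    qed
    then show "p \<in> {p. quad \<rho> p < 1}" by simp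
  qed
qed

lemma quad_boundary:
  "0 < \<rho> \<Longrightarrow> p \<in> ellipse \<rho> \<Longrightarrow> p \<notin> interior (ellipse \<rho>) \<Longrightarrow> quad \<rho> p = 1"
  by (simp add: interior_ellipse mem_ellipse)

lemma snd_le_ellipse: "p \<in> ellipse \<rho> \<Longrightarrow> (snd p)\<^sup>2 \<le> 1"
  unfolding mem_ellipse quad_def using zero_le_power2[of "\<rho> * fst p"] unfolding power_mult_distrib by linarith

text \<open>That the origin and both basis vectors lie in the ellipse makes the constant in the
  Markov inequality for \<open>partial b\<close> independent of \<rho>.\<close>

lemma ellipse_points: "(0, 0) \<in> ellipse \<rho>" "(0, 1) \<in> ellipse \<rho>" "0 \<le> \<rho> \<Longrightarrow> \<rho> \<le> 1 \<Longrightarrow> (1, 0) \<in> ellipse \<rho>"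
  by (auto simp: mem_ellipse quad_def abs_square_le_1)

lemma zero_in_interior: "0 < \<rho> \<Longrightarrow> (0, 0) \<in> interior (ellipse \<rho>)"
  by (simp add: interior_ellipse quad_def)

section \<open>Barriers and maximum principles\<close>

lemma polyfun_snd2: "polyfun 2 (\<lambda>p. c - a * (snd p)\<^sup>2)"
  using polyfun_diff[OF polyfun_const[of 2 c] polyfun.monom[of 0 2 2 a]] by simp

text \<open>The choice a = 0 also serves as the Laplacian of constants.\<close>

lemma laplacian_snd2: "laplacian (\<lambda>p. c - a * (snd p)\<^sup>2) p = - 2 * a"
proof -
  have 1: "partial b (\<lambda>p. c - a * (snd p)\<^sup>2) = (\<lambda>p. - (2 * a * snd p * snd b))" for b
    by (intro ext partial_eqI) (auto intro!: derivative_eq_intros)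
  have "partial b (\<lambda>p. - (2 * a * snd p * snd b)) p = - (2 * a * snd b * snd b)" for b
    by (rule partial_eqI) (auto intro!: derivative_eq_intros)
  then have "laplacian (\<lambda>p. c - a * (snd p)\<^sup>2) p
      = - (2 * a * snd (1::real, 0::real) * snd (1::real, 0::real)) + - (2 * a * snd (0::real, 1::real) * snd (0::real, 1::real))"
    unfolding laplacian_eq 1 by presburger
  then show ?thesis by simp
qed

text \<open>The strictly positive function \<open>h = 6/5 - y\<^sup>2\<close> satisfies \<open>- \<Delta>h = 2 > 33/20 h\<close>, so the
  quotient \<open>d / h\<close> cannot have a positive interior maximum.\<close>

lemma max_principle:
  assumes \<rho>: "0 < \<rho>" and cont: "continuous_on (ellipse \<rho>) d"
    and diff: "twice_diff (interior (ellipse \<rho>)) d"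
    and bdry: "\<And>p. p \<in> ellipse \<rho> \<Longrightarrow> p \<notin> interior (ellipse \<rho>) \<Longrightarrow> d p \<le> 0"
    and sub: "\<And>p. p \<in> interior (ellipse \<rho>) \<Longrightarrow> d p > 0 \<Longrightarrow> - laplacian d p \<le> 33/20 * d p"
    and x: "x \<in> ellipse \<rho>"
  shows "d x \<le> 0"
proof (rule ccontr)
  assume pos: "\<not> d x \<le> 0"
  define h :: "plane \<Rightarrow> real" where "h = (\<lambda>p. 6/5 - 1 * (snd p)\<^sup>2)"
  have h: "h p \<ge> 1/5" "h p \<le> 6/5" if "p \<in> ellipse \<rho>" for p
    using snd_le_ellipse[OF that] by (auto simp: h_def)
  have "continuous_on (ellipse \<rho>) (\<lambda>p. d p / h p)"
    using h by (intro continuous_on_divide cont) (fastforce simp: h_def intro!: continuous_intros)+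
  then obtain p where p: "p \<in> ellipse \<rho>" "\<And>y. y \<in> ellipse \<rho> \<Longrightarrow> d y / h y \<le> d p / h p"
    using continuous_attains_sup[OF compact_ellipse[OF \<rho>]] x by blast
  define M where "M = d p / h p"
  have "0 < d x / h x" using pos h[OF x] by simp
  then have "M > 0" using p(2)[OF x] unfolding M_def by linarith
  have dp: "d p = M * h p" using h[OF p(1)] unfolding M_def by simp
  then have "d p > 0" using \<open>M > 0\<close> h[OF p(1)] by simp
  then have pint: "p \<in> interior (ellipse \<rho>)" using bdry[OF p(1)] by fastforce
  \<comment> \<open>The multiple M h touches d from above at p, so the second-derivative test for d
    - M h replaces a computation with the quotient d / h.\<close>
  let ?f = "\<lambda>y. 1 * d y + (- M) * h y"
  have hd: "twice_diff (interior (ellipse \<rho>)) h"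
    unfolding h_def by (rule polyfun_twice_diff[OF polyfun_snd2])
  have "laplacian ?f p \<le> 0"
  proof (rule laplacian_nonpos_at_max[OF open_interior pint lincomb_laplacian(1)[OF open_interior diff hd]])
    fix y assume "y \<in> interior (ellipse \<rho>)"
    then have y: "y \<in> ellipse \<rho>" using interior_subset by blast
    then have "d y \<le> M * h y"
      using p(2)[OF y] h[OF y] unfolding M_def[symmetric] by (simp add: pos_divide_le_eq)
    then show "?f y \<le> ?f p" by (simp add: dp)
  qed
  moreover have "laplacian ?f p = laplacian d p + 2 * M"
    unfolding lincomb_laplacian(2)[OF open_interior diff hd pint]
    by (simp add: h_def laplacian_snd2[of "6/5" 1, simplified])
  ultimately have "2 * M \<le> 33/20 * (M * h p)"
    using sub[OF pint \<open>d p > 0\<close>] dp by simp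
  \<comment> \<open>The contradiction is 33/20 * 6/5 = 99/50 < 2.\<close>
  also have "\<dots> \<le> 33/20 * (M * (6/5))"
    using h[OF p(1)] \<open>M > 0\<close> by (intro mult_left_mono) auto
  finally show False using \<open>M > 0\<close> by simp
qed

lemma weak_max_principle:
  assumes \<rho>: "0 < \<rho>" and cont: "continuous_on (ellipse \<rho>) f" "continuous_on (ellipse \<rho>) g"
    and diff: "twice_diff (interior (ellipse \<rho>)) f" "twice_diff (interior (ellipse \<rho>)) g"
    and bdry: "\<And>p. p \<in> ellipse \<rho> \<Longrightarrow> p \<notin> interior (ellipse \<rho>) \<Longrightarrow> f p \<le> g p"
    and lap: "\<And>p. p \<in> interior (ellipse \<rho>) \<Longrightarrow> - laplacian f p \<le> - laplacian g p"
    and x: "x \<in> ellipse \<rho>"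
  shows "f x \<le> g x"
proof -
  let ?d = "\<lambda>p. 1 * f p + (- 1) * g p"
  have "?d x \<le> 0"
  proof (rule max_principle[OF \<rho>])
    show "continuous_on (ellipse \<rho>) ?d" by (intro continuous_intros cont)
    show "twice_diff (interior (ellipse \<rho>)) ?d" by (rule lincomb_laplacian(1)[OF open_interior diff])
    show "- laplacian ?d p \<le> 33/20 * ?d p" if "p \<in> interior (ellipse \<rho>)" "0 < ?d p" for p
      unfolding lincomb_laplacian(2)[OF open_interior diff that(1)] using lap[OF that(1)] that(2) by simp
  qed (use bdry x in auto)
  then show ?thesis by simp
qed

subsection \<open>The Dirichlet problem with polynomial right-hand side\<close>

text \<open>A is linear only on W, so it is replaced by a globally linear g that agrees with it on a
  basis B of W. The image of B is again independent and has as many elements; a point of W outside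
  its span would give an independent set in \<open>span B\<close> with one element too many.\<close>

lemma (in vector_space) injective_endomorphism_surj:
  assumes W: "subspace W" "W \<subseteq> span S" "finite S"
    and A: "\<And>f. f \<in> W \<Longrightarrow> A f \<in> W"
    and add: "\<And>f g. f \<in> W \<Longrightarrow> g \<in> W \<Longrightarrow> A (f + g) = A f + A g"
    and scale: "\<And>c f. f \<in> W \<Longrightarrow> A (scale c f) = scale c (A f)"
    and inj: "\<And>f. f \<in> W \<Longrightarrow> A f = 0 \<Longrightarrow> f = 0"
    and y: "y \<in> W"
  shows "\<exists>f\<in>W. A f = y"
proof -
  interpret P: vector_space_pair scale scale by unfold_locales
  obtain B where B: "B \<subseteq> W" "independent B" "W \<subseteq> span B"
    using maximal_independent_subset by blast
  have finB: "finite B"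
    using independent_span_bound[OF W(3) B(2)] B(1) W(2) by blast
  have spanB: "span B = W"
    using span_minimal[OF B(1) W(1)] B(3) by blast
  obtain g where g: "Vector_Spaces.linear scale scale g" "\<And>x. x \<in> B \<Longrightarrow> g x = A x"
    using P.linear_independent_extend[OF B(2)] by blast
  interpret g: Vector_Spaces.linear scale scale g by fact
  have A0: "A 0 = 0"
    using scale[of 0 0] subspace_0[OF W(1)] by simp
  have "subspace {x. x \<in> W \<and> g x = A x}"
    by (rule subspaceI)
      (use W(1) A0 g.zero g.add g.scale add scale
        in \<open>auto simp: subspace_0 subspace_add subspace_scale\<close>)
  then have "span B \<subseteq> {x. x \<in> W \<and> g x = A x}"
    by (rule span_minimal[rotated]) (use B(1) g(2) in auto)
  then have gA: "g x = A x" if "x \<in> W" for x using that spanB by blast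
  have "inj_on g (span B)"
    unfolding g.inj_on_iff_eq_0[OF subspace_span] using gA inj spanB by auto
  then have ind: "independent (g ` B)" and card: "card (g ` B) = card B"
    using P.linear_independent_injective_image[OF g(1) B(2)] card_image inj_on_subset[OF _ span_superset]
    by blast+
  have gB: "g ` B \<subseteq> W" using B(1) gA A by auto
  have "y \<in> span (g ` B)"
  proof (rule ccontr)
    assume n: "y \<notin> span (g ` B)"
    then have "y \<notin> g ` B" using span_base by blast
    then have "card (insert y (g ` B)) = Suc (card B)" using finB card by simp
    moreover have "independent (insert y (g ` B))" using n ind by (rule independent_insertI)
    then have "card (insert y (g ` B)) \<le> card B"
      using independent_span_bound[OF finB] gB y spanB by blast
    ultimately show False by simp
  qed
  then obtain x where "x \<in> span B" "y = g x"
    using P.linear_span_image[OF g(1)] by auto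
  then show ?thesis using spanB gA by auto
qed

interpretation plane_fun: vector_space "\<lambda>(c::real) (f::plane \<Rightarrow> real) p. c * f p"
  by unfold_locales (auto simp: fun_eq_iff algebra_simps)

lemma polyfun_span:
  assumes "polyfun n f"
  shows "f \<in> plane_fun.span ((\<lambda>(i, j) p. fst p ^ i * snd p ^ j) ` ({..n} \<times> {..n}))" (is "f \<in> plane_fun.span ?S")
  using assms
proof (induction rule: polyfun.induct)
  case (monom i j c)
  then have "(\<lambda>p. fst p ^ i * snd p ^ j) \<in> ?S"
    by (intro image_eqI[where x="(i, j)"]) auto
  then have "(\<lambda>p. c * (fst p ^ i * snd p ^ j)) \<in> plane_fun.span ?S"
    by (intro plane_fun.span_scale plane_fun.span_base)
  then show ?case by (simp add: mult.assoc)
next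
  case (add f g)
  then show ?case using plane_fun.span_add[OF add.IH] by (simp add: plus_fun_def)
qed

lemma polyfun_bump: "polyfun n g \<Longrightarrow> polyfun (n + 2) (\<lambda>p. (1 - quad \<rho> p) * g p)"
  using polyfun_mult[OF polyfun_diff[OF polyfun_const polyfun_quad]] by (simp add: add.commute)

text \<open>The product is harmonic with zero boundary values, so the maximum principle applied in
  both directions makes it vanish. In the interior the factor 1 - \<open>quad\<close> is positive
  and can be cancelled, and the identity theorem extends g = 0 to the plane.\<close>

lemma polyfun_Dirichlet_unique:
  assumes \<rho>: "0 < \<rho>" and g: "polyfun n g"
    and lap: "\<And>p. laplacian (\<lambda>p. (1 - quad \<rho> p) * g p) p = 0"
  shows "g p = 0"
proof (rule polyfun_eq_0[OF g open_interior zero_in_interior[OF \<rho>]])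
  let ?w = "\<lambda>p. (1 - quad \<rho> p) * g p"
  fix x assume x: "x \<in> interior (ellipse \<rho>)"
  then have xe: "x \<in> ellipse \<rho>" using interior_subset by blast
  note w = polyfun_bump[OF g, of \<rho>]
  have z: "polyfun 0 (\<lambda>p. 0)" by (rule polyfun_const)
  have z0: "laplacian (\<lambda>p. 0) p = 0" for p
    using laplacian_snd2[of 0 0] by simp
  have "?w x \<le> 0"
    by (rule weak_max_principle[OF \<rho> polyfun_continuous_on[OF w] polyfun_continuous_on[OF z]
        polyfun_twice_diff[OF w] polyfun_twice_diff[OF z] _ _ xe])
      (auto simp: quad_boundary[OF \<rho>] lap z0)
  moreover have "0 \<le> ?w x"
    by (rule weak_max_principle[OF \<rho> polyfun_continuous_on[OF z] polyfun_continuous_on[OF w]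
        polyfun_twice_diff[OF z] polyfun_twice_diff[OF w] _ _ xe])
      (auto simp: quad_boundary[OF \<rho>] lap z0)
  ultimately have "(1 - quad \<rho> x) * g x = 0" by linarith
  then show "g x = 0" using x by (simp add: interior_ellipse[OF \<rho>])
qed

lemma polyfun_Dirichlet_exists:
  assumes \<rho>: "0 < \<rho>" and f: "polyfun n f"
  shows "\<exists>g. polyfun n g \<and> (\<forall>p. - laplacian (\<lambda>p. (1 - quad \<rho> p) * g p) p = f p)"
proof -
  let ?W = "{g. polyfun n g}" and ?A = "\<lambda>g p. - laplacian (\<lambda>p. (1 - quad \<rho> p) * g p) p"
  have td: "twice_diff UNIV (\<lambda>p. (1 - quad \<rho> p) * g p)" if "polyfun n g" for g
    by (rule polyfun_twice_diff[OF polyfun_bump[OF that]])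
  have "\<exists>g\<in>?W. ?A g = f"
  proof (rule plane_fun.injective_endomorphism_surj)
    show "plane_fun.subspace ?W"
      by (rule plane_fun.subspaceI)
        (auto simp: plus_fun_def zero_fun_def intro: polyfun_const polyfun.add polyfun_scale)
    show "?W \<subseteq> plane_fun.span ((\<lambda>(i, j) p. fst p ^ i * snd p ^ j) ` ({..n} \<times> {..n}))"
      using polyfun_span by blast
    show "?A g \<in> ?W" if "g \<in> ?W" for g
      using polyfun_scale[OF polyfun_laplacian[OF polyfun_bump], of n g "-1" \<rho>] that by simp
    show "?A (g + h) = ?A g + ?A h" if "g \<in> ?W" "h \<in> ?W" for g h
      using lincomb_laplacian(2)[OF open_UNIV td td UNIV_I, of g h 1 1] that
      by (auto simp: fun_eq_iff algebra_simps)
    show "?A (\<lambda>p. c * g p) = (\<lambda>p. c * ?A g p)" if "g \<in> ?W" for c g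
      using lincomb_laplacian(2)[OF open_UNIV td td UNIV_I, of g g c 0] that
      by (auto simp: fun_eq_iff algebra_simps)
    show "g = 0" if "g \<in> ?W" "?A g = 0" for g
      using polyfun_Dirichlet_unique[OF \<rho>, of n g] that by (auto simp: fun_eq_iff)
  qed (use f in auto)
  then show ?thesis by (auto simp: fun_eq_iff)
qed

text \<open>The factored form is part of the specification because it yields the boundary values and
  the degree bound n + 2 at once.\<close>

definition dirichlet :: "real \<Rightarrow> nat \<Rightarrow> (plane \<Rightarrow> real) \<Rightarrow> plane \<Rightarrow> real" where
  "dirichlet \<rho> n f = (SOME w. (\<exists>g. polyfun n g \<and> w = (\<lambda>p. (1 - quad \<rho> p) * g p)) \<and>
     (\<forall>p. - laplacian w p = f p))"

lemma
  assumes "0 < \<rho>" "polyfun n f"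
  shows dirichlet_form: "\<exists>g. polyfun n g \<and> dirichlet \<rho> n f = (\<lambda>p. (1 - quad \<rho> p) * g p)"
    and laplacian_dirichlet: "- laplacian (dirichlet \<rho> n f) p = f p"
proof -
  have "\<exists>w. (\<exists>g. polyfun n g \<and> w = (\<lambda>p. (1 - quad \<rho> p) * g p)) \<and> (\<forall>p. - laplacian w p = f p)"
    using polyfun_Dirichlet_exists[OF assms] by blast
  from someI_ex[OF this]
  show "\<exists>g. polyfun n g \<and> dirichlet \<rho> n f = (\<lambda>p. (1 - quad \<rho> p) * g p)"
    "- laplacian (dirichlet \<rho> n f) p = f p"
    unfolding dirichlet_def by blast+
qed

lemma polyfun_dirichlet: "0 < \<rho> \<Longrightarrow> polyfun n f \<Longrightarrow> polyfun (n + 2) (dirichlet \<rho> n f)"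
  using dirichlet_form polyfun_bump by fastforce

lemma dirichlet_boundary: "0 < \<rho> \<Longrightarrow> polyfun n f \<Longrightarrow> quad \<rho> p = 1 \<Longrightarrow> dirichlet \<rho> n f p = 0"
  using dirichlet_form[of \<rho> n f] by force

lemma dirichlet_nonneg:
  assumes \<rho>: "0 < \<rho>" and f: "polyfun n f" and "\<And>p. p \<in> ellipse \<rho> \<Longrightarrow> 0 \<le> f p" and x: "x \<in> ellipse \<rho>"
  shows "0 \<le> dirichlet \<rho> n f x"
proof (rule weak_max_principle[OF \<rho> _ _ _ _ _ _ x])
  note w = polyfun_dirichlet[OF \<rho> f]
  show "continuous_on (ellipse \<rho>) (dirichlet \<rho> n f)" "twice_diff (interior (ellipse \<rho>)) (dirichlet \<rho> n f)"
    using w by (rule polyfun_continuous_on, rule polyfun_twice_diff)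
  show "twice_diff (interior (ellipse \<rho>)) (\<lambda>p. 0)" by (rule polyfun_twice_diff[OF polyfun_const])
  show "- laplacian (\<lambda>p. 0) p \<le> - laplacian (dirichlet \<rho> n f) p" if "p \<in> interior (ellipse \<rho>)" for p
    using laplacian_snd2[of 0 0 p] assms(3)[of p] that interior_subset[of "ellipse \<rho>"]
    unfolding laplacian_dirichlet[OF \<rho> f] by auto
qed (auto simp: quad_boundary[OF \<rho>] dirichlet_boundary[OF \<rho> f])

text \<open>The barriers are B/2 (1 - y^2) and its negative: their Laplacians are -B and B, and
  their size B/2 does not depend on \<rho>.\<close>

lemma dirichlet_bound:
  assumes \<rho>: "0 < \<rho>" and f: "polyfun n f" and B: "\<And>p. p \<in> ellipse \<rho> \<Longrightarrow> \<bar>f p\<bar> \<le> B" and x: "x \<in> ellipse \<rho>"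
  shows "\<bar>dirichlet \<rho> n f x\<bar> \<le> B / 2"
proof -
  have "0 \<le> B" using B[OF x] by linarith
  define v :: "plane \<Rightarrow> real" where "v = (\<lambda>p. B / 2 - B / 2 * (snd p)\<^sup>2)"
  define v' :: "plane \<Rightarrow> real" where "v' = (\<lambda>p. (- B / 2) - (- B / 2) * (snd p)\<^sup>2)"
  note v = polyfun_snd2[of "B / 2" "B / 2", folded v_def] polyfun_snd2[of "- B / 2" "- B / 2", folded v'_def]
  have lap: "laplacian v p = - B" "laplacian v' p = B" for p
    unfolding v_def v'_def laplacian_snd2 by auto
  have vb: "0 \<le> v p" "v' p \<le> 0" "v p \<le> B / 2" "- B / 2 \<le> v' p" if "p \<in> ellipse \<rho>" for p
  proof -
    have "B * (snd p)\<^sup>2 \<le> B * 1" "0 \<le> B * (snd p)\<^sup>2"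
      using snd_le_ellipse[OF that] \<open>0 \<le> B\<close> by (auto intro!: mult_left_mono simp del: mult_1_right)
    then show "0 \<le> v p" "v' p \<le> 0" "v p \<le> B / 2" "- B / 2 \<le> v' p" by (auto simp: v_def v'_def)
  qed
  note w = polyfun_dirichlet[OF \<rho> f]
  have bd: "dirichlet \<rho> n f p = 0" if "p \<in> ellipse \<rho>" "p \<notin> interior (ellipse \<rho>)" for p
    using dirichlet_boundary[OF \<rho> f] quad_boundary[OF \<rho>] that by blast
  have L: "- laplacian (dirichlet \<rho> n f) p \<le> B" "- B \<le> - laplacian (dirichlet \<rho> n f) p"
    if "p \<in> interior (ellipse \<rho>)" for p
    using B[of p] that interior_subset[of "ellipse \<rho>"] unfolding laplacian_dirichlet[OF \<rho> f] by force+
  have "dirichlet \<rho> n f x \<le> v x"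
    by (rule weak_max_principle[OF \<rho> polyfun_continuous_on[OF w] polyfun_continuous_on[OF v(1)]
        polyfun_twice_diff[OF w] polyfun_twice_diff[OF v(1)] _ _ x]) (use vb bd lap L in auto)
  moreover have "v' x \<le> dirichlet \<rho> n f x"
    by (rule weak_max_principle[OF \<rho> polyfun_continuous_on[OF v(2)] polyfun_continuous_on[OF w]
        polyfun_twice_diff[OF v(2)] polyfun_twice_diff[OF w] _ _ x]) (use vb bd lap L in auto)
  ultimately show ?thesis using vb[OF x] by linarith
qed

subsection \<open>A Markov inequality\<close>

text \<open>Since sin^2 \<theta> = (1 - cos 2\<theta>) / 2, multiplication by it shifts the
  frequency by one in both directions. The frequency \<open>Suc j\<close> keeps the lower neighbour
  a natural number; frequency 0 is treated separately below.\<close>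

lemma sin_sq_mult_cos:
  fixes \<theta> :: real
  shows "(sin \<theta>)\<^sup>2 * cos (2 * real (Suc j) * \<theta>) =
    1/2 * cos (2 * real (Suc j) * \<theta>) - 1/4 * cos (2 * real (Suc (Suc j)) * \<theta>) - 1/4 * cos (2 * real j * \<theta>)"
proof -
  define a where "a = 2 * real (Suc j) * \<theta>"
  have "cos (2 * real (Suc (Suc j)) * \<theta>) = cos (a + 2 * \<theta>)" "cos (2 * real j * \<theta>) = cos (a - 2 * \<theta>)"
    by (intro arg_cong[of _ _ cos]; simp add: a_def algebra_simps)+
  then have e: "cos (2 * real (Suc (Suc j)) * \<theta>) + cos (2 * real j * \<theta>) = 2 * (cos a * cos (2 * \<theta>))"
    by (simp only: cos_add cos_diff)
  have "(sin \<theta>)\<^sup>2 = (1 - cos (2 * \<theta>)) / 2" by (simp add: cos_double_sin)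
  then have "(sin \<theta>)\<^sup>2 * cos a = 1/2 * cos a - 1/4 * (2 * (cos a * cos (2 * \<theta>)))"
    by (simp only:) (simp add: diff_divide_distrib left_diff_distrib)
  then show ?thesis using e unfolding a_def[symmetric] by linarith
qed

text \<open>Horner's scheme: q = c + x r, and multiplication by x = sin^2 \<theta> raises the
  frequencies in the expansion of r by at most one.\<close>

lemma poly_sin_sq:
  assumes "degree (q :: real poly) \<le> n"
  shows "\<exists>a. \<forall>\<theta>. poly q ((sin \<theta>)\<^sup>2) = (\<Sum>j\<le>n. a j * cos (2 * real j * \<theta>))"
  using assms
proof (induction n arbitrary: q)
  case 0
  then obtain c where "q = [:c:]" by (metis degree_eq_zeroE le_zero_eq)
  then show ?case by (intro exI[of _ "\<lambda>_. c"]) simp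
next
  case (Suc n)
  obtain c r where q: "q = pCons c r" by (rule pCons_cases)
  then have "degree r \<le> n" using Suc.prems by (cases "r = 0") auto
  then obtain a where a: "\<And>\<theta>. poly r ((sin \<theta>)\<^sup>2) = (\<Sum>j\<le>n. a j * cos (2 * real j * \<theta>))"
    using Suc.IH by blast
  define sp where "sp = (\<lambda>f :: real \<Rightarrow> real. \<exists>a. \<forall>\<theta>. f \<theta> = (\<Sum>j\<le>Suc n. a j * cos (2 * real j * \<theta>)))"
  have sp_add: "sp (\<lambda>\<theta>. f \<theta> + g \<theta>)" if fg: "sp f" "sp g" for f g
  proof -
    obtain a b where "\<And>\<theta>. f \<theta> = (\<Sum>j\<le>Suc n. a j * cos (2 * real j * \<theta>))"
      "\<And>\<theta>. g \<theta> = (\<Sum>j\<le>Suc n. b j * cos (2 * real j * \<theta>))"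
      using fg unfolding sp_def by blast
    then show ?thesis unfolding sp_def
      by (intro exI[of _ "\<lambda>j. a j + b j"]) (simp add: sum.distrib distrib_right)
  qed
  have sp_cos: "sp (\<lambda>\<theta>. c * cos (2 * real j * \<theta>))" if "j \<le> Suc n" for c j
    unfolding sp_def
  proof (intro exI allI)
    fix \<theta>
    show "c * cos (2 * real j * \<theta>) = (\<Sum>i\<le>Suc n. (if i = j then c else 0) * cos (2 * real i * \<theta>))"
      using that by (simp add: if_distrib[of "\<lambda>x. x * _"] sum.delta cong: if_cong)
  qed
  have sp_const: "sp (\<lambda>\<theta>. c)" for c using sp_cos[of 0 c] by simp
  have sp_sum: "sp (\<lambda>\<theta>. \<Sum>j\<in>J. f j \<theta>)" if "\<And>j. j \<in> J \<Longrightarrow> sp (f j)" for f and J :: "nat set"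
    using that by (induction J rule: infinite_finite_induct) (auto intro: sp_add sp_const)
  have "sp (\<lambda>\<theta>. a j * ((sin \<theta>)\<^sup>2 * cos (2 * real j * \<theta>)))" if "j \<le> n" for j
  proof (cases j)
    case 0
    have "sp (\<lambda>\<theta>. a 0 / 2 + (- a 0 / 2) * cos (2 * real 1 * \<theta>))"
      by (intro sp_add sp_const sp_cos) simp
    moreover have "a 0 / 2 + (- a 0 / 2) * cos (2 * real 1 * \<theta>) = a 0 * (sin \<theta>)\<^sup>2" for \<theta>
      by (simp add: cos_double_sin right_diff_distrib)
    ultimately show ?thesis using 0 by simp
  next
    case (Suc i)
    have "sp (\<lambda>\<theta>. (a j / 2) * cos (2 * real (Suc i) * \<theta>) + ((- a j / 4) * cos (2 * real (Suc (Suc i)) * \<theta>)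
       + (- a j / 4) * cos (2 * real i * \<theta>)))"
      using that Suc by (intro sp_add sp_cos) auto
    then show ?thesis unfolding Suc sin_sq_mult_cos by (simp add: algebra_simps)
  qed
  then have "sp (\<lambda>\<theta>. c + (\<Sum>j\<in>{..n}. a j * ((sin \<theta>)\<^sup>2 * cos (2 * real j * \<theta>))))"
    by (intro sp_add sp_const sp_sum) auto
  moreover have "poly q ((sin \<theta>)\<^sup>2) = c + (\<Sum>j\<in>{..n}. a j * ((sin \<theta>)\<^sup>2 * cos (2 * real j * \<theta>)))" for \<theta>
    by (simp add: q a sum_distrib_left mult_ac)
  ultimately show ?case unfolding sp_def by simp
qed

text \<open>The frequency is an integer because the product formula for cosines produces differences
  j - k.\<close>

lemma integral_cos_multiple:
  fixes m :: int
  shows "((\<lambda>\<theta>. cos (2 * real_of_int m * \<theta>)) has_integral (if m = 0 then pi else 0)) {0..pi}"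
proof (cases "m = 0")
  case True
  then show ?thesis using has_integral_const_real[of "1::real" 0 pi] by simp
next
  case False
  have "((\<lambda>\<theta>. cos (2 * real_of_int m * \<theta>)) has_integral
      sin (2 * real_of_int m * pi) / (2 * real_of_int m) - sin (2 * real_of_int m * 0) / (2 * real_of_int m)) {0..pi}"
    by (rule fundamental_theorem_of_calculus)
      (use False in \<open>auto intro!: derivative_eq_intros simp: has_real_derivative_iff_has_vector_derivative[symmetric]\<close>)
  moreover have "sin (2 * real_of_int m * pi) = 0"
    using sin_int_2pin[of m] by (simp add: mult_ac)
  ultimately show ?thesis using False by simp
qed

text \<open>Orthogonality: the integral over [0, pi] against cos(2k\<theta>) is a k times pi/2, or
  pi if k = 0, while its modulus is at most M pi.\<close>

lemma cosine_coeff_bound: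
  fixes a :: "nat \<Rightarrow> real"
  assumes M: "\<And>\<theta>. \<bar>\<Sum>j\<le>n. a j * cos (2 * real j * \<theta>)\<bar> \<le> M" and k: "k \<le> n"
  shows "\<bar>a k\<bar> \<le> 2 * M"
proof -
  let ?f = "\<lambda>\<theta>. \<Sum>j\<le>n. a j * cos (2 * real j * \<theta>)"
  define I where "I = (\<lambda>m::int. if m = 0 then pi else 0)"
  have prod: "cos (2 * real j * \<theta>) * cos (2 * real k * \<theta>) =
    (cos (2 * real_of_int (int j - int k) * \<theta>) + cos (2 * real_of_int (int j + int k) * \<theta>)) / 2" for j \<theta>
    by (simp add: cos_times_cos algebra_simps)
  have "((\<lambda>\<theta>. \<Sum>j\<le>n. a j * (cos (2 * real j * \<theta>) * cos (2 * real k * \<theta>))) has_integral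
    (\<Sum>j\<le>n. a j * ((I (int j - int k) + I (int j + int k)) / 2))) {0..pi}"
    unfolding prod I_def
    by (intro has_integral_sum has_integral_mult_right has_integral_divide has_integral_add integral_cos_multiple) simp
  moreover have "(\<Sum>j\<le>n. a j * ((I (int j - int k) + I (int j + int k)) / 2))
      = a k * ((I 0 + I (2 * int k)) / 2)"
  proof -
    have "(\<Sum>j\<le>n. a j * ((I (int j - int k) + I (int j + int k)) / 2))
      = (\<Sum>j\<in>{k}. a j * ((I (int j - int k) + I (int j + int k)) / 2))"
      using k by (intro sum.mono_neutral_right) (auto simp: I_def)
    then show ?thesis by simp
  qed
  ultimately have int: "((\<lambda>\<theta>. ?f \<theta> * cos (2 * real k * \<theta>)) has_integral (a k * ((I 0 + I (2 * int k)) / 2))) {0..pi}"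
    by (simp only: sum_distrib_right mult.assoc)
  have "0 \<le> M" using order.trans[OF abs_ge_zero M] .
  have "\<bar>?f \<theta> * cos (2 * real k * \<theta>)\<bar> \<le> M" for \<theta>
    unfolding abs_mult using mult_mono[OF M abs_cos_le_one \<open>0 \<le> M\<close> abs_ge_zero] by simp
  then have "norm (a k * ((I 0 + I (2 * int k)) / 2)) \<le> M * Henstock_Kurzweil_Integration.content (cbox 0 pi)"
    using int by (intro has_integral_bound[OF \<open>0 \<le> M\<close>]) (auto simp: cbox_interval)
  then have "\<bar>a k\<bar> * ((I 0 + I (2 * int k)) / 2) \<le> M * pi"
    by (simp add: abs_mult I_def split: if_splits)
  moreover have "\<bar>a k\<bar> * (pi / 2) \<le> \<bar>a k\<bar> * ((I 0 + I (2 * int k)) / 2)"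
    by (intro mult_left_mono) (auto simp: I_def)
  ultimately have "\<bar>a k\<bar> * (pi / 2) \<le> (2 * M) * (pi / 2)" by linarith
  then show ?thesis by (rule mult_right_le_imp_le) simp
qed

text \<open>The substitution \<open>t = sin\<^sup>2 \<theta>\<close> turns \<open>q\<close> into a cosine polynomial with coefficients of modulus at most
  \<open>2M\<close>, and \<open>2 q'(0)\<close> is its second derivative at \<open>0\<close>.\<close>

lemma Markov_endpoint:
  fixes q :: "real poly"
  assumes deg: "degree q \<le> n" and M: "\<And>t. 0 \<le> t \<Longrightarrow> t \<le> 1 \<Longrightarrow> \<bar>poly q t\<bar> \<le> M"
  shows "\<bar>poly (pderiv q) 0\<bar> \<le> 4 * real n ^ 3 * M"
proof -
  obtain a where a: "\<And>\<theta>. poly q ((sin \<theta>)\<^sup>2) = (\<Sum>j\<le>n. a j * cos (2 * real j * \<theta>))"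
    using poly_sin_sq[OF deg] by blast
  have "((\<lambda>\<theta>. poly q ((sin \<theta>)\<^sup>2)) has_real_derivative poly (pderiv q) ((sin \<theta>)\<^sup>2) * (2 * sin \<theta> * cos \<theta>)) (at \<theta>)" for \<theta>
    by (auto intro!: derivative_eq_intros)
  moreover have "((\<lambda>\<theta>. \<Sum>j\<le>n. a j * cos (2 * real j * \<theta>)) has_real_derivative
      (\<Sum>j\<le>n. - (2 * real j * a j * sin (2 * real j * \<theta>)))) (at \<theta>)" for \<theta>
    by (auto intro!: derivative_eq_intros sum.cong)
  ultimately have d1: "poly (pderiv q) ((sin \<theta>)\<^sup>2) * (2 * sin \<theta> * cos \<theta>) =
      (\<Sum>j\<le>n. - (2 * real j * a j * sin (2 * real j * \<theta>)))" for \<theta>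
    unfolding a using DERIV_unique by blast
  have "((\<lambda>\<theta>. poly (pderiv q) ((sin \<theta>)\<^sup>2) * (2 * sin \<theta> * cos \<theta>)) has_real_derivative
      2 * poly (pderiv q) 0) (at 0)"
    by (auto intro!: derivative_eq_intros)
  moreover have "((\<lambda>\<theta>. \<Sum>j\<le>n. - (2 * real j * a j * sin (2 * real j * \<theta>))) has_real_derivative
      (\<Sum>j\<le>n. - (4 * (real j)\<^sup>2 * a j))) (at 0)"
    by (auto intro!: derivative_eq_intros sum.cong simp: power2_eq_square)
  ultimately have "2 * poly (pderiv q) 0 = (\<Sum>j\<le>n. - (4 * (real j)\<^sup>2 * a j))"
    unfolding d1 using DERIV_unique by blast
  also have "\<dots> = - 4 * (\<Sum>j\<le>n. (real j)\<^sup>2 * a j)"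
    by (simp add: sum_distrib_left sum_negf mult.assoc)
  finally have eq: "poly (pderiv q) 0 = - 2 * (\<Sum>j\<le>n. (real j)\<^sup>2 * a j)" by simp
  have bd: "\<bar>a j\<bar> \<le> 2 * M" if "j \<le> n" for j
  proof (rule cosine_coeff_bound[OF _ that])
    show "\<bar>\<Sum>j\<le>n. a j * cos (2 * real j * \<theta>)\<bar> \<le> M" for \<theta>
      unfolding a[symmetric] by (rule M) (auto simp: abs_square_le_1)
  qed
  have "0 \<le> M" using M[of 0] by linarith
  have "\<bar>\<Sum>j\<le>n. (real j)\<^sup>2 * a j\<bar> = \<bar>\<Sum>j\<in>{1..n}. (real j)\<^sup>2 * a j\<bar>"
    by (intro arg_cong[of _ _ abs] sum.mono_neutral_right) (auto simp: not_le)
  \<comment> \<open>These n equal terms give the cube. The exponent is immaterial, since any power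
    of n is later absorbed by geometric decay.\<close>
  also have "\<dots> \<le> (\<Sum>j\<in>{1..n}. (real n)\<^sup>2 * (2 * M))"
    by (rule order.trans[OF sum_abs], rule sum_mono)
      (auto simp: abs_mult intro!: mult_mono bd power_mono)
  also have "\<dots> = 2 * real n ^ 3 * M" by (simp add: power2_eq_square power3_eq_cube)
  finally show ?thesis unfolding eq by (simp add: abs_mult mult_ac)
qed

text \<open>The derivative at \<open>p\<close> in the direction \<open>v\<close> is the difference of those in the directions \<open>v - p\<close> and
  \<open>0 - p\<close>. Both point from \<open>p\<close> into \<open>K\<close>, so the inequality at an end point suffices even when \<open>p\<close> is a
  boundary point.\<close>

lemma polyfun_partial_bound:
  assumes f: "polyfun n f" and K: "convex K" "p \<in> K" "0 \<in> K" "v \<in> K"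
    and M: "\<And>x. x \<in> K \<Longrightarrow> \<bar>f x\<bar> \<le> M"
  shows "\<bar>partial v f p\<bar> \<le> 8 * real n ^ 3 * M"
proof -
  have *: "\<bar>partial (c - p) f p\<bar> \<le> 4 * real n ^ 3 * M" if "c \<in> K" for c
  proof -
    obtain q where q: "degree q \<le> n" "\<And>t. poly q t = f (p + t *\<^sub>R (c - p))"
      using polyfun_line[OF f, of p "c - p"] by blast
    have "((\<lambda>t::real. p + t *\<^sub>R (c - p)) has_derivative (\<lambda>s. s *\<^sub>R (c - p))) (at 0)"
      by (auto intro!: derivative_eq_intros)
    moreover have fd: "(f has_derivative (\<lambda>h. partial h f p)) (at p)"
      by (intro has_derivative_partial polyfun_differentiable[OF f])
    ultimately have "((\<lambda>t. f (p + t *\<^sub>R (c - p))) has_derivative (\<lambda>s. partial (s *\<^sub>R (c - p)) f p)) (at 0)"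
      using has_derivative_compose[of "\<lambda>t. p + t *\<^sub>R (c - p)" _ 0 UNIV f] by simp
    moreover have "partial (s *\<^sub>R (c - p)) f p = partial (c - p) f p * s" for s
      using linear_cmul[OF has_derivative_linear[OF fd]] by simp
    ultimately have "(poly q has_real_derivative partial (c - p) f p) (at 0)"
      unfolding has_field_derivative_def q(2)[abs_def] by simp
    then have "partial (c - p) f p = poly (pderiv q) 0"
      using DERIV_unique poly_DERIV by blast
    moreover have "\<bar>poly (pderiv q) 0\<bar> \<le> 4 * real n ^ 3 * M"
    proof (rule Markov_endpoint[OF q(1)])
      fix t :: real assume "0 \<le> t" "t \<le> 1"
      then have "(1 - t) *\<^sub>R p + t *\<^sub>R c \<in> K"
        using K that unfolding convex_alt by auto
      then show "\<bar>poly q t\<bar> \<le> M"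
        unfolding q(2) by (intro M) (simp add: algebra_simps)
    qed
    ultimately show ?thesis by simp
  qed
  have "partial ((v - p) - (0 - p)) f p = partial (v - p) f p - partial (0 - p) f p"
    by (rule linear_diff[OF has_derivative_linear[OF has_derivative_partial[OF polyfun_differentiable[OF f]]]])
  then show ?thesis using *[OF K(4)] *[OF K(3)] by simp
qed

lemma polyfun_ellipse_partial_bound:
  assumes "0 < \<rho>" "\<rho> \<le> 1" "polyfun n f" "\<And>x. x \<in> ellipse \<rho> \<Longrightarrow> \<bar>f x\<bar> \<le> M" "p \<in> ellipse \<rho>" "b \<in> Basis"
  shows "\<bar>partial b f p\<bar> \<le> 8 * real n ^ 3 * M"
proof (rule polyfun_partial_bound[OF assms(3) convex_ellipse assms(5) _ _ assms(4)])
  show "0 \<in> ellipse \<rho>" using ellipse_points(1) by (simp add: zero_prod_def)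
  show "b \<in> ellipse \<rho>" using assms ellipse_points[of \<rho>] by (auto simp: Basis_plane)
qed

subsection \<open>Series of polynomials in \<open>C\<^sup>2\<^sub>0\<close>\<close>

text \<open>Bounds in the two basis directions suffice: by linearity the derivative in direction h
  is at most \<open>norm h * (2 * M k)\<close>, so the series of total derivatives converges
  uniformly in operator norm.\<close>

lemma has_derivative_suminf_partial:
  fixes f :: "nat \<Rightarrow> plane \<Rightarrow> real"
  assumes U: "open U" "convex U" "x \<in> U"
    and diff: "\<And>k x. x \<in> U \<Longrightarrow> f k differentiable (at x)"
    and bf: "\<And>k x. x \<in> U \<Longrightarrow> \<bar>f k x\<bar> \<le> M k"
    and bd: "\<And>k x b. x \<in> U \<Longrightarrow> b \<in> Basis \<Longrightarrow> \<bar>partial b (f k) x\<bar> \<le> M k"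
    and M: "summable M"
  shows "((\<lambda>x. \<Sum>k. f k x) has_derivative (\<lambda>h. \<Sum>k. partial h (f k) x)) (at x)"
proof -
  have pd: "\<bar>partial h (f k) x\<bar> \<le> norm h * (2 * M k)" if "x \<in> U" for h k x
  proof -
    note lin = has_derivative_linear[OF has_derivative_partial[OF diff[OF that, of k]]]
    have "h = fst h *\<^sub>R (1, 0) + snd h *\<^sub>R (0, 1)" by (simp add: prod_eq_iff)
    then have "partial h (f k) x = fst h * partial (1, 0) (f k) x + snd h * partial (0, 1) (f k) x"
      using linear_add[OF lin, of "fst h *\<^sub>R (1, 0)" "snd h *\<^sub>R (0, 1)"]
        linear_cmul[OF lin, of "fst h" "(1, 0)"] linear_cmul[OF lin, of "snd h" "(0, 1)"] by simp
    moreover have "\<bar>fst h * partial (1, 0) (f k) x\<bar> \<le> norm h * M k"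
      unfolding abs_mult by (intro mult_mono bd that) (auto simp: Basis_plane norm_fst_le[of "fst h" "snd h", simplified])
    moreover have "\<bar>snd h * partial (0, 1) (f k) x\<bar> \<le> norm h * M k"
      unfolding abs_mult by (intro mult_mono bd that) (auto simp: Basis_plane norm_snd_le[of "snd h" "fst h", simplified])
    ultimately show ?thesis by linarith
  qed
  have sf: "summable (\<lambda>k. f k x)" if "x \<in> U" for x
    by (rule summable_comparison_test'[OF M]) (use bf[OF that] in auto)
  have M2: "summable (\<lambda>k. 2 * M k)" using M by (rule summable_mult)
  have spd: "summable (\<lambda>k. partial h (f k) x)" if "x \<in> U" for x h
    by (rule summable_comparison_test'[OF summable_mult[OF M2, of "norm h"]]) (use pd[OF that] in auto)
  have "\<exists>g. \<forall>x\<in>U. (\<lambda>n. f n x) sums g x \<and> (g has_derivative (\<lambda>h. \<Sum>k. partial h (f k) x)) (at x within U)"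
  proof (rule has_derivative_series[OF U(2) _ _ U(3)])
    show "(f n has_derivative (\<lambda>h. partial h (f n) x)) (at x within U)" if "x \<in> U" for n x
      using has_derivative_partial[OF diff[OF that]] by (rule has_derivative_at_withinI)
    show "(\<lambda>n. f n x) sums (\<Sum>k. f k x)" using sf[OF U(3)] by (rule summable_sums)
    fix e :: real assume "e > 0"
    then obtain n0 where n0: "\<And>n. n \<ge> n0 \<Longrightarrow> norm (\<Sum>k. 2 * M (k + n)) < e"
      using suminf_exist_split[OF _ M2] by blast
    have "norm ((\<Sum>i<n. partial h (f i) x) - (\<Sum>k. partial h (f k) x)) \<le> e * norm h"
      if n: "n \<ge> n0" and x: "x \<in> U" for n x h
    proof -
      have "(\<Sum>k. partial h (f k) x) - (\<Sum>i<n. partial h (f i) x) = (\<Sum>k. partial h (f (k + n)) x)"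
        by (rule suminf_minus_initial_segment[OF spd[OF x], symmetric])
      moreover have "norm (\<Sum>k. partial h (f (k + n)) x) \<le> (\<Sum>k. norm h * (2 * M (k + n)))"
      proof (rule norm_suminf_le)
        show "norm (partial h (f (k + n)) x) \<le> norm h * (2 * M (k + n))" for k
          using pd[OF x] by simp
        show "summable (\<lambda>k. norm h * (2 * M (k + n)))"
          by (intro summable_mult summable_ignore_initial_segment M)
      qed
      moreover have "(\<Sum>k. norm h * (2 * M (k + n))) = norm h * (\<Sum>k. 2 * M (k + n))"
        by (intro suminf_mult summable_mult summable_ignore_initial_segment M)
      moreover have "norm h * (\<Sum>k. 2 * M (k + n)) \<le> norm h * e"
        using n0[OF n] by (intro mult_left_mono) auto
      ultimately show ?thesis by (simp add: norm_minus_commute mult.commute)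
    qed
    then show "\<forall>\<^sub>F n in sequentially. \<forall>x\<in>U. \<forall>h. norm ((\<Sum>i<n. partial h (f i) x) - (\<Sum>k. partial h (f k) x)) \<le> e * norm h"
      unfolding eventually_sequentially by blast
  qed
  then obtain g where g: "\<forall>x\<in>U. (\<lambda>n. f n x) sums g x \<and>
      (g has_derivative (\<lambda>h. \<Sum>k. partial h (f k) x)) (at x within U)"
    by blast
  then have g2: "(g has_derivative (\<lambda>h. \<Sum>k. partial h (f k) x)) (at x)"
    using at_within_open[OF U(3,1)] U(3) by fastforce
  show ?thesis
    by (rule has_derivative_transform_within_open[OF g2 U(1,3)]) (use g in \<open>simp add: sums_iff\<close>)
qed

text \<open>A single majorant N controls the functions and all derivatives up to order two, so a
  series with coefficients c k lies in \<open>C20\<close> as soon as the products of |c k| and N k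
  are summable.\<close>

locale ellipse_series =
  fixes \<rho> :: real and a :: "nat \<Rightarrow> plane \<Rightarrow> real" and N :: "nat \<Rightarrow> real"
  assumes \<rho>: "0 < \<rho>"
    and poly: "\<And>k. \<exists>n. polyfun n (a k)"
    and bdry: "\<And>k p. quad \<rho> p = 1 \<Longrightarrow> a k p = 0"
    and N0: "\<And>k p. p \<in> ellipse \<rho> \<Longrightarrow> \<bar>a k p\<bar> \<le> N k"
    and N1: "\<And>k p b. p \<in> ellipse \<rho> \<Longrightarrow> b \<in> Basis \<Longrightarrow> \<bar>partial b (a k) p\<bar> \<le> N k"
    and N2: "\<And>k p b c. p \<in> ellipse \<rho> \<Longrightarrow> b \<in> Basis \<Longrightarrow> c \<in> Basis \<Longrightarrow>
      \<bar>partial b (partial c (a k)) p\<bar> \<le> N k"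
begin

abbreviation "K \<equiv> ellipse \<rho>"

text \<open>The value 0 off the interior is the normalisation required by \<open>C20\<close>. Since
  every term vanishes on the boundary, the series formula remains valid on all of K.\<close>

definition series_fun :: "(nat \<Rightarrow> real) \<Rightarrow> plane \<Rightarrow> real" where
  "series_fun c = (\<lambda>p. if p \<in> interior K then \<Sum>k. c k * a k p else 0)"

definition admissible :: "(nat \<Rightarrow> real) \<Rightarrow> bool" where
  "admissible c \<longleftrightarrow> summable (\<lambda>k. \<bar>c k\<bar> * N k)"

lemma series_fun_eq: "p \<in> K \<Longrightarrow> series_fun c p = (\<Sum>k. c k * a k p)"
  using bdry[OF quad_boundary[OF \<rho>]] by (simp add: series_fun_def)

lemma intK: "p \<in> interior K \<Longrightarrow> p \<in> K"
  using interior_subset by blast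

lemma N_nonneg: "0 \<le> N k"
  using N0[OF ellipse_points(1)] abs_ge_zero order.trans by blast

lemma summable_bounded:
  assumes "admissible c" "\<And>k. \<bar>h k\<bar> \<le> N k"
  shows "summable (\<lambda>k. c k * h k)"
proof (rule summable_comparison_test'[OF assms(1)[unfolded admissible_def]])
  show "norm (c k * h k) \<le> \<bar>c k\<bar> * N k" for k
    using assms(2)[of k] by (auto simp: abs_mult intro: mult_left_mono)
qed

lemma suminf_bounded:
  assumes "admissible c" "\<And>k. \<bar>h k\<bar> \<le> N k"
  shows "\<bar>\<Sum>k. c k * h k\<bar> \<le> (\<Sum>k. \<bar>c k\<bar> * N k)"
proof -
  have "norm (c k * h k) \<le> \<bar>c k\<bar> * N k" for k
    using assms(2)[of k] by (auto simp: abs_mult intro: mult_left_mono)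
  from norm_suminf_le[OF this assms(1)[unfolded admissible_def]] show ?thesis by simp
qed

lemma continuous_on_series:
  assumes "admissible c" "\<And>k. continuous_on K (h k)" "\<And>k p. p \<in> K \<Longrightarrow> \<bar>h k p\<bar> \<le> N k"
  shows "continuous_on K (\<lambda>p. \<Sum>k. c k * h k p)"
proof (rule uniform_limit_theorem[OF _ Weierstrass_m_test])
  show "\<forall>\<^sub>F n in sequentially. continuous_on K (\<lambda>p. \<Sum>k<n. c k * h k p)"
    by (intro always_eventually allI continuous_intros assms(2))
  show "norm (c k * h k p) \<le> \<bar>c k\<bar> * N k" if "p \<in> K" for k p
    using assms(3)[OF that] by (auto simp: abs_mult intro: mult_left_mono)
  show "summable (\<lambda>k. \<bar>c k\<bar> * N k)" using assms(1) unfolding admissible_def .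
qed simp

lemma convex_interior_K: "convex (interior K)"
  by (rule convex_interior[OF convex_ellipse])

lemma has_derivative_series_bounded:
  assumes c: "admissible c" and h: "\<And>k. \<exists>n. polyfun n (h k)" "\<And>k p. p \<in> K \<Longrightarrow> \<bar>h k p\<bar> \<le> N k"
    "\<And>k p b. p \<in> K \<Longrightarrow> b \<in> Basis \<Longrightarrow> \<bar>partial b (h k) p\<bar> \<le> N k" and p: "p \<in> interior K"
  shows "((\<lambda>p. \<Sum>k. c k * h k p) has_derivative (\<lambda>v. \<Sum>k. c k * partial v (h k) p)) (at p)"
proof -
  have d: "h k differentiable (at x)" for k x
    using h(1) polyfun_differentiable by blast
  have pc: "partial v (\<lambda>p. c k * h k p) x = c k * partial v (h k) x" for k v x
    using partial_lincomb[OF d d, of v "c k" k 0 k] by simp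
  have "((\<lambda>p. \<Sum>k. c k * h k p) has_derivative (\<lambda>v. \<Sum>k. partial v (\<lambda>p. c k * h k p) p)) (at p)"
  proof (rule has_derivative_suminf_partial[OF open_interior convex_interior_K p])
    show "(\<lambda>p. c k * h k p) differentiable (at x)" for k x
      by (intro differentiable_mult d) simp
    show "summable (\<lambda>k. \<bar>c k\<bar> * N k)" using c unfolding admissible_def .
    show "\<bar>c k * h k x\<bar> \<le> \<bar>c k\<bar> * N k" if "x \<in> interior K" for k x
      using h(2)[OF intK[OF that]] by (simp add: abs_mult mult_left_mono)
    show "\<bar>partial b (\<lambda>p. c k * h k p) x\<bar> \<le> \<bar>c k\<bar> * N k" if "x \<in> interior K" "b \<in> Basis" for k x b
      unfolding pc using h(3)[OF intK[OF that(1)] that(2)] by (simp add: abs_mult mult_left_mono)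
  qed
  then show ?thesis unfolding pc .
qed

lemma poly1: "\<exists>n. polyfun n (partial b (a k))"
  using poly polyfun_partial by blast

lemma poly2: "\<exists>n. polyfun n (partial c (partial b (a k)))"
  using poly1 polyfun_partial by blast

lemma series_fun_differentiable:
  assumes "admissible c" "p \<in> interior K"
  shows "series_fun c differentiable (at p)" and "partial b (series_fun c) p = (\<Sum>k. c k * partial b (a k) p)"
proof -
  have "(series_fun c has_derivative (\<lambda>v. \<Sum>k. c k * partial v (a k) p)) (at p)"
    by (rule has_derivative_transform_within_open[OF
        has_derivative_series_bounded[OF assms(1) poly N0 N1 assms(2)] open_interior assms(2)])
      (auto simp: series_fun_def)
  then show "series_fun c differentiable (at p)" "partial b (series_fun c) p = (\<Sum>k. c k * partial b (a k) p)"
    by (auto simp: differentiable_def partial_eqI)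
qed

lemma series_fun_differentiable2:
  assumes "admissible c" "p \<in> interior K" "b \<in> Basis"
  shows "partial b (series_fun c) differentiable (at p)"
    and "partial d (partial b (series_fun c)) p = (\<Sum>k. c k * partial d (partial b (a k)) p)"
proof -
  have "(partial b (series_fun c) has_derivative (\<lambda>v. \<Sum>k. c k * partial v (partial b (a k)) p)) (at p)"
    by (rule has_derivative_transform_within_open[OF
        has_derivative_series_bounded[OF assms(1) poly1 N1[OF _ assms(3)] N2[OF _ _ assms(3)] assms(2)] open_interior assms(2)])
      (auto simp: series_fun_differentiable[OF assms(1)])
  then show "partial b (series_fun c) differentiable (at p)"
    "partial d (partial b (series_fun c)) p = (\<Sum>k. c k * partial d (partial b (a k)) p)"
    by (auto simp: differentiable_def partial_eqI)
qed

lemma laplacian_series_fun: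
  assumes c: "admissible c" and p: "p \<in> interior K"
  shows "(\<lambda>k. c k * laplacian (a k) p) sums laplacian (series_fun c) p"
proof -
  have "(\<lambda>k. c k * partial b (partial b (a k)) p) sums partial b (partial b (series_fun c)) p" if "b \<in> Basis" for b
    unfolding series_fun_differentiable2(2)[OF c p that]
    by (intro summable_sums summable_bounded[OF c] N2 intK[OF p] that)
  then have "(\<lambda>k. \<Sum>b\<in>Basis. c k * partial b (partial b (a k)) p) sums (\<Sum>b\<in>Basis. partial b (partial b (series_fun c)) p)"
    by (rule sums_sum)
  then show ?thesis by (simp add: laplacian_def sum_distrib_left)
qed

lemma series_fun_C20:
  assumes c: "admissible c"
  shows "series_fun c \<in> C20 K"
proof -
  have cont: "continuous_on K h" if "\<exists>n. polyfun n h" for h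
    using that polyfun_continuous_on by blast
  have e1: "continuous_on K (\<lambda>p. \<Sum>k. c k * partial b (a k) p)" if "b \<in> Basis" for b
    by (intro continuous_on_series[OF c] cont poly1 N1 that)
  have e2: "continuous_on K (\<lambda>p. \<Sum>k. c k * partial b (partial d (a k)) p)" if "b \<in> Basis" "d \<in> Basis" for b d
    by (intro continuous_on_series[OF c] cont poly2 N2 that)
  have "continuous_on K (\<lambda>p. \<Sum>k. c k * a k p)"
    by (intro continuous_on_series[OF c] cont poly N0)
  then have "continuous_on K (series_fun c)"
    by (simp add: series_fun_eq cong: continuous_on_cong)
  moreover have "Ck 2 (interior K) (series_fun c)"
  proof -
    have "continuous_on (interior K) (partial b (partial d (series_fun c)))" if "b \<in> Basis" "d \<in> Basis" for b d
      using continuous_on_subset[OF e2[OF that] interior_subset] series_fun_differentiable2(2)[OF c _ that(2)]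
      by (simp cong: continuous_on_cong)
    then show ?thesis
      by (simp add: numeral_2_eq_2 series_fun_differentiable(1)[OF c] series_fun_differentiable2(1)[OF c])
  qed
  moreover have "extends_to_closure K (partial b (series_fun c))" if "b \<in> Basis" for b
    unfolding extends_to_closure_def
    by (intro exI[of _ "\<lambda>p. \<Sum>k. c k * partial b (a k) p"] conjI e1 that) (simp add: series_fun_differentiable(2)[OF c])
  moreover have "extends_to_closure K (partial b (partial d (series_fun c)))" if "b \<in> Basis" "d \<in> Basis" for b d
    unfolding extends_to_closure_def
    by (intro exI[of _ "\<lambda>p. \<Sum>k. c k * partial b (partial d (a k)) p"] conjI e2 that)
      (simp add: series_fun_differentiable2(2)[OF c _ that(2)])
  ultimately show ?thesis unfolding C20_def by (simp add: series_fun_def)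
qed

text \<open>The norm consists of 1 + 2 + 4 = 7 suprema, each bounded by the same majorant series.
  That bound also shows that the sets are bounded above, without which nothing could be said about
  \<open>SUP\<close>, not even its sign.\<close>

lemma C2_norm_series_fun:
  assumes c: "admissible c"
  shows "0 \<le> C2_norm K (series_fun c)" "C2_norm K (series_fun c) \<le> 7 * (\<Sum>k. \<bar>c k\<bar> * N k)"
proof -
  let ?S = "\<Sum>k. \<bar>c k\<bar> * N k"
  have ne: "interior K \<noteq> {}" using zero_in_interior[OF \<rho>] by blast
  have SUP: "0 \<le> (SUP p\<in>interior K. \<bar>h p\<bar>) \<and> (SUP p\<in>interior K. \<bar>h p\<bar>) \<le> ?S"
    if "\<And>p. p \<in> interior K \<Longrightarrow> \<bar>h p\<bar> \<le> ?S" for h :: "plane \<Rightarrow> real"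
  proof
    show "(SUP p\<in>interior K. \<bar>h p\<bar>) \<le> ?S" using ne that by (rule cSUP_least)
    have "bdd_above ((\<lambda>p. \<bar>h p\<bar>) ` interior K)" using that by (rule bdd_aboveI2)
    then have "\<bar>h (0, 0)\<bar> \<le> (SUP p\<in>interior K. \<bar>h p\<bar>)"
      by (rule cSUP_upper[OF zero_in_interior[OF \<rho>]])
    then show "0 \<le> (SUP p\<in>interior K. \<bar>h p\<bar>)" by (meson abs_ge_zero order.trans)
  qed
  have 0: "\<bar>series_fun c p\<bar> \<le> ?S" if "p \<in> interior K" for p
    unfolding series_fun_eq[OF intK[OF that]] by (intro suminf_bounded[OF c] N0 intK[OF that])
  have 1: "\<bar>partial b (series_fun c) p\<bar> \<le> ?S" if "p \<in> interior K" "b \<in> Basis" for p b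
    unfolding series_fun_differentiable(2)[OF c that(1)] by (intro suminf_bounded[OF c] N1 intK[OF that(1)] that)
  have 2: "\<bar>partial d (partial b (series_fun c)) p\<bar> \<le> ?S" if "p \<in> interior K" "d \<in> Basis" "b \<in> Basis" for p b d
    unfolding series_fun_differentiable2(2)[OF c that(1,3)] by (intro suminf_bounded[OF c] N2 intK[OF that(1)] that)
  have B: "(1, 0) \<in> (Basis :: plane set)" "(0, 1) \<in> (Basis :: plane set)" by (auto simp: Basis_plane)
  note all = SUP[of "series_fun c", OF 0]
    SUP[of "partial (1, 0) (series_fun c)", OF 1[OF _ B(1)]] SUP[of "partial (0, 1) (series_fun c)", OF 1[OF _ B(2)]]
    SUP[of "partial (1, 0) (partial (1, 0) (series_fun c))", OF 2[OF _ B(1) B(1)]]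
    SUP[of "partial (1, 0) (partial (0, 1) (series_fun c))", OF 2[OF _ B(1) B(2)]]
    SUP[of "partial (0, 1) (partial (1, 0) (series_fun c))", OF 2[OF _ B(2) B(1)]]
    SUP[of "partial (0, 1) (partial (0, 1) (series_fun c))", OF 2[OF _ B(2) B(2)]]
  have eq: "C2_norm K (series_fun c) = (SUP p\<in>interior K. \<bar>series_fun c p\<bar>)
     + ((SUP p\<in>interior K. \<bar>partial (1, 0) (series_fun c) p\<bar>) + (SUP p\<in>interior K. \<bar>partial (0, 1) (series_fun c) p\<bar>))
     + (((SUP p\<in>interior K. \<bar>partial (1, 0) (partial (1, 0) (series_fun c)) p\<bar>) + (SUP p\<in>interior K. \<bar>partial (1, 0) (partial (0, 1) (series_fun c)) p\<bar>))
      + ((SUP p\<in>interior K. \<bar>partial (0, 1) (partial (1, 0) (series_fun c)) p\<bar>) + (SUP p\<in>interior K. \<bar>partial (0, 1) (partial (0, 1) (series_fun c)) p\<bar>)))"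
    unfolding C2_norm_def Basis_plane by simp
  show "0 \<le> C2_norm K (series_fun c)" "C2_norm K (series_fun c) \<le> 7 * ?S"
    unfolding eq using all by linarith+
qed

end

section \<open>Power series in a real parameter as smooth curves in \<open>C20\<close>\<close>

lemma summable_power_times:
  "\<bar>x\<bar> < 1 \<Longrightarrow> summable (\<lambda>n. real n ^ m * (x::real) ^ n)"
proof (induction m arbitrary: x)
  case 0
  then show ?case by (simp add: summable_geometric)
next
  case (Suc m)
  \<comment> \<open>Each additional factor n comes from one termwise differentiation, which
    preserves the radius of convergence 1.\<close>
  have "summable (\<lambda>n. diffs (\<lambda>n. real n ^ m) n * x ^ n)"
    by (rule termdiff_converges[where K = 1]) (use Suc in auto)
  then have "summable (\<lambda>n. x * (real (Suc n) ^ Suc m * x ^ n))"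
    by (intro summable_mult) (simp add: diffs_def)
  then have "summable (\<lambda>n. real (Suc n) ^ Suc m * x ^ Suc n)"
    by (simp add: mult_ac)
  then show ?case by (subst summable_Suc_iff[symmetric])
qed

text \<open>For \<open>k < j\<close> the subtraction \<open>k - j\<close> is truncated, but then the falling factorial is \<open>0\<close>.\<close>

definition power_deriv :: "nat \<Rightarrow> real \<Rightarrow> nat \<Rightarrow> real" where
  "power_deriv j l k = (\<Prod>i<j. real k - real i) * l ^ (k - j)"

lemma prod_falling_zero: "k < j \<Longrightarrow> (\<Prod>i<j. real k - real i) = 0"
  by (rule prod_zero) auto

lemma prod_falling_bound: "\<bar>\<Prod>i<j. real k - real i\<bar> \<le> real k ^ j"
proof (cases "k < j")
  case True
  then show ?thesis by (simp add: prod_falling_zero)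
next
  case False
  have "\<bar>\<Prod>i<j. real k - real i\<bar> = (\<Prod>i<j. \<bar>real k - real i\<bar>)" by (rule abs_prod)
  also have "\<dots> \<le> (\<Prod>i<j. real k)" using False by (intro prod_mono) auto
  finally show ?thesis by simp
qed

lemma power_deriv_Suc:
  "power_deriv (Suc j) l k = (\<Prod>i<j. real k - real i) * (real (k - j) * l ^ (k - j - 1))"
proof (cases "k < j")
  case True
  then show ?thesis by (simp add: power_deriv_def prod_falling_zero)
next
  case False
  then show ?thesis by (simp add: power_deriv_def of_nat_diff)
qed

lemma power_deriv_bound:
  assumes "\<bar>l\<bar> \<le> R" "1 \<le> R"
  shows "\<bar>power_deriv j l k\<bar> \<le> real k ^ j * R ^ k"
proof -
  have "\<bar>l\<bar> ^ (k - j) \<le> R ^ (k - j)" using assms by (intro power_mono) auto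
  also have "\<dots> \<le> R ^ k" using assms by (intro power_increasing) auto
  finally show ?thesis unfolding power_deriv_def abs_mult power_abs
    by (intro mult_mono prod_falling_bound) auto
qed

text \<open>Up to the falling factorial, bounded by k^j, this is the difference quotient error of
  the power with exponent k - j, whose second derivative contributes the other k^2.\<close>

lemma power_deriv_quotient:
  assumes "\<bar>l\<bar> \<le> R" "\<bar>t\<bar> \<le> R" "1 \<le> R" "t \<noteq> l"
  shows "\<bar>(power_deriv j t k - power_deriv j l k) / (t - l) - power_deriv (Suc j) l k\<bar>
    \<le> \<bar>t - l\<bar> * (real k ^ (j + 2) * R ^ k)"
proof -
  let ?c = "\<Prod>i<j. real k - real i" and ?m = "k - j"
  have "(power_deriv j t k - power_deriv j l k) / (t - l) - power_deriv (Suc j) l k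
    = ?c * ((t ^ ?m - l ^ ?m) / (t - l) - real ?m * l ^ (?m - 1))"
    unfolding power_deriv_Suc by (simp add: power_deriv_def right_diff_distrib diff_divide_distrib)
  moreover have "\<bar>(t ^ ?m - l ^ ?m) / (t - l) - real ?m * l ^ (?m - 1)\<bar> \<le> real k * real k * R ^ k * \<bar>t - l\<bar>"
  proof -
    have "\<bar>(t ^ ?m - l ^ ?m) / (t - l) - real ?m * l ^ (?m - 1)\<bar>
        \<le> real ?m * real (?m - 1) * R ^ (?m - 2) * \<bar>t - l\<bar>"
      using lemma_termdiff3[of "t - l" l R ?m] assms by simp
    also have "\<dots> \<le> real k * real k * R ^ k * \<bar>t - l\<bar>"
      using assms by (intro mult_mono power_increasing mult_nonneg_nonneg) auto
    finally show ?thesis .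
  qed
  ultimately have "\<bar>(power_deriv j t k - power_deriv j l k) / (t - l) - power_deriv (Suc j) l k\<bar>
     \<le> real k ^ j * (real k * real k * R ^ k * \<bar>t - l\<bar>)"
    unfolding abs_mult by (auto intro!: mult_mono prod_falling_bound simp: abs_mult)
  also have "\<dots> = \<bar>t - l\<bar> * (real k ^ (j + 2) * R ^ k)"
    by (simp add: power_add power2_eq_square mult_ac)
  finally show ?thesis .
qed

text \<open>The parameter l ranges over |l| <= R, strictly inside the radius of convergence 1/A, so
  polynomial factors in k stay summable. With 1 <= R the powers of R increase, which removes the
  shift in \<open>l ^ (k - j)\<close>.\<close>

locale geometric_series = ellipse_series \<rho> a "\<lambda>k. B * A ^ k" for \<rho> a and B A :: real +
  fixes R :: real
  assumes A: "0 \<le> A" "A * R < 1" and R: "1 \<le> R"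
begin

text \<open>The j-th termwise derivative in l of the power series with coefficients a k.\<close>

definition curve :: "nat \<Rightarrow> real \<Rightarrow> plane \<Rightarrow> real" where
  "curve j l = series_fun (power_deriv j l)"

lemma B_nonneg: "0 \<le> B" using N_nonneg[of 0] by simp

lemma summable_major: "summable (\<lambda>k. (real k ^ m * R ^ k) * (B * A ^ k))"
proof -
  have "\<bar>A * R\<bar> < 1" using A R by simp
  from summable_mult[OF summable_power_times[OF this, of m], of B]
  show ?thesis by (simp add: power_mult_distrib mult_ac)
qed

lemma power_deriv_major: "\<bar>l\<bar> \<le> R \<Longrightarrow> \<bar>power_deriv j l k\<bar> * (B * A ^ k) \<le> (real k ^ j * R ^ k) * (B * A ^ k)"
  by (intro mult_right_mono power_deriv_bound R) (use B_nonneg A in auto)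

lemma admissible_power_deriv: "\<bar>l\<bar> \<le> R \<Longrightarrow> admissible (power_deriv j l)"
  unfolding admissible_def by (rule summable_comparison_test'[OF summable_major[of j]])
    (use power_deriv_major B_nonneg A in \<open>auto simp: abs_mult\<close>)

lemma C2_norm_curve:
  assumes "\<bar>l\<bar> \<le> R"
  shows "C2_norm K (curve j l) \<le> 7 * (\<Sum>k. (real k ^ j * R ^ k) * (B * A ^ k))"
proof -
  have "C2_norm K (curve j l) \<le> 7 * (\<Sum>k. \<bar>power_deriv j l k\<bar> * (B * A ^ k))"
    unfolding curve_def by (rule C2_norm_series_fun(2)[OF admissible_power_deriv[OF assms]])
  also have "\<dots> \<le> 7 * (\<Sum>k. (real k ^ j * R ^ k) * (B * A ^ k))"
    by (intro mult_left_mono suminf_le summable_major power_deriv_major[OF assms]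
        admissible_power_deriv[OF assms, unfolded admissible_def]) simp
  finally show ?thesis .
qed

text \<open>The error of a difference quotient is again a series over the same functions, so its
  \<open>C2_norm\<close> is controlled by its scalar coefficients, which are O(|t - l|) in the
  weighted sum.\<close>

lemma curve_quotient:
  fixes j :: nat
  assumes "\<bar>l\<bar> \<le> R" "\<bar>t\<bar> \<le> R" "t \<noteq> l"
  defines "c \<equiv> \<lambda>k. (power_deriv j t k - power_deriv j l k) / (t - l) - power_deriv (Suc j) l k"
  shows "admissible c" "(\<Sum>k. \<bar>c k\<bar> * (B * A ^ k)) \<le> \<bar>t - l\<bar> * (\<Sum>k. (real k ^ (j + 2) * R ^ k) * (B * A ^ k))"
    "(\<lambda>p. (curve j t p - curve j l p) / (t - l) - curve (Suc j) l p) = series_fun c"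
proof -
  have le: "\<bar>c k\<bar> * (B * A ^ k) \<le> \<bar>t - l\<bar> * ((real k ^ (j + 2) * R ^ k) * (B * A ^ k))" for k
    using mult_right_mono[OF power_deriv_quotient[OF assms(1,2) R assms(3), of j k], of "B * A ^ k"] B_nonneg A
    unfolding c_def by (simp add: mult.assoc)
  have s: "summable (\<lambda>k. \<bar>t - l\<bar> * ((real k ^ (j + 2) * R ^ k) * (B * A ^ k)))"
    by (intro summable_mult summable_major)
  show admissible: "admissible c" unfolding admissible_def
    by (rule summable_comparison_test'[OF s]) (use le B_nonneg A in \<open>auto simp: abs_mult\<close>)
  have "(\<Sum>k. \<bar>c k\<bar> * (B * A ^ k)) \<le> (\<Sum>k. \<bar>t - l\<bar> * ((real k ^ (j + 2) * R ^ k) * (B * A ^ k)))"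
    by (intro suminf_le le s admissible[unfolded admissible_def])
  also have "\<dots> = \<bar>t - l\<bar> * (\<Sum>k. (real k ^ (j + 2) * R ^ k) * (B * A ^ k))"
    by (intro suminf_mult summable_major)
  finally show "(\<Sum>k. \<bar>c k\<bar> * (B * A ^ k)) \<le> \<bar>t - l\<bar> * (\<Sum>k. (real k ^ (j + 2) * R ^ k) * (B * A ^ k))" .
  show "(\<lambda>p. (curve j t p - curve j l p) / (t - l) - curve (Suc j) l p) = series_fun c"
  proof
    fix p
    show "(curve j t p - curve j l p) / (t - l) - curve (Suc j) l p = series_fun c p"
    proof (cases "p \<in> interior K")
      case True
      have s: "summable (\<lambda>k. power_deriv i s k * a k p)" if "\<bar>s\<bar> \<le> R" for i s
        by (rule summable_bounded[OF admissible_power_deriv[OF that] N0[OF intK[OF True]]])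
      have "(\<lambda>k. (power_deriv j t k * a k p - power_deriv j l k * a k p) / (t - l) - power_deriv (Suc j) l k * a k p)
        sums ((curve j t p - curve j l p) / (t - l) - curve (Suc j) l p)"
        unfolding curve_def using True
        by (auto simp: series_fun_def intro!: sums_diff sums_divide summable_sums s assms)
      moreover have "(\<lambda>k. (power_deriv j t k * a k p - power_deriv j l k * a k p) / (t - l) - power_deriv (Suc j) l k * a k p)
        = (\<lambda>k. c k * a k p)"
        unfolding c_def by (simp add: left_diff_distrib diff_divide_distrib)
      ultimately show ?thesis using True by (simp add: series_fun_def sums_iff)
    qed (simp add: curve_def series_fun_def)
  qed
qed

lemma curve_deriv_curve:
  assumes S: "\<And>l. l \<in> S \<Longrightarrow> \<bar>l\<bar> \<le> R"
  shows "curve_deriv K S j (curve 0) (curve j)"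
proof (induction j)
  case 0
  then show ?case using series_fun_C20[OF admissible_power_deriv[OF S]] by (simp add: curve_def)
next
  case (Suc j)
  have "((\<lambda>t. C2_norm K (\<lambda>p. (curve j t p - curve j l p) / (t - l) - curve (Suc j) l p)) \<longlongrightarrow> 0) (at l within S)"
    if l: "l \<in> S" for l
  proof (rule Lim_null_comparison)
    let ?T = "7 * (\<Sum>k. (real k ^ (j + 2) * R ^ k) * (B * A ^ k))"
    show "\<forall>\<^sub>F t in at l within S. norm (C2_norm K (\<lambda>p. (curve j t p - curve j l p) / (t - l) - curve (Suc j) l p)) \<le> \<bar>t - l\<bar> * ?T"
      unfolding eventually_at_filter
    proof (rule always_eventually, intro allI impI)
      fix t assume t: "t \<noteq> l" "t \<in> S"
      note q = curve_quotient[OF S[OF l] S[OF t(2)] t(1), of j]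
      show "norm (C2_norm K (\<lambda>p. (curve j t p - curve j l p) / (t - l) - curve (Suc j) l p)) \<le> \<bar>t - l\<bar> * ?T"
        unfolding q(3) using C2_norm_series_fun[OF q(1)] q(2) by simp
    qed
    have "((\<lambda>t. \<bar>t - l\<bar> * ?T) \<longlongrightarrow> \<bar>l - l\<bar> * ?T) (at l within S)" by (intro tendsto_intros)
    then show "((\<lambda>t. \<bar>t - l\<bar> * ?T) \<longlongrightarrow> 0) (at l within S)" by simp
  qed
  moreover have "curve (Suc j) l \<in> C20 K" if "l \<in> S" for l
    unfolding curve_def by (rule series_fun_C20[OF admissible_power_deriv[OF S[OF that]]])
  ultimately show ?case using Suc.IH by auto
qed

lemma smooth_curve_curve:
  assumes "\<And>l. l \<in> S \<Longrightarrow> \<bar>l\<bar> \<le> R"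
  shows "smooth_curve K S (curve 0)"
  unfolding smooth_curve_def using curve_deriv_curve[OF assms] by blast

end

subsection \<open>Exponentials of power series\<close>

text \<open>With f and u the series with coefficients b and a, the recursion says f' = u' f. Hence f
  exp(-u) is constant, and its value at 0 is 1.\<close>

lemma power_series_exp:
  fixes a b :: "nat \<Rightarrow> real"
  assumes b0: "b 0 = 1" and a0: "a 0 = 0"
    and rec: "\<And>k. real (Suc k) * b (Suc k) = (\<Sum>j\<le>k. real (Suc j) * a (Suc j) * b (k - j))"
    and sa: "\<And>x. \<bar>x\<bar> < r \<Longrightarrow> summable (\<lambda>k. a k * x ^ k)"
    and sb: "\<And>x. \<bar>x\<bar> < r \<Longrightarrow> summable (\<lambda>k. b k * x ^ k)"
    and x: "\<bar>x\<bar> < r"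
  shows "(\<Sum>k. b k * x ^ k) = exp (\<Sum>k. a k * x ^ k)"
proof -
  define u where "u = (\<lambda>x. \<Sum>k. a k * x ^ k)"
  define f where "f = (\<lambda>x. \<Sum>k. b k * x ^ k)"
  have deriv: "((\<lambda>x. \<Sum>k. c k * x ^ k) has_real_derivative (\<Sum>k. diffs c k * x ^ k)) (at x)"
    and sdiffs: "summable (\<lambda>k. norm (diffs c k * x ^ k))"
    if sc: "\<And>x. \<bar>x\<bar> < r \<Longrightarrow> summable (\<lambda>k. c k * x ^ k)" and x: "\<bar>x\<bar> < r" for c x
  proof -
    \<comment> \<open>Two intermediate radii |x| < z < y < r: one is spent on passing from c to
      \<open>diffs c\<close>, the other on absolute convergence.\<close>
    define y where "y = (\<bar>x\<bar> + r) / 2"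
    define z where "z = (\<bar>x\<bar> + y) / 2"
    have y: "\<bar>x\<bar> < z" "\<bar>z\<bar> < y" "\<bar>y\<bar> < r" "0 \<le> y" "0 \<le> z" using x unfolding y_def z_def by auto
    show "((\<lambda>x. \<Sum>k. c k * x ^ k) has_real_derivative (\<Sum>k. diffs c k * x ^ k)) (at x)"
      using termdiffs_strong[OF sc[OF y(3)], of x] y by simp
    have "summable (\<lambda>k. diffs c k * z ^ k)"
      by (rule termdiff_converges[where K = y]) (use sc y in auto)
    then show "summable (\<lambda>k. norm (diffs c k * x ^ k))"
      by (rule powser_insidea) (use y in auto)
  qed
  have nb: "summable (\<lambda>k. norm (b k * x ^ k))" if x: "\<bar>x\<bar> < r" for x
  proof (rule powser_insidea)
    show "summable (\<lambda>k. b k * ((\<bar>x\<bar> + r) / 2) ^ k)" using x by (intro sb) auto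
    show "norm x < norm ((\<bar>x\<bar> + r) / 2)" using x by auto
  qed
  have df: "(f has_real_derivative (\<Sum>k. diffs a k * x ^ k) * f x) (at x)" if x: "\<bar>x\<bar> < r" for x
  proof -
    have "(\<Sum>k. diffs a k * x ^ k) * f x = (\<Sum>k. \<Sum>j\<le>k. diffs a j * x ^ j * (b (k - j) * x ^ (k - j)))"
      unfolding f_def by (rule Cauchy_product[OF sdiffs[OF sa x] nb[OF x]])
    also have "\<dots> = (\<Sum>k. diffs b k * x ^ k)"
    proof (rule suminf_cong)
      fix k
      have "(\<Sum>j\<le>k. diffs a j * x ^ j * (b (k - j) * x ^ (k - j))) = (\<Sum>j\<le>k. real (Suc j) * a (Suc j) * b (k - j) * x ^ k)"
      proof (rule sum.cong)
        fix j assume "j \<in> {..k}"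
        then have "x ^ k = x ^ j * x ^ (k - j)" by (simp flip: power_add)
        then show "diffs a j * x ^ j * (b (k - j) * x ^ (k - j)) = real (Suc j) * a (Suc j) * b (k - j) * x ^ k"
          by (simp add: diffs_def)
      qed simp
      then show "(\<Sum>j\<le>k. diffs a j * x ^ j * (b (k - j) * x ^ (k - j))) = diffs b k * x ^ k"
        using rec[of k] by (simp add: diffs_def sum_distrib_right)
    qed
    finally show ?thesis using deriv[OF sb x] unfolding f_def by simp
  qed
  have du: "(u has_real_derivative (\<Sum>k. diffs a k * x ^ k)) (at x)" if "\<bar>x\<bar> < r" for x
    unfolding u_def by (rule deriv[OF sa that])
  have "\<exists>c. \<forall>x\<in>{-r<..<r}. f x * exp (- u x) = c"
  proof (rule has_field_derivative_zero_constant)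
    fix x assume "x \<in> {-r<..<r}"
    then have x: "\<bar>x\<bar> < r" by auto
    have "((\<lambda>x. f x * exp (- u x)) has_real_derivative 0) (at x)"
      by (rule derivative_eq_intros df[OF x] du[OF x] refl)+ simp
    then show "((\<lambda>x. f x * exp (- u x)) has_real_derivative 0) (at x within {-r<..<r})"
      by (rule has_field_derivative_at_within)
  qed simp
  then obtain c where c: "\<And>x. \<bar>x\<bar> < r \<Longrightarrow> f x * exp (- u x) = c" by (auto simp: abs_less_iff)
  have "f 0 * exp (- u 0) = 1"
    unfolding f_def u_def by (simp add: powser_zero a0 b0)
  then have "f x * exp (- u x) = 1" using c[OF x] c[of 0] x by auto
  then show ?thesis unfolding f_def u_def by (simp add: exp_minus field_simps)
qed

text \<open>For truncations f and u the recursion gives f' <= u' f, because the triangle of index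
  pairs on the left is part of the rectangle on the right and all terms are nonnegative. Thus f
  exp(-u) does not increase. No convergence is presupposed, so the bound can be used to prove
  it.\<close>

lemma partial_sum_exp_bound:
  fixes a b :: "nat \<Rightarrow> real"
  assumes b0: "b 0 = 1" and a0: "a 0 = 0"
    and rec: "\<And>k. real (Suc k) * b (Suc k) = (\<Sum>j\<le>k. real (Suc j) * a (Suc j) * b (k - j))"
    and nonneg: "\<And>k. 0 \<le> a k" "\<And>k. 0 \<le> b k" and x: "0 \<le> x"
  shows "(\<Sum>k\<le>n. b k * x ^ k) \<le> exp (\<Sum>k\<le>n. a k * x ^ k)"
proof -
  define u where "u = (\<lambda>x. \<Sum>k\<le>n. a k * x ^ k)"
  define f where "f = (\<lambda>x. \<Sum>k\<le>n. b k * x ^ k)"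
  have deriv: "((\<lambda>x. \<Sum>k\<le>n. c k * x ^ k) has_real_derivative (\<Sum>k<n. real (Suc k) * c (Suc k) * x ^ k)) (at x)" for c x
  proof -
    have "((\<lambda>x. \<Sum>k\<le>n. c k * x ^ k) has_real_derivative (\<Sum>k\<le>n. c k * (real k * x ^ (k - 1)))) (at x)"
      by (auto intro!: derivative_eq_intros sum.cong)
    moreover have "(\<Sum>k\<le>n. c k * (real k * x ^ (k - 1))) = (\<Sum>k<n. real (Suc k) * c (Suc k) * x ^ k)"
      by (subst sum.atMost_shift) (simp add: mult_ac)
    ultimately show ?thesis by simp
  qed
  have le: "(\<Sum>k<n. real (Suc k) * b (Suc k) * x ^ k) \<le> (\<Sum>k<n. real (Suc k) * a (Suc k) * x ^ k) * f x" if x: "0 \<le> x" for x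
  proof -
    let ?g = "\<lambda>j i. (real (Suc j) * a (Suc j) * x ^ j) * (b i * x ^ i)"
    have "(\<Sum>k<n. real (Suc k) * b (Suc k) * x ^ k) = (\<Sum>k<n. \<Sum>j\<le>k. ?g j (k - j))"
    proof (rule sum.cong)
      fix k
      have "real (Suc k) * b (Suc k) * x ^ k = (\<Sum>j\<le>k. real (Suc j) * a (Suc j) * b (k - j) * x ^ k)"
        unfolding rec by (rule sum_distrib_right)
      also have "\<dots> = (\<Sum>j\<le>k. ?g j (k - j))"
      proof (rule sum.cong)
        fix j assume "j \<in> {..k}"
        then have "x ^ k = x ^ j * x ^ (k - j)" by (simp flip: power_add)
        then show "real (Suc j) * a (Suc j) * b (k - j) * x ^ k = ?g j (k - j)" by simp
      qed simp
      finally show "real (Suc k) * b (Suc k) * x ^ k = (\<Sum>j\<le>k. ?g j (k - j))" .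
    qed simp
    also have "\<dots> = (\<Sum>(j, i)\<in>{(j, i). j + i < n}. ?g j i)"
      by (rule sum.triangle_reindex[symmetric])
    also have "\<dots> \<le> (\<Sum>(j, i)\<in>{..<n} \<times> {..n}. ?g j i)"
      using nonneg x by (intro sum_mono2) auto
    also have "\<dots> = (\<Sum>k<n. real (Suc k) * a (Suc k) * x ^ k) * f x"
      unfolding f_def by (simp add: sum_product sum.cartesian_product)
    finally show ?thesis .
  qed
  have "f x * exp (- u x) \<le> f 0 * exp (- u 0)"
  proof (rule DERIV_nonpos_imp_nonincreasing[OF x])
    fix y assume "0 \<le> y" "y \<le> x"
    let ?D = "(\<Sum>k<n. real (Suc k) * b (Suc k) * y ^ k) * exp (- u y)
       + f y * (exp (- u y) * - (\<Sum>k<n. real (Suc k) * a (Suc k) * y ^ k))"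
    have "((\<lambda>x. f x * exp (- u x)) has_real_derivative ?D) (at y)"
      unfolding f_def u_def by (rule derivative_eq_intros deriv refl)+ simp
    moreover have "?D = ((\<Sum>k<n. real (Suc k) * b (Suc k) * y ^ k) - (\<Sum>k<n. real (Suc k) * a (Suc k) * y ^ k) * f y) * exp (- u y)"
      by (simp add: algebra_simps)
    moreover have "\<dots> \<le> 0" using le[OF \<open>0 \<le> y\<close>] by (simp add: mult_le_0_iff)
    ultimately show "\<exists>z. ((\<lambda>x. f x * exp (- u x)) has_real_derivative z) (at y) \<and> z \<le> 0" by auto
  qed
  also have "f 0 * exp (- u 0) = 1"
  proof -
    have "(\<Sum>k\<le>n. c k * 0 ^ k) = c 0" for c :: "nat \<Rightarrow> real"
      by (subst sum.atMost_shift) simp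
    then show ?thesis unfolding f_def u_def by (simp add: a0 b0)
  qed
  finally show ?thesis unfolding f_def u_def by (simp add: exp_minus field_simps)
qed

lemma sum_inverse_squares: "(\<Sum>i\<le>j. 1 / (real (Suc i))\<^sup>2) \<le> 2 - 1 / real (Suc j)"
proof (induction j)
  case (Suc j)
  define t where "t = real (Suc j)"
  have t: "t > 0" "real (Suc (Suc j)) = t + 1" by (auto simp: t_def)
  have "1 / (t + 1)\<^sup>2 \<le> 1 / t - 1 / (t + 1)"
  proof -
    have "1 / t - 1 / (t + 1) = 1 / (t * (t + 1))" using t(1) by (simp add: field_simps)
    moreover have "t * (t + 1) \<le> (t + 1)\<^sup>2" using t(1) by (simp add: power2_eq_square algebra_simps)
    then have "1 / (t + 1)\<^sup>2 \<le> 1 / (t * (t + 1))" using t(1) by (intro divide_left_mono) auto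
    ultimately show ?thesis by simp
  qed
  then show ?case using Suc unfolding sum.atMost_Suc t(2) t_def[symmetric] by linarith
qed simp

text \<open>Put s = i + 1 and t = j - i + 1, so s + t - 1 = j + 1. Partial fractions split 1 / (s
  t^2) into 1 / (s + t) times 1 / (s t) + 1 / t^2, and s t >= s + t - 1. After factoring out 1 / (j
  + 1), the first part sums to at most 1 and the second to at most 2.\<close>

lemma convolution_bound:
  "(\<Sum>i\<le>j. 1 / (real (Suc i) * (real (Suc (j - i)))\<^sup>2)) \<le> 3 / real (Suc j)"
proof -
  have "1 / (real (Suc i) * (real (Suc (j - i)))\<^sup>2) \<le>
    1 / real (Suc j) * (1 / real (Suc j) + 1 / (real (Suc (j - i)))\<^sup>2)" if "i \<le> j" for i
  proof -
    define s t where "s = real (Suc i)" and "t = real (Suc (j - i))"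
    have st: "s \<ge> 1" "t \<ge> 1" "real (Suc j) = s + t - 1" using that by (auto simp: s_def t_def)
    have "0 \<le> (s - 1) * (t - 1)" using st by simp
    then have stle: "s + t - 1 \<le> s * t" by (simp add: algebra_simps)
    have "1 / (s * t\<^sup>2) = (1 / (s + t)) * (1 / (s * t) + 1 / t\<^sup>2)"
      using st by (simp add: field_simps power2_eq_square)
    also have "\<dots> \<le> (1 / (s + t - 1)) * (1 / (s + t - 1) + 1 / t\<^sup>2)"
      using st stle by (intro mult_mono add_mono divide_left_mono) auto
    finally show ?thesis unfolding st(3) s_def t_def .
  qed
  then have "(\<Sum>i\<le>j. 1 / (real (Suc i) * (real (Suc (j - i)))\<^sup>2)) \<le>
     (\<Sum>i\<le>j. 1 / real (Suc j) * (1 / real (Suc j) + 1 / (real (Suc (j - i)))\<^sup>2))"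
    by (intro sum_mono) auto
  also have "\<dots> = 1 / real (Suc j) * (1 + (\<Sum>i\<le>j. 1 / (real (Suc (j - i)))\<^sup>2))"
    unfolding sum_distrib_left[symmetric] sum.distrib by simp
  also have "(\<Sum>i\<le>j. 1 / (real (Suc (j - i)))\<^sup>2) = (\<Sum>i\<le>j. 1 / (real (Suc i))\<^sup>2)"
    by (rule sum.reindex_bij_witness[of _ "\<lambda>i. j - i" "\<lambda>i. j - i"]) auto
  also have "1 / real (Suc j) * (1 + (\<Sum>i\<le>j. 1 / (real (Suc i))\<^sup>2)) \<le> 1 / real (Suc j) * 3"
  proof (intro mult_left_mono)
    have "0 \<le> 1 / real (Suc j)" by simp
    then show "1 + (\<Sum>i\<le>j. 1 / (real (Suc i))\<^sup>2) \<le> 3" using sum_inverse_squares[of j] by linarith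
  qed simp
  finally show ?thesis by simp
qed

subsection \<open>The formal expansion\<close>

text \<open>The area is pi/\<rho>, so in terms of averages P reads -\<Delta>u = s exp u / avg (exp
  u) with s = \<lambda>\<rho>/pi.\<close>

definition avg :: "real \<Rightarrow> (plane \<Rightarrow> real) \<Rightarrow> real" where
  "avg \<rho> f = integral (ellipse \<rho>) f / measure lborel (ellipse \<rho>)"

text \<open>The coefficients \<open>f\<^sub>k\<close> and \<open>z\<^sub>k\<close> of \<open>f = \<Sum>f\<^sub>k s\<^sup>k\<close> and \<open>u = \<Sum>z\<^sub>k s\<^sup>k\<close> in \<open>- \<Delta>u = s f\<close>, where
  \<open>f = exp u\<close> for \<open>\<theta> = 0\<close> and \<open>f = exp u / avg (exp u)\<close> for \<open>\<theta> = 1\<close>. In both cases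
  \<open>f' = (u' - \<theta> avg (u' f)) f\<close>, and the recursion compares coefficients in this equation.\<close>

function expansion_rhs :: "real \<Rightarrow> real \<Rightarrow> nat \<Rightarrow> plane \<Rightarrow> real" where
  "expansion_rhs \<rho> \<theta> 0 = (\<lambda>p. 1)"
| "expansion_rhs \<rho> \<theta> (Suc k) = (\<lambda>p. (\<Sum>j\<le>k. (real (Suc j) * dirichlet \<rho> (2 * j) (expansion_rhs \<rho> \<theta> j) p
     - \<theta> * (\<Sum>i\<le>j. avg \<rho> (\<lambda>q. real (Suc i) * dirichlet \<rho> (2 * i) (expansion_rhs \<rho> \<theta> i) q * expansion_rhs \<rho> \<theta> (j - i) q)))
     * expansion_rhs \<rho> \<theta> (k - j) p) / real (Suc k))"
  by pat_completeness auto
termination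
  by (relation "Wellfounded.measure (\<lambda>(\<rho>, \<theta>, k). k)") auto

declare expansion_rhs.simps [simp del]

locale expansion =
  fixes \<rho> \<theta> :: real
  assumes \<rho>: "0 < \<rho>" "\<rho> \<le> 1"
begin

abbreviation "K \<equiv> ellipse \<rho>"

abbreviation f :: "nat \<Rightarrow> plane \<Rightarrow> real" where
  "f k \<equiv> expansion_rhs \<rho> \<theta> k"

definition z :: "nat \<Rightarrow> plane \<Rightarrow> real" where
  "z k = (case k of 0 \<Rightarrow> (\<lambda>p. 0) | Suc j \<Rightarrow> dirichlet \<rho> (2 * j) (f j))"

text \<open>The coefficient of s^j in avg (u' f).\<close>

definition h :: "nat \<Rightarrow> real" where
  "h j = (\<Sum>i\<le>j. avg \<rho> (\<lambda>q. real (Suc i) * z (Suc i) q * f (j - i) q))"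

lemma z_0: "z 0 p = 0" and z_Suc: "z (Suc k) = dirichlet \<rho> (2 * k) (f k)"
  by (simp_all add: z_def)

lemma f_0: "f 0 p = 1"
  by (simp add: expansion_rhs.simps)

lemma f_Suc: "real (Suc k) * f (Suc k) p = (\<Sum>j\<le>k. (real (Suc j) * z (Suc j) p - \<theta> * h j) * f (k - j) p)"
  by (simp add: expansion_rhs.simps(2)[of \<rho> \<theta> k] z_Suc h_def)

lemma polyfun_f: "polyfun (2 * k) (f k)"
proof (induction k rule: less_induct)
  case (less k)
  show ?case
  proof (cases k)
    case 0
    then show ?thesis using polyfun_const[of 0 1] by (simp add: expansion_rhs.simps(1))
  next
    case (Suc m)
    have "polyfun (2 * Suc m) (\<lambda>p. (real (Suc j) * z (Suc j) p - \<theta> * h j) * f (m - j) p)" if "j \<le> m" for j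
    proof -
      have "polyfun (2 * j + 2) (z (Suc j))"
        unfolding z_Suc by (intro polyfun_dirichlet \<rho> less) (use that Suc in auto)
      then have "polyfun (2 * j + 2) (\<lambda>p. real (Suc j) * z (Suc j) p - \<theta> * h j)"
        by (intro polyfun_diff polyfun_scale polyfun_const)
      moreover have "polyfun (2 * (m - j)) (f (m - j))"
        by (intro less) (use Suc in auto)
      ultimately have "polyfun (2 * j + 2 + 2 * (m - j)) (\<lambda>p. (real (Suc j) * z (Suc j) p - \<theta> * h j) * f (m - j) p)"
        by (rule polyfun_mult)
      moreover have "2 * j + 2 + 2 * (m - j) = 2 * Suc m" using that by simp
      ultimately show ?thesis by metis
    qed
    then have "polyfun (2 * Suc m) (\<lambda>p. (1 / real (Suc m)) * (\<Sum>j\<le>m. (real (Suc j) * z (Suc j) p - \<theta> * h j) * f (m - j) p))"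
      by (intro polyfun_scale polyfun_sum) auto
    then show ?thesis unfolding f_Suc[symmetric] Suc by simp
  qed
qed

lemma polyfun_z: "polyfun (2 * k) (z k)"
  using polyfun_const[of 0 0] polyfun_dirichlet[OF \<rho>(1) polyfun_f] by (auto simp: z_def split: nat.split)

lemma z_boundary: "quad \<rho> p = 1 \<Longrightarrow> z k p = 0"
  using dirichlet_boundary[OF \<rho>(1) polyfun_f] by (auto simp: z_def split: nat.split)

lemma laplacian_z: "- laplacian (z (Suc k)) p = f k p"
  unfolding z_Suc by (rule laplacian_dirichlet[OF \<rho>(1) polyfun_f])

lemma laplacian_z_0: "laplacian (z 0) p = 0"
  using laplacian_snd2[of 0 0] by (simp add: z_def)

lemma z_bound: "(\<And>p. p \<in> K \<Longrightarrow> \<bar>f k p\<bar> \<le> B) \<Longrightarrow> p \<in> K \<Longrightarrow> \<bar>z (Suc k) p\<bar> \<le> B / 2"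
  unfolding z_Suc by (rule dirichlet_bound[OF \<rho>(1) polyfun_f])

text \<open>\<open>psi0\<close> is the torsion function of the ellipse: both sides have Laplacian -1
  and vanish on the boundary. This is what makes the leading term explicit.\<close>

lemma z_first_eq:
  assumes "p \<in> K"
  shows "z 1 p = psi0 \<rho> p"
proof -
  let ?\<psi> = "\<lambda>p. 1 / (2 * (1 + \<rho>\<^sup>2)) * (1 - quad \<rho> p)"
  have \<psi>: "psi0 \<rho> = ?\<psi>" by (auto simp: psi0_def quad_def)
  have pol: "polyfun 2 ?\<psi>" by (intro polyfun_scale polyfun_diff polyfun_const polyfun_quad)
  have lap: "laplacian ?\<psi> p = - 1" for p
  proof -
    have "1 + \<rho>\<^sup>2 > 0" by (simp add: add_pos_nonneg)
    then have ne: "2 + 2 * \<rho>\<^sup>2 \<noteq> 0" by linarith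
    have 1: "partial b ?\<psi> = (\<lambda>p. 1 / (2 * (1 + \<rho>\<^sup>2)) * - (\<rho>\<^sup>2 * (2 * fst p * fst b) + 2 * snd p * snd b))" for b
      unfolding quad_def by (intro ext partial_eqI) (use ne in \<open>auto intro!: derivative_eq_intros\<close>)
    have 2: "partial b (\<lambda>p. 1 / (2 * (1 + \<rho>\<^sup>2)) * - (\<rho>\<^sup>2 * (2 * fst p * fst b) + 2 * snd p * snd b)) p
       = 1 / (2 * (1 + \<rho>\<^sup>2)) * - (\<rho>\<^sup>2 * (2 * fst b * fst b) + 2 * snd b * snd b)" for b
      by (rule partial_eqI) (use ne in \<open>auto intro!: derivative_eq_intros\<close>)
    have "laplacian ?\<psi> p = 1 / (2 * (1 + \<rho>\<^sup>2)) * - (2 * \<rho>\<^sup>2 + 2)"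
      unfolding laplacian_eq 1 2 distrib_left[symmetric] by simp
    also have "\<dots> = - 1" using ne by (simp add: field_simps)
    finally show ?thesis .
  qed
  note w = polyfun_z[of 1]
  have lz: "laplacian (z 1) p = - 1" for p
    using laplacian_z[of 0 p] by (simp add: f_0)
  have bd: "z 1 p = 0" "?\<psi> p = 0" if "p \<in> K" "p \<notin> interior K" for p
    using quad_boundary[OF \<rho>(1) that] z_boundary by auto
  have "z 1 p \<le> ?\<psi> p"
    by (rule weak_max_principle[OF \<rho>(1) polyfun_continuous_on[OF w] polyfun_continuous_on[OF pol]
        polyfun_twice_diff[OF w] polyfun_twice_diff[OF pol] _ _ assms]) (metis bd order_refl, simp only: lap lz order_refl)
  moreover have "?\<psi> p \<le> z 1 p"
    by (rule weak_max_principle[OF \<rho>(1) polyfun_continuous_on[OF pol] polyfun_continuous_on[OF w]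
        polyfun_twice_diff[OF pol] polyfun_twice_diff[OF w] _ _ assms]) (metis bd order_refl, simp only: lap lz order_refl)
  ultimately show ?thesis unfolding \<psi> by linarith
qed

end

subsection \<open>Integrals over the ellipse\<close>

text \<open>The map T stretches the first axis by 1/\<rho>, with determinant 1/\<rho>, and pulls the
  ellipse back to the unit disc.\<close>

lemma ellipse_area:
  assumes \<rho>: "0 < \<rho>"
  shows "measure lborel (ellipse \<rho>) = pi / \<rho>"
proof -
  define c :: "plane \<Rightarrow> real" where "c = (\<lambda>j. if j = (1, 0) then 1 / \<rho> else 1)"
  define T :: "plane \<Rightarrow> plane" where "T = (\<lambda>x. 0 + (\<Sum>j\<in>Basis. (c j * (x \<bullet> j)) *\<^sub>R j))"
  have T: "T x = (fst x / \<rho>, snd x)" for x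
    unfolding T_def c_def Basis_plane by (cases x) simp
  have prod: "(\<Prod>j\<in>Basis. \<bar>c j\<bar>) = 1 / \<rho>"
    unfolding c_def Basis_plane using \<rho> by simp
  have lb: "lborel = density (distr lborel borel T) (\<lambda>_. ennreal (1 / \<rho>))"
    using lborel_affine_euclidean[of c 0] \<rho> unfolding T_def prod by (auto simp: c_def)
  have meas: "ellipse \<rho> \<in> sets borel"
    by (intro borel_closed compact_imp_closed compact_ellipse \<rho>)
  have "continuous_on UNIV T"
    unfolding T[abs_def] using \<rho> by (intro continuous_intros) auto
  then have Tm: "T \<in> borel_measurable borel"
    by (rule borel_measurable_continuous_onI)
  have "emeasure lborel (ellipse \<rho>) = emeasure (density (distr lborel borel T) (\<lambda>_. ennreal (1 / \<rho>))) (ellipse \<rho>)"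
    using lb by simp
  also have "\<dots> = ennreal (1 / \<rho>) * emeasure (distr lborel borel T) (ellipse \<rho>)"
    using meas by (simp add: emeasure_density nn_integral_cmult)
  also have "emeasure (distr lborel borel T) (ellipse \<rho>) = emeasure lborel (T -` ellipse \<rho>)"
    using meas Tm by (simp add: emeasure_distr)
  also have "T -` ellipse \<rho> = cball 0 1"
    using \<rho> unfolding ellipse_eq_vimage by (auto simp: T)
  also have "emeasure lborel (cball (0::plane) 1) = ennreal pi"
    using emeasure_cball[of 1 "0::plane"] by (simp add: unit_ball_vol_2)
  finally have "emeasure lborel (ellipse \<rho>) = ennreal (pi / \<rho>)"
    using \<rho> by (simp flip: ennreal_mult)
  then show ?thesis using \<rho> by (simp add: measure_def)
qed

lemma integrable_on_ellipse:
  assumes "0 < \<rho>" "continuous_on (ellipse \<rho>) (g :: plane \<Rightarrow> real)"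
  shows "g integrable_on ellipse \<rho>"
  using set_borel_integral_eq_integral(1)[of "ellipse \<rho>" g] borel_integrable_compact[OF compact_ellipse assms(2)] assms(1)
  by (simp add: set_integrable_def)

lemma integral_const_ellipse:
  assumes \<rho>: "0 < \<rho>"
  shows "integral (ellipse \<rho>) (\<lambda>p. c :: real) = c * (pi / \<rho>)"
proof -
  have "ellipse \<rho> \<in> lmeasurable" using compact_ellipse[OF \<rho>] by (rule lmeasurable_compact)
  moreover have "ellipse \<rho> \<in> sets borel"
    by (intro borel_closed compact_imp_closed compact_ellipse \<rho>)
  ultimately have "integral (ellipse \<rho>) (\<lambda>p. 1 :: real) = pi / \<rho>"
    using lmeasure_integral ellipse_area[OF \<rho>] by (metis measure_completion sets_lborel)
  then show ?thesis
    using integral_mult_right[of "ellipse \<rho>" c "\<lambda>p. 1"] by simp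
qed

lemma avg_eq: "0 < \<rho> \<Longrightarrow> avg \<rho> g = \<rho> / pi * integral (ellipse \<rho>) g"
  by (simp add: avg_def ellipse_area)

lemma avg_const: "0 < \<rho> \<Longrightarrow> avg \<rho> (\<lambda>p. c) = c"
  by (simp add: avg_eq integral_const_ellipse)

lemma avg_bound:
  assumes \<rho>: "0 < \<rho>" and g: "continuous_on (ellipse \<rho>) g" "\<And>p. p \<in> ellipse \<rho> \<Longrightarrow> \<bar>g p\<bar> \<le> B"
  shows "\<bar>avg \<rho> g\<bar> \<le> B"
proof -
  have "norm (integral (ellipse \<rho>) g) \<le> integral (ellipse \<rho>) (\<lambda>p. B)"
    by (rule Henstock_Kurzweil_Integration.integral_norm_bound_integral)
      (use g integrable_on_ellipse[OF \<rho>] in auto)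
  then have "\<bar>integral (ellipse \<rho>) g\<bar> \<le> B * (pi / \<rho>)"
    by (simp add: integral_const_ellipse[OF \<rho>])
  then have "\<rho> / pi * \<bar>integral (ellipse \<rho>) g\<bar> \<le> \<rho> / pi * (B * (pi / \<rho>))"
    using \<rho> by (intro mult_left_mono) auto
  then show ?thesis unfolding avg_eq[OF \<rho>] abs_mult using \<rho> by simp
qed

lemma avg_sum:
  assumes \<rho>: "0 < \<rho>" and "finite J" "\<And>j. j \<in> J \<Longrightarrow> continuous_on (ellipse \<rho>) (g j)"
  shows "avg \<rho> (\<lambda>p. \<Sum>j\<in>J. g j p) = (\<Sum>j\<in>J. avg \<rho> (g j))"
  unfolding avg_eq[OF \<rho>] sum_distrib_left[symmetric]
  by (subst Henstock_Kurzweil_Integration.integral_sum) (use assms integrable_on_ellipse[OF \<rho>] in auto)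

lemma avg_cmult: "0 < \<rho> \<Longrightarrow> avg \<rho> (\<lambda>p. c * g p) = c * avg \<rho> g"
  by (simp add: avg_eq)

lemma avg_diff:
  assumes \<rho>: "0 < \<rho>" and "continuous_on (ellipse \<rho>) g" "continuous_on (ellipse \<rho>) h"
  shows "avg \<rho> (\<lambda>p. g p - h p) = avg \<rho> g - avg \<rho> h"
  unfolding avg_eq[OF \<rho>] right_diff_distrib[symmetric]
  by (subst Henstock_Kurzweil_Integration.integral_diff) (use assms integrable_on_ellipse[OF \<rho>] in auto)

subsection \<open>Convergence of the expansion\<close>

locale convergent_expansion = expansion +
  fixes C A :: real
  assumes A: "0 < A" and f_bound: "\<And>k p. p \<in> K \<Longrightarrow> \<bar>f k p\<bar> \<le> C * A ^ k"
begin

lemma C: "1 \<le> C"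
  using f_bound[of "(0, 0)" 0] ellipse_points(1) by (simp add: f_0)

text \<open>For k >= 1 this is the bound C A^(k-1) / 2 that \<open>dirichlet_bound\<close> gives for
  the solution with right-hand side f (k - 1).\<close>

definition E :: "nat \<Rightarrow> real" where "E k = C / (2 * A) * A ^ k"

lemma E_nonneg: "0 \<le> E k"
  using A C by (simp add: E_def)

lemma z_bound_E:
  assumes "p \<in> K"
  shows "\<bar>z k p\<bar> \<le> E k"
proof (cases k)
  case 0
  then show ?thesis using E_nonneg by (simp add: z_0)
next
  case (Suc j)
  show ?thesis using z_bound[OF f_bound assms, of j] A unfolding Suc E_def by simp
qed

text \<open>The degree is at most 2k, and 8 (2k)^3 = 64 k^3. A second application of the Markov
  inequality, again with degree 2k, squares this factor to 4096 k^6.\<close>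

lemma partial_z_bound:
  assumes "p \<in> K" "b \<in> Basis"
  shows "\<bar>partial b (z k) p\<bar> \<le> 64 * real k ^ 3 * E k"
  using polyfun_ellipse_partial_bound[OF \<rho> polyfun_z z_bound_E assms] by (simp add: power_mult_distrib)

lemma partial2_z_bound:
  assumes "p \<in> K" "b \<in> Basis" "c \<in> Basis"
  shows "\<bar>partial b (partial c (z k)) p\<bar> \<le> 4096 * real k ^ 6 * E k"
proof -
  have "polyfun (2 * k) (partial c (z k))"
    using polyfun_mono[OF polyfun_partial[OF polyfun_z]] by (metis diff_le_self)
  from polyfun_ellipse_partial_bound[OF \<rho> this partial_z_bound[OF _ assms(3)] assms(1,2)]
  have "\<bar>partial b (partial c (z k)) p\<bar> \<le> 8 * real (2 * k) ^ 3 * (64 * real k ^ 3 * E k)" .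
  also have "\<dots> = 4096 * (real k ^ 3 * real k ^ 3) * E k" by (simp add: power_mult_distrib)
  finally show ?thesis by (simp flip: power_add)
qed

sublocale ser: ellipse_series \<rho> z "\<lambda>k. 4096 * real k ^ 6 * E k"
proof unfold_locales
  show "0 < \<rho>" by (rule \<rho>)
  show "\<exists>n. polyfun n (z k)" for k using polyfun_z by blast
  show "quad \<rho> p = 1 \<Longrightarrow> z k p = 0" for k p by (rule z_boundary)
  \<comment> \<open>At k = 0 the majorant is 0, in accordance with z 0 = 0; from k = 1 on it
    dominates the bounds of lower order.\<close>
  have k: "k = 0 \<or> 1 \<le> real k" for k by auto
  have k3: "64 * real k ^ 3 * E k \<le> 4096 * real k ^ 6 * E k" for k
    using k[of k] by (intro mult_right_mono mult_mono E_nonneg) (auto intro: power_increasing)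
  show "\<bar>z k p\<bar> \<le> 4096 * real k ^ 6 * E k" if "p \<in> K" for k p
  proof (cases "k = 0")
    case False
    then have "1 \<le> 4096 * real k ^ 6" using one_le_power[of "real k" 6] by linarith
    then have "1 * E k \<le> 4096 * real k ^ 6 * E k" by (intro mult_right_mono E_nonneg)
    then show ?thesis using z_bound_E[OF that, of k] by linarith
  qed (simp add: z_0)
  show "\<bar>partial b (z k) p\<bar> \<le> 4096 * real k ^ 6 * E k" if "p \<in> K" "b \<in> Basis" for k p b
    using partial_z_bound[OF that] k3 by (rule order.trans)
  show "\<bar>partial b (partial c (z k)) p\<bar> \<le> 4096 * real k ^ 6 * E k"
    if "p \<in> K" "b \<in> Basis" "c \<in> Basis" for k p b c
    using that by (rule partial2_z_bound)
qed

lemma admissible_power: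
  assumes "\<bar>s\<bar> * A < 1"
  shows "ser.admissible (\<lambda>k. s ^ k)"
proof -
  have "\<bar>\<bar>s\<bar> * A\<bar> < 1" using assms A by simp
  from summable_mult[OF summable_power_times[OF this, of 6], of "4096 * C / (2 * A)"]
  show ?thesis unfolding ser.admissible_def unfolding E_def by (simp add: power_mult_distrib power_abs mult_ac)
qed

definition u :: "real \<Rightarrow> plane \<Rightarrow> real" where
  "u s = ser.series_fun (\<lambda>k. s ^ k)"

text \<open>The coefficients of the primitive in s of avg (u' f), normalised to vanish at s =
  0.\<close>

definition g :: "nat \<Rightarrow> real" where
  "g k = (case k of 0 \<Rightarrow> 0 | Suc j \<Rightarrow> h j / real (Suc j))"

text \<open>The factor, constant in space, with f = exp u G: it is 1 for \<theta> = 0 and 1 / avg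
  (exp u) for \<theta> = 1, the latter being a consequence of \<open>avg_rhs\<close>.\<close>

definition G :: "real \<Rightarrow> real" where
  "G s = exp (- \<theta> * (\<Sum>k. g k * s ^ k))"

lemma u_C20: "\<bar>s\<bar> * A < 1 \<Longrightarrow> u s \<in> C20 K"
  unfolding u_def by (intro ser.series_fun_C20 admissible_power)

lemma u_sums: "\<bar>s\<bar> * A < 1 \<Longrightarrow> p \<in> K \<Longrightarrow> (\<lambda>k. s ^ k * z k p) sums u s p"
  unfolding u_def ser.series_fun_eq by (intro summable_sums ser.summable_bounded admissible_power ser.N0)

lemma cont_f: "continuous_on S (f k)" and cont_z: "continuous_on S (z k)"
  by (rule polyfun_continuous_on[OF polyfun_f], rule polyfun_continuous_on[OF polyfun_z])

lemma f_summable: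
  assumes "\<bar>s\<bar> * A < 1" "p \<in> K"
  shows "summable (\<lambda>k. f k p * s ^ k)"
proof (rule summable_comparison_test')
  show "summable (\<lambda>k. C * (\<bar>s\<bar> * A) ^ k)"
    using assms A by (intro summable_mult summable_geometric) auto
  show "norm (f k p * s ^ k) \<le> C * (\<bar>s\<bar> * A) ^ k" for k
    using mult_right_mono[OF f_bound[OF assms(2), of k], of "\<bar>s\<bar> ^ k"]
    by (simp add: abs_mult power_abs power_mult_distrib mult_ac)
qed

text \<open>There are j + 1 summands, each with a factor of at most j + 1; this polynomial loss does
  not change the radius of convergence.\<close>

lemma h_bound: "\<bar>h j\<bar> \<le> real (Suc j) * (real (Suc j) * (C\<^sup>2 * A ^ j))"
proof -
  have "\<bar>avg \<rho> (\<lambda>q. real (Suc i) * z (Suc i) q * f (j - i) q)\<bar> \<le> real (Suc j) * (C\<^sup>2 * A ^ j)" if "i \<le> j" for i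
  proof (rule avg_bound[OF \<rho>(1)])
    show "continuous_on K (\<lambda>q. real (Suc i) * z (Suc i) q * f (j - i) q)"
      by (intro continuous_intros cont_z cont_f)
    fix p assume p: "p \<in> K"
    have "\<bar>z (Suc i) p\<bar> \<le> C * A ^ i"
      using z_bound[OF f_bound p, of i] C A by simp
    then have "\<bar>z (Suc i) p\<bar> * \<bar>f (j - i) p\<bar> \<le> (C * A ^ i) * (C * A ^ (j - i))"
      using C A by (intro mult_mono f_bound[OF p]) auto
    also have "\<dots> = C\<^sup>2 * A ^ j"
      using that by (simp add: power2_eq_square power_add[symmetric] mult_ac)
    finally have "\<bar>z (Suc i) p\<bar> * \<bar>f (j - i) p\<bar> \<le> C\<^sup>2 * A ^ j" .
    then show "\<bar>real (Suc i) * z (Suc i) p * f (j - i) p\<bar> \<le> real (Suc j) * (C\<^sup>2 * A ^ j)"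
      using that C A by (simp only: abs_mult mult.assoc abs_of_nat) (rule mult_mono; simp)
  qed
  then have "\<bar>h j\<bar> \<le> (\<Sum>i\<le>j. real (Suc j) * (C\<^sup>2 * A ^ j))"
    unfolding h_def by (intro order.trans[OF sum_abs] sum_mono) auto
  then show ?thesis by simp
qed

lemma g_summable:
  assumes "\<bar>s\<bar> * A < 1"
  shows "summable (\<lambda>k. g k * s ^ k)"
proof (rule summable_comparison_test')
  have "\<bar>\<bar>s\<bar> * A\<bar> < 1" using assms A by simp
  from summable_mult[OF summable_power_times[OF this, of 1], of "C\<^sup>2 / A"]
  show "summable (\<lambda>k. C\<^sup>2 / A * (real k ^ 1 * (\<bar>s\<bar> * A) ^ k))" .
  show "norm (g k * s ^ k) \<le> C\<^sup>2 / A * (real k ^ 1 * (\<bar>s\<bar> * A) ^ k)" for k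
  proof (cases k)
    case (Suc j)
    have "\<bar>g k\<bar> \<le> real (Suc j) * (C\<^sup>2 * A ^ j)"
      using h_bound[of j] unfolding g_def Suc by (simp add: divide_le_eq mult_ac)
    from mult_right_mono[OF this, of "\<bar>s\<bar> ^ k"] show ?thesis
      using A unfolding Suc by (simp add: abs_mult power_abs power_mult_distrib mult_ac)
  qed (simp add: g_def)
qed

text \<open>At a fixed point p the recursion for f is that of an exponential whose exponent has the
  coefficients z k p - \<theta> g k.\<close>

lemma rhs_sums:
  assumes s: "\<bar>s\<bar> * A < 1" and p: "p \<in> K"
  shows "(\<lambda>k. s ^ k * f k p) sums (exp (u s p) * G s)"
proof -
  have sm: "\<bar>x\<bar> * A < 1" if "\<bar>x\<bar> < 1 / A" for x using that A by (simp add: field_simps)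
  have sz: "summable (\<lambda>k. z k p * x ^ k)" if "\<bar>x\<bar> * A < 1" for x
    using sums_summable[OF u_sums[OF that p]] by (simp add: mult.commute)
  have "(\<Sum>k. f k p * s ^ k) = exp (\<Sum>k. (z k p - \<theta> * g k) * s ^ k)"
  proof (rule power_series_exp[where r = "1 / A"])
    show "f 0 p = 1" by (rule f_0)
    show "z 0 p - \<theta> * g 0 = 0" by (simp add: z_0 g_def)
    show "real (Suc k) * f (Suc k) p = (\<Sum>j\<le>k. real (Suc j) * (z (Suc j) p - \<theta> * g (Suc j)) * f (k - j) p)" for k
      unfolding f_Suc by (intro sum.cong) (auto simp: g_def field_simps)
    show "summable (\<lambda>k. (z k p - \<theta> * g k) * x ^ k)" if "\<bar>x\<bar> < 1 / A" for x
      using summable_diff[OF sz[OF sm[OF that]] summable_mult[OF g_summable[OF sm[OF that]], of \<theta>]]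
      by (simp add: left_diff_distrib mult.assoc)
    show "summable (\<lambda>k. f k p * x ^ k)" if "\<bar>x\<bar> < 1 / A" for x
      by (rule f_summable[OF sm[OF that] p])
    show "\<bar>s\<bar> < 1 / A" using s A by (simp add: field_simps)
  qed
  also have "(\<Sum>k. (z k p - \<theta> * g k) * s ^ k) = u s p - \<theta> * (\<Sum>k. g k * s ^ k)"
  proof -
    have "(\<lambda>k. s ^ k * z k p - \<theta> * (g k * s ^ k)) sums (u s p - \<theta> * (\<Sum>k. g k * s ^ k))"
      by (intro sums_diff u_sums sums_mult summable_sums g_summable s p)
    then show ?thesis by (simp add: sums_iff algebra_simps)
  qed
  also have "exp \<dots> = exp (u s p) * G s"
    unfolding G_def exp_add[symmetric] by simp
  finally show ?thesis
    using summable_sums[OF f_summable[OF s p]] by (simp add: mult.commute)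
qed

lemma laplacian_u:
  assumes s: "\<bar>s\<bar> * A < 1" and p: "p \<in> interior K"
  shows "- laplacian (u s) p = s * G s * exp (u s p)"
proof -
  have "(\<lambda>k. s ^ k * laplacian (z k) p) sums laplacian (u s) p"
    unfolding u_def by (rule ser.laplacian_series_fun[OF admissible_power[OF s] p])
  then have "(\<lambda>k. s ^ Suc k * laplacian (z (Suc k)) p) sums laplacian (u s) p"
    by (subst sums_Suc_iff) (simp add: laplacian_z_0)
  then have "(\<lambda>k. - (s ^ Suc k * laplacian (z (Suc k)) p)) sums - laplacian (u s) p"
    by (rule sums_minus)
  then have "(\<lambda>k. s * (s ^ k * f k p)) sums - laplacian (u s) p"
    unfolding laplacian_z[symmetric] by (simp add: mult.assoc)
  moreover have "(\<lambda>k. s * (s ^ k * f k p)) sums (s * (exp (u s p) * G s))"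
    by (intro sums_mult rhs_sums s ser.intK p)
  ultimately show ?thesis using sums_unique2 by (simp add: mult_ac)
qed

text \<open>The series converges uniformly on K, so it may be averaged termwise. Every partial sum
  that contains the term k = 0, hence is taken up to \<open>Suc n\<close>, has average exactly
  1.\<close>

lemma avg_rhs:
  assumes s: "\<bar>s\<bar> * A < 1" and avg: "\<And>k. avg \<rho> (f k) = (if k = 0 then 1 else 0)"
  shows "avg \<rho> (\<lambda>p. exp (u s p) * G s) = 1"
proof -
  let ?F = "\<lambda>p. exp (u s p) * G s"
  let ?S = "\<lambda>n p. \<Sum>k<n. s ^ k * f k p"
  let ?M = "\<lambda>k. C * (\<bar>s\<bar> * A) ^ k"
  have sM: "summable ?M"
    using s A by (intro summable_mult summable_geometric) auto
  have bd: "norm (s ^ k * f k p) \<le> ?M k" if "p \<in> K" for k p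
    using mult_right_mono[OF f_bound[OF that, of k], of "\<bar>s\<bar> ^ k"]
    by (simp add: abs_mult power_abs power_mult_distrib mult_ac)
  have "continuous_on K (u s)" using u_C20[OF s] by (simp add: C20_def)
  then have cF: "continuous_on K ?F" by (intro continuous_intros)
  have cS: "continuous_on K (?S n)" for n by (intro continuous_intros cont_f)
  have avgS: "avg \<rho> (?S (Suc n)) = 1" for n
  proof -
    have "avg \<rho> (?S (Suc n)) = (\<Sum>k<Suc n. s ^ k * avg \<rho> (f k))"
      by (subst avg_sum[OF \<rho>(1)]) (auto intro!: continuous_intros cont_f simp: avg_cmult[OF \<rho>(1)])
    also have "\<dots> = (\<Sum>k\<in>{0}. s ^ k * avg \<rho> (f k))"
      by (rule sum.mono_neutral_right) (auto simp: avg)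
    finally show ?thesis by (simp add: avg)
  qed
  have "\<bar>avg \<rho> ?F - 1\<bar> \<le> e" if e: "0 < e" for e
  proof -
    obtain n0 where n0: "\<And>n. n \<ge> n0 \<Longrightarrow> norm (\<Sum>k. ?M (k + n)) < e"
      using suminf_exist_split[OF e sM] by blast
    have "\<bar>avg \<rho> (\<lambda>p. ?F p - ?S (Suc n0) p)\<bar> \<le> e"
    proof (rule avg_bound[OF \<rho>(1)])
      show "continuous_on K (\<lambda>p. ?F p - ?S (Suc n0) p)" by (intro continuous_on_diff cF cS)
      fix p assume p: "p \<in> K"
      have sm: "summable (\<lambda>k. s ^ k * f k p)" using rhs_sums[OF s p] by (rule sums_summable)
      have "?F p - ?S (Suc n0) p = (\<Sum>k. s ^ (k + Suc n0) * f (k + Suc n0) p)"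
        using suminf_minus_initial_segment[OF sm, of "Suc n0"] rhs_sums[OF s p] by (simp add: sums_iff)
      also have "norm \<dots> \<le> (\<Sum>k. ?M (k + Suc n0))"
      proof (rule norm_suminf_le)
        show "norm (s ^ (k + Suc n0) * f (k + Suc n0) p) \<le> ?M (k + Suc n0)" for k by (rule bd[OF p])
        show "summable (\<lambda>k. ?M (k + Suc n0))" using sM by (rule summable_ignore_initial_segment)
      qed
      also have "\<dots> \<le> e" using n0[of "Suc n0"] by simp
      finally show "\<bar>?F p - ?S (Suc n0) p\<bar> \<le> e" by simp
    qed
    then show ?thesis unfolding avg_diff[OF \<rho>(1) cF cS] avgS .
  qed
  then have "\<bar>avg \<rho> ?F - 1\<bar> \<le> 0" by (rule field_le_epsilon) simp
  then show ?thesis by simp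
qed

end

subsection \<open>Bounds for the two expansions\<close>

context expansion
begin

lemma f_Suc_0: "\<theta> = 0 \<Longrightarrow> real (Suc k) * f (Suc k) p = (\<Sum>j\<le>k. real (Suc j) * z (Suc j) p * f (k - j) p)"
  unfolding f_Suc by simp

lemma z_Suc_nonneg: "(\<And>p. p \<in> K \<Longrightarrow> 0 \<le> f k p) \<Longrightarrow> p \<in> K \<Longrightarrow> 0 \<le> z (Suc k) p"
  unfolding z_Suc by (rule dirichlet_nonneg[OF \<rho>(1) polyfun_f])

lemma f_nonneg:
  assumes "\<theta> = 0" "p \<in> K"
  shows "0 \<le> f k p"
  using assms(2)
proof (induction k arbitrary: p rule: less_induct)
  case (less k)
  show ?case
  proof (cases k)
    case (Suc m)
    have "0 \<le> (\<Sum>j\<le>m. real (Suc j) * z (Suc j) p * f (m - j) p)"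
      by (intro sum_nonneg mult_nonneg_nonneg z_Suc_nonneg less.prems less.IH) (use Suc in auto)
    then have "0 \<le> real (Suc m) * f (Suc m) p" unfolding f_Suc_0[OF assms(1)] .
    then show ?thesis using Suc by (simp only: zero_le_mult_iff) auto
  qed (simp add: f_0)
qed

lemma z_nonneg:
  assumes "\<theta> = 0" "p \<in> K"
  shows "0 \<le> z k p"
proof (cases k)
  case 0
  then show ?thesis by (simp add: z_0)
next
  case (Suc j)
  then show ?thesis using z_Suc_nonneg[OF f_nonneg[OF assms(1)] assms(2)] by simp
qed

lemma partial_sum_poly: "polyfun (2 * n) (\<lambda>p. \<Sum>k\<le>n. s ^ k * z k p)"
  by (intro polyfun_sum polyfun_scale polyfun_mono[OF polyfun_z]) simp

lemma laplacian_partial_sum: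
  "- laplacian (\<lambda>p. \<Sum>k\<le>Suc n. s ^ k * z k p) p = s * (\<Sum>k\<le>n. f k p * s ^ k)"
proof (induction n)
  case 0
  have "laplacian (\<lambda>p. s * z 1 p + 0 * z 1 p) p = s * laplacian (z 1) p + 0 * laplacian (z 1) p"
    by (rule lincomb_laplacian(2)[OF open_UNIV polyfun_twice_diff[OF polyfun_z] polyfun_twice_diff[OF polyfun_z] UNIV_I])
  then show ?case using laplacian_z[of 0 p] by (simp add: z_0 f_0)
next
  case (Suc n)
  let ?S = "\<lambda>p. \<Sum>k\<le>Suc n. s ^ k * z k p"
  have "laplacian (\<lambda>p. 1 * ?S p + s ^ Suc (Suc n) * z (Suc (Suc n)) p) p
      = 1 * laplacian ?S p + s ^ Suc (Suc n) * laplacian (z (Suc (Suc n))) p"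
    by (rule lincomb_laplacian(2)[OF open_UNIV polyfun_twice_diff[OF partial_sum_poly] polyfun_twice_diff[OF polyfun_z] UNIV_I])
  moreover have "(\<lambda>p. 1 * ?S p + s ^ Suc (Suc n) * z (Suc (Suc n)) p) = (\<lambda>p. \<Sum>k\<le>Suc (Suc n). s ^ k * z k p)"
    by simp
  ultimately have "- laplacian (\<lambda>p. \<Sum>k\<le>Suc (Suc n). s ^ k * z k p) p
      = - laplacian ?S p + s ^ Suc (Suc n) * - laplacian (z (Suc (Suc n))) p"
    by simp
  then show ?case unfolding Suc laplacian_z by (simp add: distrib_left mult_ac)
qed

text \<open>Induction through the weak maximum principle: with S n the n-th partial sum, -\<Delta> S
  (n + 1) is \<mu> times a truncated exponential series, at most \<mu> exp (S n) <= \<mu> exp v <=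
  -\<Delta>v. Neither smallness of \<mu> nor convergence is required.\<close>

lemma partial_sum_le_supersolution:
  assumes \<theta>: "\<theta> = 0" and \<mu>: "0 \<le> \<mu>"
    and v: "continuous_on K v" "twice_diff (interior K) v"
    and bdry: "\<And>p. p \<in> K \<Longrightarrow> p \<notin> interior K \<Longrightarrow> 0 \<le> v p"
    and super: "\<And>p. p \<in> interior K \<Longrightarrow> \<mu> * exp (v p) \<le> - laplacian v p"
    and p: "p \<in> K"
  shows "(\<Sum>k\<le>n. \<mu> ^ k * z k p) \<le> v p"
  using p
proof (induction n arbitrary: p)
  case 0
  have "0 \<le> v p"
  proof (rule weak_max_principle[OF \<rho>(1) _ v(1) _ v(2) bdry _ 0])
    show "twice_diff (interior K) (\<lambda>p. 0)" by (rule polyfun_twice_diff[OF polyfun_const])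
    show "- laplacian (\<lambda>p. 0) p \<le> - laplacian v p" if "p \<in> interior K" for p
    proof -
      have "0 \<le> \<mu> * exp (v p)" using \<mu> by simp
      then show ?thesis using laplacian_snd2[of 0 0 p] super[OF that] by simp
    qed
  qed auto
  then show ?case by (simp add: z_0)
next
  case (Suc n)
  let ?S = "\<lambda>p. \<Sum>k\<le>Suc n. \<mu> ^ k * z k p"
  note pol = partial_sum_poly[where s = \<mu> and n = "Suc n"]
  show ?case
  proof (rule weak_max_principle[OF \<rho>(1) polyfun_continuous_on[OF pol] v(1) polyfun_twice_diff[OF pol] v(2) _ _ Suc.prems])
    show "?S p \<le> v p" if "p \<in> K" "p \<notin> interior K" for p
      using bdry[OF that] z_boundary[OF quad_boundary[OF \<rho>(1) that]] by simp
    fix p assume p: "p \<in> interior K"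
    then have pK: "p \<in> K" using interior_subset by blast
    have "(\<Sum>k\<le>n. f k p * \<mu> ^ k) \<le> exp (\<Sum>k\<le>n. z k p * \<mu> ^ k)"
      by (rule partial_sum_exp_bound) (use f_0 z_0 f_Suc_0[OF \<theta>] z_nonneg[OF \<theta> pK] f_nonneg[OF \<theta> pK] \<mu> in auto)
    also have "\<dots> \<le> exp (v p)" using Suc.IH[OF pK] by (simp add: mult.commute)
    finally have "\<mu> * (\<Sum>k\<le>n. f k p * \<mu> ^ k) \<le> \<mu> * exp (v p)" using \<mu> by (rule mult_left_mono)
    also have "\<dots> \<le> - laplacian v p" by (rule super[OF p])
    finally show "- laplacian ?S p \<le> - laplacian v p" unfolding laplacian_partial_sum .
  qed
qed

lemma supersolution_snd:
  assumes "p \<in> K" "0 \<le> \<mu>" "\<mu> \<le> 2 / exp 1"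
  shows "\<mu> * exp (1 - 1 * (snd p)\<^sup>2) \<le> - laplacian (\<lambda>p. 1 - 1 * (snd p)\<^sup>2) p"
proof -
  have "\<mu> * exp (1 - 1 * (snd p)\<^sup>2) \<le> (2 / exp 1) * exp 1"
    using assms by (intro mult_mono) auto
  then show ?thesis unfolding laplacian_snd2 by simp
qed

lemma partial_sum_le_1:
  assumes "\<theta> = 0" "p \<in> K" "0 \<le> \<mu>" "\<mu> \<le> 2 / exp 1"
  shows "(\<Sum>k\<le>n. \<mu> ^ k * z k p) \<le> 1"
proof -
  have "(\<Sum>k\<le>n. \<mu> ^ k * z k p) \<le> 1 - 1 * (snd p)\<^sup>2"
  proof (rule partial_sum_le_supersolution[OF assms(1,3) polyfun_continuous_on[OF polyfun_snd2]
      polyfun_twice_diff[OF polyfun_snd2] _ _ assms(2)])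
    show "0 \<le> 1 - 1 * (snd p)\<^sup>2" if "p \<in> K" for p using snd_le_ellipse[OF that] by simp
    show "\<mu> * exp (1 - 1 * (snd p)\<^sup>2) \<le> - laplacian (\<lambda>p. 1 - 1 * (snd p)\<^sup>2) p" if "p \<in> interior K" for p
      using supersolution_snd assms interior_subset that by blast
  qed
  then show ?thesis using zero_le_power2[of "snd p"] by linarith
qed

text \<open>A single nonnegative term at \<mu> = 2/e is at most the partial sum there, and this is
  at most e because the partial sums of u stay below 1.\<close>

lemma f_bound_0:
  assumes \<theta>: "\<theta> = 0" and p: "p \<in> K"
  shows "\<bar>f k p\<bar> \<le> exp 1 * (exp 1 / 2) ^ k"
proof -
  let ?\<mu> = "2 / exp 1 :: real"
  have "f k p * ?\<mu> ^ k \<le> (\<Sum>i\<le>k. f i p * ?\<mu> ^ i)"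
    using f_nonneg[OF \<theta> p] by (intro member_le_sum) auto
  also have "\<dots> \<le> exp (\<Sum>i\<le>k. z i p * ?\<mu> ^ i)"
    by (rule partial_sum_exp_bound) (use f_0 z_0 f_Suc_0[OF \<theta>] z_nonneg[OF \<theta> p] f_nonneg[OF \<theta> p] in auto)
  also have "\<dots> \<le> exp 1"
    using partial_sum_le_1[OF \<theta> p, of ?\<mu> k] by (simp add: mult.commute)
  finally have "f k p * ?\<mu> ^ k * (exp 1 / 2) ^ k \<le> exp 1 * (exp 1 / 2) ^ k"
    by (intro mult_right_mono) auto
  moreover have "?\<mu> ^ k * (exp 1 / 2) ^ k = 1"
    unfolding power_mult_distrib[symmetric] by simp
  ultimately show ?thesis using f_nonneg[OF \<theta> p, of k] by (simp add: mult.assoc)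
qed

text \<open>The factor \<open>1 / (k + 1)\<^sup>2\<close> makes the bound stable under the convolutions of the recursion.\<close>

lemma f_bound_1:
  assumes \<theta>: "\<theta> = 1" and p: "p \<in> K"
  shows "\<bar>f k p\<bar> \<le> 48 ^ k / (real (Suc k))\<^sup>2"
  using p
proof (induction k arbitrary: p rule: less_induct)
  case (less k)
  show ?case
  proof (cases k)
    case 0
    then show ?thesis by (simp add: f_0)
  next
    case (Suc m)
    have F: "\<bar>f j q\<bar> \<le> 48 ^ j / (real (Suc j))\<^sup>2" if "j \<le> m" "q \<in> K" for j q
      using less.IH[of j q] that Suc by simp
    have Z: "real (Suc j) * \<bar>z (Suc j) q\<bar> \<le> 1/2 * (48 ^ j / real (Suc j))" if "j \<le> m" "q \<in> K" for j q
    proof -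
      have "\<bar>z (Suc j) q\<bar> \<le> 48 ^ j / (real (Suc j))\<^sup>2 / 2"
        using that by (intro z_bound[OF F]) auto
      then have "real (Suc j) * \<bar>z (Suc j) q\<bar> \<le> real (Suc j) * (48 ^ j / (real (Suc j))\<^sup>2 / 2)"
        by (intro mult_left_mono) auto
      then show ?thesis by (simp add: power2_eq_square mult_ac del: of_nat_Suc)
    qed
    have H: "\<bar>h j\<bar> \<le> 48 ^ j * (3/2 / real (Suc j))" if j: "j \<le> m" for j
    proof -
      have "\<bar>avg \<rho> (\<lambda>q. real (Suc i) * z (Suc i) q * f (j - i) q)\<bar>
          \<le> 48 ^ j / 2 * (1 / (real (Suc i) * (real (Suc (j - i)))\<^sup>2))" if i: "i \<le> j" for i
      proof (rule avg_bound[OF \<rho>(1)])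
        show "continuous_on K (\<lambda>q. real (Suc i) * z (Suc i) q * f (j - i) q)"
          by (intro continuous_intros polyfun_continuous_on[OF polyfun_f] polyfun_continuous_on[OF polyfun_z])
        fix q assume q: "q \<in> K"
        have "(real (Suc i) * \<bar>z (Suc i) q\<bar>) * \<bar>f (j - i) q\<bar>
          \<le> (1/2 * (48 ^ i / real (Suc i))) * (48 ^ (j - i) / (real (Suc (j - i)))\<^sup>2)"
          using i j q by (intro mult_mono Z F) auto
        also have "\<dots> = (48 ^ i * 48 ^ (j - i)) / 2 * (1 / (real (Suc i) * (real (Suc (j - i)))\<^sup>2))" by simp
        also have "(48::real) ^ i * 48 ^ (j - i) = 48 ^ j" using i by (simp flip: power_add)
        finally show "\<bar>real (Suc i) * z (Suc i) q * f (j - i) q\<bar>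
          \<le> 48 ^ j / 2 * (1 / (real (Suc i) * (real (Suc (j - i)))\<^sup>2))" by (simp add: abs_mult)
      qed
      then have "\<bar>h j\<bar> \<le> (\<Sum>i\<le>j. 48 ^ j / 2 * (1 / (real (Suc i) * (real (Suc (j - i)))\<^sup>2)))"
        unfolding h_def by (intro order.trans[OF sum_abs] sum_mono) auto
      also have "\<dots> = 48 ^ j / 2 * (\<Sum>i\<le>j. 1 / (real (Suc i) * (real (Suc (j - i)))\<^sup>2))"
        by (simp only: sum_distrib_left)
      also have "\<dots> \<le> 48 ^ j / 2 * (3 / real (Suc j))"
        by (intro mult_left_mono convolution_bound) simp
      finally show ?thesis by simp
    qed
    have "\<bar>(real (Suc j) * z (Suc j) p - \<theta> * h j) * f (m - j) p\<bar>
      \<le> 2 * 48 ^ m * (1 / (real (Suc j) * (real (Suc (m - j)))\<^sup>2))" if j: "j \<le> m" for j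
    proof -
      have "\<bar>real (Suc j) * z (Suc j) p - \<theta> * h j\<bar> \<le> real (Suc j) * \<bar>z (Suc j) p\<bar> + \<bar>h j\<bar>"
        unfolding \<theta> by (rule order.trans[OF abs_triangle_ineq4]) (simp add: abs_mult)
      also have "\<dots> \<le> 1/2 * (48 ^ j / real (Suc j)) + 48 ^ j * (3/2 / real (Suc j))"
        using Z[OF j less.prems] H[OF j] by (rule add_mono)
      also have "\<dots> = 2 * (48 ^ j / real (Suc j))"
      proof -
        have "1/2 * (x / t) + x * (3/2 / t) = 2 * (x / t)" for x t :: real
          by (cases "t = 0") (auto simp: field_simps)
        then show ?thesis .
      qed
      finally have "\<bar>real (Suc j) * z (Suc j) p - \<theta> * h j\<bar> * \<bar>f (m - j) p\<bar>
        \<le> 2 * (48 ^ j / real (Suc j)) * (48 ^ (m - j) / (real (Suc (m - j)))\<^sup>2)"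
        by (intro mult_mono F less.prems) auto
      also have "\<dots> = 2 * (48 ^ j * 48 ^ (m - j)) * (1 / (real (Suc j) * (real (Suc (m - j)))\<^sup>2))" by simp
      also have "(48::real) ^ j * 48 ^ (m - j) = 48 ^ m" using j by (simp flip: power_add)
      finally show ?thesis by (simp add: abs_mult)
    qed
    then have "\<bar>real (Suc m) * f (Suc m) p\<bar> \<le> (\<Sum>j\<le>m. 2 * 48 ^ m * (1 / (real (Suc j) * (real (Suc (m - j)))\<^sup>2)))"
      unfolding f_Suc by (intro order.trans[OF sum_abs] sum_mono) auto
    also have "\<dots> = 2 * 48 ^ m * (\<Sum>j\<le>m. 1 / (real (Suc j) * (real (Suc (m - j)))\<^sup>2))"
      by (simp only: sum_distrib_left)
    also have "\<dots> \<le> 2 * 48 ^ m * (3 / real (Suc m))"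
      by (intro mult_left_mono convolution_bound) simp
    finally have "real (Suc m) * \<bar>f (Suc m) p\<bar> \<le> 6 * 48 ^ m / real (Suc m)"
      by (simp add: abs_mult)
    moreover have "x \<le> y / t\<^sup>2" if "t * x \<le> y / t" "0 < t" for x y t :: real
      using that by (simp add: field_simps power2_eq_square)
    ultimately have "\<bar>f (Suc m) p\<bar> \<le> 6 * 48 ^ m / (real (Suc m))\<^sup>2"
      by simp
    \<comment> \<open>The step costs (1/2 + 3/2) * 3 = 6 from z, h and the convolution, and at most
      4 for replacing m + 1 by m + 2 in the square. The total 24 is covered by 48.\<close>
    also have "\<dots> \<le> 48 ^ Suc m / (real (Suc (Suc m)))\<^sup>2"
    proof -
      define t where "t = real (Suc m)"
      have t: "1 \<le> t" "real (Suc (Suc m)) = t + 1" by (auto simp: t_def)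
      have "6 * (t + 1)\<^sup>2 \<le> 6 * (2 * t)\<^sup>2" using t by (intro mult_left_mono power_mono) auto
      also have "\<dots> \<le> 48 * t\<^sup>2" by (simp add: power_mult_distrib)
      finally have "48 ^ m * (6 * (t + 1)\<^sup>2) \<le> 48 ^ m * (48 * t\<^sup>2)" by (rule mult_left_mono) simp
      then show ?thesis unfolding t(2) t_def[symmetric] using t(1)
        by (simp add: divide_simps)
    qed
    finally show ?thesis unfolding Suc .
  qed
qed

text \<open>The coefficient form of avg f = 1. Averaging the recursion, the products of z and f sum
  to h m by definition of \<open>h\<close>, and in the subtracted sum only j = m survives by
  induction, giving h m again.\<close>

lemma avg_f:
  assumes \<theta>: "\<theta> = 1"
  shows "avg \<rho> (f k) = (if k = 0 then 1 else 0)"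
proof (induction k rule: less_induct)
  case (less k)
  note cont = polyfun_continuous_on[OF polyfun_f] polyfun_continuous_on[OF polyfun_z]
  show ?case
  proof (cases k)
    case 0
    then show ?thesis by (simp add: expansion_rhs.simps(1) avg_const[OF \<rho>(1)])
  next
    case (Suc m)
    have "real (Suc m) * avg \<rho> (f (Suc m)) = avg \<rho> (\<lambda>p. real (Suc m) * f (Suc m) p)"
      by (rule avg_cmult[OF \<rho>(1), symmetric])
    also have "(\<lambda>p. real (Suc m) * f (Suc m) p)
        = (\<lambda>p. \<Sum>j\<le>m. real (Suc j) * z (Suc j) p * f (m - j) p - h j * f (m - j) p)"
      unfolding f_Suc using \<theta> by (simp only: left_diff_distrib) simp
    also have "avg \<rho> \<dots> = (\<Sum>j\<le>m. avg \<rho> (\<lambda>p. real (Suc j) * z (Suc j) p * f (m - j) p) - h j * avg \<rho> (f (m - j)))"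
    proof -
      have c1: "continuous_on K (\<lambda>p. real (Suc j) * z (Suc j) p * f (m - j) p)"
        and c2: "continuous_on K (\<lambda>p. h j * f (m - j) p)" for j
        by (intro continuous_intros cont)+
      have "avg \<rho> (\<lambda>p. \<Sum>j\<le>m. real (Suc j) * z (Suc j) p * f (m - j) p - h j * f (m - j) p)
        = (\<Sum>j\<le>m. avg \<rho> (\<lambda>p. real (Suc j) * z (Suc j) p * f (m - j) p - h j * f (m - j) p))"
        by (rule avg_sum[OF \<rho>(1)]) (auto intro!: continuous_on_diff c1 c2 simp del: of_nat_Suc)
      then show ?thesis unfolding avg_diff[OF \<rho>(1) c1 c2] avg_cmult[OF \<rho>(1)] .
    qed
    also have "\<dots> = h m - (\<Sum>j\<le>m. h j * avg \<rho> (f (m - j)))"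
      by (simp add: sum_subtractf h_def)
    also have "(\<Sum>j\<le>m. h j * avg \<rho> (f (m - j))) = (\<Sum>j\<in>{m}. h j * avg \<rho> (f (m - j)))"
      by (rule sum.mono_neutral_right) (use less.IH Suc in auto)
    also have "\<dots> = h m" using less.IH[of 0] Suc by simp
    finally show ?thesis using Suc by simp
  qed
qed

end

subsection \<open>Comparison of sub- and supersolutions\<close>

text \<open>Convexity gives exp v - exp w <= exp v (v - w), so only the subsolution v has to satisfy
  the smallness bound that makes the maximum principle applicable to v - w.\<close>

lemma comparison:
  assumes \<rho>: "0 < \<rho>" and \<mu>: "0 \<le> \<mu>"
    and cont: "continuous_on (ellipse \<rho>) v" "continuous_on (ellipse \<rho>) w"
    and diff: "twice_diff (interior (ellipse \<rho>)) v" "twice_diff (interior (ellipse \<rho>)) w"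
    and bdry: "\<And>p. p \<in> ellipse \<rho> \<Longrightarrow> p \<notin> interior (ellipse \<rho>) \<Longrightarrow> v p \<le> w p"
    and sub: "\<And>p. p \<in> interior (ellipse \<rho>) \<Longrightarrow> - laplacian v p \<le> \<mu> * exp (v p)"
    and super: "\<And>p. p \<in> interior (ellipse \<rho>) \<Longrightarrow> \<mu> * exp (w p) \<le> - laplacian w p"
    and small: "\<And>p. p \<in> interior (ellipse \<rho>) \<Longrightarrow> \<mu> * exp (v p) \<le> 33/20"
    and x: "x \<in> ellipse \<rho>"
  shows "v x \<le> w x"
proof -
  let ?d = "\<lambda>p. 1 * v p + (- 1) * w p"
  have "?d x \<le> 0"
  proof (rule max_principle[OF \<rho>])
    show "continuous_on (ellipse \<rho>) ?d" by (intro continuous_intros cont)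
    show "twice_diff (interior (ellipse \<rho>)) ?d" by (rule lincomb_laplacian(1)[OF open_interior diff])
    show "- laplacian ?d p \<le> 33/20 * ?d p" if p: "p \<in> interior (ellipse \<rho>)" and pos: "0 < ?d p" for p
    proof -
      have "exp (w p) = exp (v p) * exp (w p - v p)" by (simp flip: exp_add)
      also have "\<dots> \<ge> exp (v p) * (1 + (w p - v p))"
        by (intro mult_left_mono exp_ge_add_one_self) simp
      finally have "exp (v p) - exp (w p) \<le> exp (v p) * ?d p" by (simp add: algebra_simps)
      then have "\<mu> * (exp (v p) - exp (w p)) \<le> \<mu> * (exp (v p) * ?d p)"
        using \<mu> by (rule mult_left_mono)
      also have "\<dots> \<le> 33/20 * ?d p"
        using mult_right_mono[OF small[OF p], of "?d p"] pos by (simp add: mult.assoc)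
      finally show ?thesis
        unfolding lincomb_laplacian(2)[OF open_interior diff p] using sub[OF p] super[OF p]
        by (simp add: right_diff_distrib)
    qed
  qed (use bdry x in auto)
  then show ?thesis by simp
qed

lemma C20_D:
  assumes "w \<in> C20 S"
  shows "continuous_on S w" "twice_diff (interior S) w" "p \<notin> interior S \<Longrightarrow> w p = 0"
  using assms Ck2_twice_diff unfolding C20_def by (simp_all only: mem_Collect_eq) blast+

lemma solves_Q_unique:
  assumes \<rho>: "0 < \<rho>" and \<mu>: "0 \<le> \<mu>"
    and Q: "solves_Q \<mu> (ellipse \<rho>) v" "solves_Q \<mu> (ellipse \<rho>) w"
    and small: "\<And>p. p \<in> ellipse \<rho> \<Longrightarrow> \<mu> * exp (v p) \<le> 33/20"
      "\<And>p. p \<in> ellipse \<rho> \<Longrightarrow> \<mu> * exp (w p) \<le> 33/20"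
  shows "v = w"
proof
  fix p
  have le: "v1 p \<le> v2 p" if p: "p \<in> ellipse \<rho>"
    and Q: "solves_Q \<mu> (ellipse \<rho>) v1" "solves_Q \<mu> (ellipse \<rho>) v2"
    and small: "\<And>p. p \<in> ellipse \<rho> \<Longrightarrow> \<mu> * exp (v1 p) \<le> 33/20" for v1 v2
  proof -
    have C: "v1 \<in> C20 (ellipse \<rho>)" "v2 \<in> C20 (ellipse \<rho>)" using Q by (auto simp: solves_Q_def)
    show ?thesis
      by (rule comparison[OF \<rho> \<mu> C20_D(1)[OF C(1)] C20_D(1)[OF C(2)] C20_D(2)[OF C(1)] C20_D(2)[OF C(2)] _ _ _ _ p])
        (use Q small interior_subset[of "ellipse \<rho>"] C20_D(3)[OF C(1)] C20_D(3)[OF C(2)] in \<open>auto simp: solves_Q_def\<close>)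
  qed
  show "v p = w p"
  proof (cases "p \<in> ellipse \<rho>")
    case True
    then show ?thesis using le[OF True Q small(1)] le[OF True Q(2,1) small(2)] by simp
  next
    case False
    then have "p \<notin> interior (ellipse \<rho>)" using interior_subset by blast
    then show ?thesis using Q C20_D(3) unfolding solves_Q_def by metis
  qed
qed

subsection \<open>The explicit sub- and supersolution\<close>

lemma v_fun_quad: "v_fun \<rho> \<gamma> p = 2 * ln ((1 + \<gamma>\<^sup>2) / (1 + \<gamma>\<^sup>2 * quad \<rho> p))"
  by (cases p) (simp add: v_fun_def quad_def)

lemma one_plus_quad_pos: "0 \<le> g \<Longrightarrow> 0 < 1 + g * quad \<rho> p"
  using quad_nonneg by (simp add: add_pos_nonneg)

lemma exp_v_fun: "exp (v_fun \<rho> \<gamma> p) = ((1 + \<gamma>\<^sup>2) / (1 + \<gamma>\<^sup>2 * quad \<rho> p))\<^sup>2"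
proof -
  have "0 < (1 + \<gamma>\<^sup>2) / (1 + \<gamma>\<^sup>2 * quad \<rho> p)"
    by (intro divide_pos_pos one_plus_quad_pos add_pos_nonneg) auto
  from exp_ln[OF this] show ?thesis unfolding v_fun_quad exp_double by (simp only:)
qed

text \<open>For \<rho> = 1 the last bracket is constant and \<open>v_fun\<close> solves a Liouville
  equation exactly. In general \<rho>^2 x^2 - y^2, which lies between -1 and 1 on the ellipse, is
  the only term that keeps -\<Delta>v from being a multiple of exp v.\<close>

lemma v_fun_derivatives:
  fixes \<rho> \<gamma> :: real
  defines "g \<equiv> \<gamma>\<^sup>2"
  shows "twice_diff U (v_fun \<rho> \<gamma>)"
    and "- laplacian (v_fun \<rho> \<gamma>) p = 4 * g * ((1 + \<rho>\<^sup>2) + g * (1 - \<rho>\<^sup>2) * (\<rho>\<^sup>2 * (fst p)\<^sup>2 - (snd p)\<^sup>2)) / (1 + g * quad \<rho> p)\<^sup>2"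
proof -
  have g: "0 \<le> g" by (simp add: g_def)
  have pos: "0 < 1 + g * (\<rho>\<^sup>2 * (fst p)\<^sup>2 + (snd p)\<^sup>2)" for p :: plane
    using one_plus_quad_pos[OF g, of \<rho> p] by (simp add: quad_def)
  have ne: "1 + g * (\<rho>\<^sup>2 * (fst p)\<^sup>2 + (snd p)\<^sup>2) \<noteq> 0" for p :: plane
    using pos[of p] by simp
  have g1: "0 < 1 + g" using g by simp
  have v: "v_fun \<rho> \<gamma> = (\<lambda>p. 2 * (ln (1 + g) - ln (1 + g * (\<rho>\<^sup>2 * (fst p)\<^sup>2 + (snd p)\<^sup>2))))"
    unfolding v_fun_quad[abs_def] quad_def g_def[symmetric] using pos g1 ne by (intro ext) (simp add: ln_div)
  define B where "B = (\<lambda>(b::plane) p. \<rho>\<^sup>2 * fst p * fst b + snd p * snd b)"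
  have d1: "(v_fun \<rho> \<gamma> has_derivative (\<lambda>b. - 4 * g * (B b p / (1 + g * (\<rho>\<^sup>2 * (fst p)\<^sup>2 + (snd p)\<^sup>2))))) (at p)" for p
    unfolding v B_def using pos[of p]
    by (auto intro!: derivative_eq_intros simp: fun_eq_iff divide_simps)
  then have pv: "partial b (v_fun \<rho> \<gamma>) = (\<lambda>p. - 4 * g * (B b p / (1 + g * (\<rho>\<^sup>2 * (fst p)\<^sup>2 + (snd p)\<^sup>2))))" for b
    using partial_eqI by blast
  have d2: "((\<lambda>p. - 4 * g * (B b p / (1 + g * (\<rho>\<^sup>2 * (fst p)\<^sup>2 + (snd p)\<^sup>2)))) has_derivative
     (\<lambda>c. - 4 * g * ((B b c * (1 + g * (\<rho>\<^sup>2 * (fst p)\<^sup>2 + (snd p)\<^sup>2)) - B b p * (2 * g * B c p))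
       / (1 + g * (\<rho>\<^sup>2 * (fst p)\<^sup>2 + (snd p)\<^sup>2))\<^sup>2))) (at p)" for b p
    unfolding B_def using ne[of p]
    by (auto intro!: derivative_eq_intros simp: fun_eq_iff power2_eq_square divide_simps) (simp add: algebra_simps)
  show "twice_diff U (v_fun \<rho> \<gamma>)"
    unfolding twice_diff_def pv differentiable_def using d1 d2 by blast
  define D where "D = 1 + g * (\<rho>\<^sup>2 * (fst p)\<^sup>2 + (snd p)\<^sup>2)"
  have "partial b (partial b (v_fun \<rho> \<gamma>)) p = - 4 * g * ((B b b * D - B b p * (2 * g * B b p)) / D\<^sup>2)" for b
    unfolding pv D_def by (rule partial_eqI[OF d2])
  then have "- laplacian (v_fun \<rho> \<gamma>) p = 4 * g * ((\<rho>\<^sup>2 * D - (\<rho>\<^sup>2 * fst p) * (2 * g * (\<rho>\<^sup>2 * fst p))) / D\<^sup>2)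
     + 4 * g * ((D - snd p * (2 * g * snd p)) / D\<^sup>2)"
    unfolding laplacian_eq B_def by simp
  also have "\<dots> = 4 * g * ((\<rho>\<^sup>2 * D - (\<rho>\<^sup>2 * fst p) * (2 * g * (\<rho>\<^sup>2 * fst p))) + (D - snd p * (2 * g * snd p))) / D\<^sup>2"
    by (simp add: add_divide_distrib distrib_left)
  also have "(\<rho>\<^sup>2 * D - (\<rho>\<^sup>2 * fst p) * (2 * g * (\<rho>\<^sup>2 * fst p))) + (D - snd p * (2 * g * snd p))
    = (1 + \<rho>\<^sup>2) + g * (1 - \<rho>\<^sup>2) * (\<rho>\<^sup>2 * (fst p)\<^sup>2 - (snd p)\<^sup>2)"
    unfolding D_def by (simp add: algebra_simps power2_eq_square)
  finally show "- laplacian (v_fun \<rho> \<gamma>) p = 4 * g * ((1 + \<rho>\<^sup>2) + g * (1 - \<rho>\<^sup>2) * (\<rho>\<^sup>2 * (fst p)\<^sup>2 - (snd p)\<^sup>2)) / (1 + g * quad \<rho> p)\<^sup>2"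
    unfolding D_def quad_def .
qed

lemma v_fun_props:
  assumes "0 < \<rho>"
  shows "continuous_on S (v_fun \<rho> \<gamma>)"
    and "p \<in> ellipse \<rho> \<Longrightarrow> p \<notin> interior (ellipse \<rho>) \<Longrightarrow> v_fun \<rho> \<gamma> p = 0"
    and "exp (v_fun \<rho> \<gamma> p) \<le> (1 + \<gamma>\<^sup>2)\<^sup>2"
proof -
  show "continuous_on S (v_fun \<rho> \<gamma>)"
    using v_fun_derivatives(1)[of UNIV \<rho> \<gamma>] unfolding twice_diff_def
    by (intro continuous_at_imp_continuous_on ballI differentiable_imp_continuous_within) auto
  show "v_fun \<rho> \<gamma> p = 0" if "p \<in> ellipse \<rho>" "p \<notin> interior (ellipse \<rho>)"
    using quad_boundary[OF assms that] by (simp add: v_fun_quad add_nonneg_eq_0_iff)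
  have "(1 + \<gamma>\<^sup>2) / (1 + \<gamma>\<^sup>2 * quad \<rho> p) \<le> (1 + \<gamma>\<^sup>2) / 1"
    using quad_nonneg[of \<rho> p] by (intro divide_left_mono) (auto intro: add_pos_nonneg)
  then show "exp (v_fun \<rho> \<gamma> p) \<le> (1 + \<gamma>\<^sup>2)\<^sup>2"
    unfolding exp_v_fun using one_plus_quad_pos[of "\<gamma>\<^sup>2" \<rho> p] by (intro power_mono) auto
qed

lemma anisotropy_bound:
  assumes "p \<in> ellipse \<rho>"
  shows "\<rho>\<^sup>2 * (fst p)\<^sup>2 - (snd p)\<^sup>2 \<le> 1" "- 1 \<le> \<rho>\<^sup>2 * (fst p)\<^sup>2 - (snd p)\<^sup>2"
proof -
  have "0 \<le> \<rho>\<^sup>2 * (fst p)\<^sup>2" "0 \<le> (snd p)\<^sup>2" by auto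
  then show "\<rho>\<^sup>2 * (fst p)\<^sup>2 - (snd p)\<^sup>2 \<le> 1" "- 1 \<le> \<rho>\<^sup>2 * (fst p)\<^sup>2 - (snd p)\<^sup>2"
    using assms unfolding mem_ellipse quad_def by linarith+
qed

text \<open>-\<Delta>v and exp v have the same denominator, so only numerators are compared. The
  equation for \<gamma> is equality for the worst value -1 of \<rho>^2 x^2 - y^2; for the
  subsolution the worst value is 1.\<close>

lemma v_fun_supersolution:
  assumes "0 < \<rho>" "\<rho> \<le> 1" and p: "p \<in> ellipse \<rho>"
    and eq: "\<mu> * (1 + \<gamma>\<^sup>2)\<^sup>2 = 4 * \<gamma>\<^sup>2 * ((1 + \<rho>\<^sup>2) - \<gamma>\<^sup>2 * (1 - \<rho>\<^sup>2))"
  shows "\<mu> * exp (v_fun \<rho> \<gamma> p) \<le> - laplacian (v_fun \<rho> \<gamma>) p"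
proof -
  have "\<rho>\<^sup>2 \<le> 1" using assms by (simp add: abs_square_le_1)
  then have "\<gamma>\<^sup>2 * (1 - \<rho>\<^sup>2) * (- 1) \<le> \<gamma>\<^sup>2 * (1 - \<rho>\<^sup>2) * (\<rho>\<^sup>2 * (fst p)\<^sup>2 - (snd p)\<^sup>2)"
    by (intro mult_left_mono anisotropy_bound(2)[OF p]) auto
  then have "4 * \<gamma>\<^sup>2 * ((1 + \<rho>\<^sup>2) - \<gamma>\<^sup>2 * (1 - \<rho>\<^sup>2))
    \<le> 4 * \<gamma>\<^sup>2 * ((1 + \<rho>\<^sup>2) + \<gamma>\<^sup>2 * (1 - \<rho>\<^sup>2) * (\<rho>\<^sup>2 * (fst p)\<^sup>2 - (snd p)\<^sup>2))"
    by (intro mult_left_mono) auto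
  then show ?thesis unfolding exp_v_fun v_fun_derivatives(2) power_divide times_divide_eq_right eq
    by (intro divide_right_mono) auto
qed

lemma v_fun_subsolution:
  assumes "0 < \<rho>" "\<rho> \<le> 1" and p: "p \<in> ellipse \<rho>"
    and eq: "\<mu> * (1 + \<gamma>\<^sup>2)\<^sup>2 = 4 * \<gamma>\<^sup>2 * ((1 + \<rho>\<^sup>2) + \<gamma>\<^sup>2 * (1 - \<rho>\<^sup>2))"
  shows "- laplacian (v_fun \<rho> \<gamma>) p \<le> \<mu> * exp (v_fun \<rho> \<gamma> p)"
proof -
  have "\<rho>\<^sup>2 \<le> 1" using assms by (simp add: abs_square_le_1)
  then have "\<gamma>\<^sup>2 * (1 - \<rho>\<^sup>2) * (\<rho>\<^sup>2 * (fst p)\<^sup>2 - (snd p)\<^sup>2) \<le> \<gamma>\<^sup>2 * (1 - \<rho>\<^sup>2) * 1"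
    by (intro mult_left_mono anisotropy_bound(1)[OF p]) auto
  then have "4 * \<gamma>\<^sup>2 * ((1 + \<rho>\<^sup>2) + \<gamma>\<^sup>2 * (1 - \<rho>\<^sup>2) * (\<rho>\<^sup>2 * (fst p)\<^sup>2 - (snd p)\<^sup>2))
    \<le> 4 * \<gamma>\<^sup>2 * ((1 + \<rho>\<^sup>2) + \<gamma>\<^sup>2 * (1 - \<rho>\<^sup>2))"
    by (intro mult_left_mono) auto
  then show ?thesis unfolding exp_v_fun v_fun_derivatives(2) power_divide times_divide_eq_right eq
    by (intro divide_right_mono) auto
qed

text \<open>With a = 1 + \<rho>^2 the equation is the quadratic D g^2 - (4a - 2\<mu>) g + \<mu> = 0,
  and \<open>gamma_plus\<close> is the square root of its smaller root. The bound \<mu> <=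
  \<open>mu_bar\<close> makes the discriminant nonnegative; g >= 0 is needed to undo the outer
  root.\<close>

lemma gamma_plus_equation:
  assumes \<rho>: "0 < \<rho>" "\<rho> \<le> 1/10" and \<mu>: "0 < \<mu>" "\<mu> \<le> mu_bar \<rho>"
  shows "\<mu> * (1 + (gamma_plus \<rho> \<mu>)\<^sup>2)\<^sup>2
    = 4 * (gamma_plus \<rho> \<mu>)\<^sup>2 * ((1 + \<rho>\<^sup>2) - (gamma_plus \<rho> \<mu>)\<^sup>2 * (1 - \<rho>\<^sup>2))"
proof -
  define a where "a = 1 + \<rho>\<^sup>2"
  define S where "S = sqrt (a\<^sup>2 - 2 * \<mu>)"
  define D where "D = \<mu> + 4 * (2 - a)"
  define g where "g = (2 * a - \<mu> - 2 * S) / D"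
  have r2: "\<rho>\<^sup>2 \<le> (1/10)\<^sup>2" using \<rho> by (intro power_mono) auto
  have a: "1 \<le> a" "a \<le> 101/100" using r2 by (auto simp: a_def power2_eq_square)
  have m: "2 * \<mu> \<le> a\<^sup>2" using \<mu> by (simp add: mu_bar_def a_def)
  have a2: "a\<^sup>2 \<le> (101/100)\<^sup>2" using a by (intro power_mono) auto
  have m1: "\<mu> \<le> 6/10" using m a2 by (simp add: power2_eq_square)
  have S2: "S\<^sup>2 = a\<^sup>2 - 2 * \<mu>" unfolding S_def using m by simp
  have D: "0 < D" unfolding D_def using a \<mu> by simp
  have "S \<le> (2 * a - \<mu>) / 2"
  proof (rule power2_le_imp_le)
    have "0 \<le> \<mu> * (2 - a + \<mu> / 4)" using a \<mu> by simp
    then show "S\<^sup>2 \<le> ((2 * a - \<mu>) / 2)\<^sup>2" unfolding S2 by (simp add: power2_eq_square algebra_simps)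
  qed (use a m1 in simp)
  then have g0: "0 \<le> g" unfolding g_def using D by simp
  have gg: "(gamma_plus \<rho> \<mu>)\<^sup>2 = g"
    using g0 unfolding gamma_plus_def g_def S_def D_def a_def by simp
  have "D * g - (2 * a - \<mu>) = - 2 * S" unfolding g_def using D by simp
  then have "(D * g - (2 * a - \<mu>))\<^sup>2 = 4 * (a\<^sup>2 - 2 * \<mu>)" using S2 by (simp add: power_mult_distrib)
  then have "D * (D * g\<^sup>2 - (4 * a - 2 * \<mu>) * g + \<mu>) = 0"
    unfolding D_def by (simp add: power2_eq_square algebra_simps)
  then have "D * g\<^sup>2 - (4 * a - 2 * \<mu>) * g + \<mu> = 0" using D by simp
  then show ?thesis unfolding gg D_def a_def by (simp add: power2_eq_square algebra_simps)
qed

text \<open>Here the quadratic is D g^2 + (4a - 2\<mu>) g - \<mu> = 0 with D > 0, and the formula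
  picks its nonnegative root.\<close>

lemma gamma_minus_equation:
  assumes \<rho>: "0 < \<rho>" "\<rho> \<le> 1/10" and \<mu>: "0 < \<mu>" "\<mu> \<le> mu_bar \<rho>"
  shows "\<mu> * (1 + (gamma_minus \<rho> \<mu>)\<^sup>2)\<^sup>2
    = 4 * (gamma_minus \<rho> \<mu>)\<^sup>2 * ((1 + \<rho>\<^sup>2) + (gamma_minus \<rho> \<mu>)\<^sup>2 * (1 - \<rho>\<^sup>2))"
    and "(gamma_minus \<rho> \<mu>)\<^sup>2 \<le> 1/4"
proof -
  define a where "a = 1 + \<rho>\<^sup>2"
  define S where "S = sqrt (a\<^sup>2 - 2 * (a - 1) * \<mu>)"
  define D where "D = 4 * (2 - a) - \<mu>"
  define g where "g = (\<mu> - 2 * a + 2 * S) / D"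
  have r2: "\<rho>\<^sup>2 \<le> (1/10)\<^sup>2" using \<rho> by (intro power_mono) auto
  have a: "1 \<le> a" "a \<le> 101/100" using r2 by (auto simp: a_def power2_eq_square)
  have m: "2 * \<mu> \<le> a\<^sup>2" using \<mu> by (simp add: mu_bar_def a_def)
  have a2: "a\<^sup>2 \<le> (101/100)\<^sup>2" using a by (intro power_mono) auto
  have m1: "\<mu> \<le> 6/10" using m a2 by (simp add: power2_eq_square)
  have "(a - 1) * (2 * \<mu>) \<le> 1 * (2 * \<mu>)" using a \<mu> by (intro mult_right_mono) auto
  moreover have "2 * (a - 1) * \<mu> = (a - 1) * (2 * \<mu>)" by simp
  ultimately have mm: "0 \<le> a\<^sup>2 - 2 * (a - 1) * \<mu>" using m by linarith
  then have S2: "S\<^sup>2 = a\<^sup>2 - 2 * (a - 1) * \<mu>" and S0: "0 \<le> S" unfolding S_def by simp_all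
  have D: "0 < D" unfolding D_def using a m1 by simp
  have "(2 * a - \<mu>) / 2 \<le> S"
  proof (rule power2_le_imp_le)
    have "0 \<le> \<mu> * (D / 4)" using D \<mu> by simp
    then show "((2 * a - \<mu>) / 2)\<^sup>2 \<le> S\<^sup>2" unfolding S2 D_def by (simp add: power2_eq_square field_simps)
  qed (rule S0)
  then have g0: "0 \<le> g" unfolding g_def using D by simp
  have gg: "(gamma_minus \<rho> \<mu>)\<^sup>2 = g"
    using g0 unfolding gamma_minus_def g_def S_def D_def a_def by simp
  have "D * g + (2 * a - \<mu>) = 2 * S" unfolding g_def using D by simp
  then have "(D * g + (2 * a - \<mu>))\<^sup>2 = 4 * (a\<^sup>2 - 2 * (a - 1) * \<mu>)" using S2 by (simp add: power_mult_distrib)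
  then have "D * (D * g\<^sup>2 + (4 * a - 2 * \<mu>) * g - \<mu>) = 0"
    unfolding D_def by (simp add: power2_eq_square algebra_simps)
  then have q: "D * g\<^sup>2 + (4 * a - 2 * \<mu>) * g - \<mu> = 0" using D by simp
  then show "\<mu> * (1 + (gamma_minus \<rho> \<mu>)\<^sup>2)\<^sup>2
    = 4 * (gamma_minus \<rho> \<mu>)\<^sup>2 * ((1 + \<rho>\<^sup>2) + (gamma_minus \<rho> \<mu>)\<^sup>2 * (1 - \<rho>\<^sup>2))"
    unfolding gg D_def a_def by (simp add: power2_eq_square algebra_simps)
  \<comment> \<open>Dropping the quadratic term leaves 2.8 g <= \<mu> <= 0.6, because 4a - 2\<mu> >=
    4 - 1.2.\<close>
  have "0 \<le> D * g\<^sup>2" using D by simp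
  moreover have "(28/10) * g \<le> (4 * a - 2 * \<mu>) * g" using a m1 g0 by (intro mult_right_mono) auto
  ultimately have "(28/10) * g \<le> \<mu>" using q by linarith
  then show "(gamma_minus \<rho> \<mu>)\<^sup>2 \<le> 1/4" unfolding gg using m1 by simp
qed

lemma mu_bar_bounds:
  assumes "0 < \<rho>" "\<rho> \<le> 1/10"
  shows "mu_bar \<rho> \<le> 6/10" "1/2 \<le> mu_bar \<rho>"
proof -
  have r2: "\<rho>\<^sup>2 \<le> (1/10)\<^sup>2" using assms by (intro power_mono) auto
  then have "(1 + \<rho>\<^sup>2)\<^sup>2 \<le> (101/100)\<^sup>2" by (intro power_mono) (auto simp: power2_eq_square)
  then show "mu_bar \<rho> \<le> 6/10" by (simp add: mu_bar_def power2_eq_square)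
  have "1 \<le> (1 + \<rho>\<^sup>2)\<^sup>2" by (intro one_le_power) simp
  then show "1/2 \<le> mu_bar \<rho>" by (simp add: mu_bar_def)
qed

text \<open>The equation for \<gamma> turns \<mu> (1 + g)^2 into a concave quadratic in g.
  Completing the square bounds it by (1 + \<rho>^2)^2 / (1 - \<rho>^2), which is close to 1, without
  any estimate for g.\<close>

lemma v_plus_small:
  assumes \<rho>: "0 < \<rho>" "\<rho> \<le> 1/10" and \<mu>: "0 < \<mu>" "\<mu> \<le> mu_bar \<rho>"
  shows "\<mu> * exp (v_fun \<rho> (gamma_plus \<rho> \<mu>) p) \<le> 33/20"
proof -
  define g where "g = (gamma_plus \<rho> \<mu>)\<^sup>2"
  have r2: "\<rho>\<^sup>2 \<le> (1/10)\<^sup>2" using \<rho> by (intro power_mono) auto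
  have "\<mu> * exp (v_fun \<rho> (gamma_plus \<rho> \<mu>) p) \<le> \<mu> * (1 + g)\<^sup>2"
    unfolding g_def using \<mu> by (intro mult_left_mono v_fun_props(3) \<rho>) auto
  also have "\<dots> = 4 * g * ((1 + \<rho>\<^sup>2) - g * (1 - \<rho>\<^sup>2))"
    unfolding g_def by (rule gamma_plus_equation[OF \<rho> \<mu>])
  also have "\<dots> \<le> 33/20"
  proof -
    have c: "99/100 \<le> 1 - \<rho>\<^sup>2" using r2 by (simp add: power2_eq_square)
    have "0 \<le> ((1 + \<rho>\<^sup>2) - 2 * (g * (1 - \<rho>\<^sup>2)))\<^sup>2" by simp
    then have "(1 - \<rho>\<^sup>2) * (4 * g * ((1 + \<rho>\<^sup>2) - g * (1 - \<rho>\<^sup>2))) \<le> (1 + \<rho>\<^sup>2)\<^sup>2"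
      by (simp add: power2_eq_square algebra_simps)
    also have "(1 + \<rho>\<^sup>2)\<^sup>2 \<le> (101/100)\<^sup>2" using r2 by (intro power_mono) (auto simp: power2_eq_square)
    also have "\<dots> \<le> (99/100) * (33/20)" by (simp add: power2_eq_square)
    also have "\<dots> \<le> (1 - \<rho>\<^sup>2) * (33/20)" using c by simp
    finally show ?thesis by (rule mult_left_le_imp_le) (use c in linarith)
  qed
  finally show ?thesis .
qed

lemma v_minus_small:
  assumes \<rho>: "0 < \<rho>" "\<rho> \<le> 1/10" and \<mu>: "0 < \<mu>" "\<mu> \<le> mu_bar \<rho>"
  shows "\<mu> * exp (v_fun \<rho> (gamma_minus \<rho> \<mu>) p) \<le> 33/20"
proof -
  have "exp (v_fun \<rho> (gamma_minus \<rho> \<mu>) p) \<le> (1 + (gamma_minus \<rho> \<mu>)\<^sup>2)\<^sup>2"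
    by (rule v_fun_props(3)[OF \<rho>(1)])
  also have "\<dots> \<le> (1 + 1/4)\<^sup>2"
    using gamma_minus_equation(2)[OF \<rho> \<mu>] by (intro power_mono) auto
  finally have "\<mu> * exp (v_fun \<rho> (gamma_minus \<rho> \<mu>) p) \<le> (6/10) * (1 + 1/4)\<^sup>2"
    using \<mu> mu_bar_bounds(1)[OF \<rho>] by (intro mult_mono) auto
  then show ?thesis by (simp add: power2_eq_square)
qed

subsection \<open>Identification of the branch\<close>

context convergent_expansion
begin

lemma u_solves_Q: "\<bar>s\<bar> * A < 1 \<Longrightarrow> solves_Q (s * G s) K (u s)"
  unfolding solves_Q_def using u_C20 laplacian_u by simp

lemma G_0:
  assumes "\<theta> = 0"
  shows "G s = 1"
  unfolding G_def unfolding assms by simp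

lemma u_le_supersolution:
  assumes \<theta>: "\<theta> = 0" and \<mu>: "0 \<le> \<mu>" "\<bar>\<mu>\<bar> * A < 1"
    and v: "continuous_on K v" "twice_diff (interior K) v"
    and bdry: "\<And>p. p \<in> K \<Longrightarrow> p \<notin> interior K \<Longrightarrow> 0 \<le> v p"
    and super: "\<And>p. p \<in> interior K \<Longrightarrow> \<mu> * exp (v p) \<le> - laplacian v p"
    and p: "p \<in> K"
  shows "u \<mu> p \<le> v p"
proof (rule LIMSEQ_le_const2)
  show "(\<lambda>n. \<Sum>k\<le>n. \<mu> ^ k * z k p) \<longlonglongrightarrow> u \<mu> p"
    using u_sums[OF \<mu>(2) p] unfolding sums_def_le .
  show "\<exists>N. \<forall>n\<ge>N. (\<Sum>k\<le>n. \<mu> ^ k * z k p) \<le> v p"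
    using partial_sum_le_supersolution[OF \<theta> \<mu>(1) v bdry super p] by blast
qed

lemma u_mono:
  assumes "\<theta> = 0" "0 \<le> \<mu>1" "\<mu>1 \<le> \<mu>2" "\<mu>2 * A < 1" "p \<in> K"
  shows "u \<mu>1 p \<le> u \<mu>2 p"
proof (rule sums_le)
  have "\<mu>1 * A \<le> \<mu>2 * A" using assms A by (intro mult_right_mono) auto
  then show "(\<lambda>k. \<mu>1 ^ k * z k p) sums u \<mu>1 p" "(\<lambda>k. \<mu>2 ^ k * z k p) sums u \<mu>2 p"
    using assms(2-) by (auto intro!: u_sums)
  show "\<mu>1 ^ k * z k p \<le> \<mu>2 ^ k * z k p" for k
    using assms z_nonneg by (intro mult_right_mono power_mono) auto
qed

end

lemma convergent_expansion_0: "0 < \<rho> \<Longrightarrow> \<rho> \<le> 1 \<Longrightarrow> convergent_expansion \<rho> 0 (exp 1) (exp 1 / 2)"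
proof unfold_locales
  assume \<rho>: "0 < \<rho>" "\<rho> \<le> 1"
  interpret expansion \<rho> 0 using \<rho> by unfold_locales
  show "\<bar>expansion_rhs \<rho> 0 k p\<bar> \<le> exp 1 * (exp 1 / 2) ^ k" if "p \<in> ellipse \<rho>" for k p
    by (rule f_bound_0[OF refl that])
qed auto

lemma convergent_expansion_1: "0 < \<rho> \<Longrightarrow> \<rho> \<le> 1 \<Longrightarrow> convergent_expansion \<rho> 1 1 48"
proof unfold_locales
  assume \<rho>: "0 < \<rho>" "\<rho> \<le> 1"
  interpret expansion \<rho> 1 using \<rho> by unfold_locales
  show "\<bar>expansion_rhs \<rho> 1 k p\<bar> \<le> 1 * 48 ^ k" if "p \<in> ellipse \<rho>" for k p
  proof -
    have "(48::real) ^ k / (real (Suc k))\<^sup>2 \<le> 48 ^ k / 1"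
      by (intro divide_left_mono one_le_power) auto
    then show ?thesis using f_bound_1[OF refl that, of k] by linarith
  qed
qed auto

context
  fixes \<rho> :: real
  assumes \<rho>: "0 < \<rho>" "\<rho> \<le> 1/10"
begin

interpretation ex0: convergent_expansion \<rho> 0 "exp 1" "exp 1 / 2"
  using convergent_expansion_0 \<rho> by simp

text \<open>All three follow from e \<mu> <= 0.6 * 2.72 = 1.632. They give, in this order,
  convergence of the series for Q, the supersolution 1 - y^2, and the uniqueness threshold.\<close>

lemma small_mu:
  assumes "0 < \<mu>" "\<mu> \<le> mu_bar \<rho>"
  shows "\<mu> * (exp 1 / 2) < 1" "\<mu> \<le> 2 / exp 1" "\<mu> * exp 1 \<le> 33/20"
proof -
  have "\<mu> \<le> 6/10" using mu_bar_bounds(1)[OF \<rho>] assms by simp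
  then have "\<mu> * exp 1 \<le> 6/10 * (272/100)"
    using assms(1) e_less_272 by (intro mult_mono) auto
  then show "\<mu> * (exp 1 / 2) < 1" "\<mu> \<le> 2 / exp 1" "\<mu> * exp 1 \<le> 33/20"
    by (auto simp: field_simps)
qed

lemma u_le_1:
  assumes \<mu>: "0 < \<mu>" "\<mu> \<le> mu_bar \<rho>" and p: "p \<in> ellipse \<rho>"
  shows "ex0.u \<mu> p \<le> 1"
proof -
  have "ex0.u \<mu> p \<le> 1 - 1 * (snd p)\<^sup>2"
  proof (rule ex0.u_le_supersolution[OF refl _ _ polyfun_continuous_on[OF polyfun_snd2] polyfun_twice_diff[OF polyfun_snd2] _ _ p])
    show "0 \<le> 1 - 1 * (snd p)\<^sup>2" if "p \<in> ellipse \<rho>" for p using snd_le_ellipse[OF that] by simp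
    show "\<mu> * exp (1 - 1 * (snd p)\<^sup>2) \<le> - laplacian (\<lambda>p. 1 - 1 * (snd p)\<^sup>2) p" if "p \<in> interior (ellipse \<rho>)" for p
      using ex0.supersolution_snd ex0.ser.intK[OF that] small_mu[OF \<mu>] \<mu> by simp
  qed (use \<mu> small_mu[OF \<mu>] in auto)
  then show ?thesis using zero_le_power2[of "snd p"] by linarith
qed

lemma u_small:
  assumes "0 < \<mu>" "\<mu> \<le> mu_bar \<rho>" "p \<in> ellipse \<rho>"
  shows "\<mu> * exp (ex0.u \<mu> p) \<le> 33/20"
proof -
  have "\<mu> * exp (ex0.u \<mu> p) \<le> \<mu> * exp 1"
    using u_le_1[OF assms] assms(1) by (intro mult_left_mono) auto
  then show ?thesis using small_mu(3)[OF assms(1,2)] by linarith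
qed

lemma u_solves:
  assumes "0 < \<mu>" "\<mu> \<le> mu_bar \<rho>"
  shows "solves_Q \<mu> (ellipse \<rho>) (ex0.u \<mu>)"
  using ex0.u_solves_Q[of \<mu>] small_mu(1)[OF assms] assms by (simp add: ex0.G_0)

text \<open>The lower bound comes from comparison with the small subsolution, the upper one from the
  partial sums. Any competitor lies below the explicit supersolution, so it is small as well and
  uniqueness applies.\<close>

lemma u_sub_super_eq:
  assumes \<mu>: "0 < \<mu>" "\<mu> \<le> mu_bar \<rho>"
  shows "u_sub_super \<rho> \<mu> = ex0.u \<mu>"
  unfolding u_sub_super_def
proof (rule the_equality)
  note r1 = order.trans[OF \<rho>(2), of 1, simplified]
  have Q: "solves_Q \<mu> (ellipse \<rho>) (ex0.u \<mu>)" by (rule u_solves[OF \<mu>])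
  then have C: "ex0.u \<mu> \<in> C20 (ellipse \<rho>)" by (simp add: solves_Q_def)
  have "v_fun \<rho> (gamma_minus \<rho> \<mu>) p \<le> ex0.u \<mu> p" if p: "p \<in> ellipse \<rho>" for p
  proof (rule comparison[OF \<rho>(1) _ v_fun_props(1)[OF \<rho>(1)] C20_D(1)[OF C] v_fun_derivatives(1) C20_D(2)[OF C] _ _ _ _ p])
    show "- laplacian (v_fun \<rho> (gamma_minus \<rho> \<mu>)) p \<le> \<mu> * exp (v_fun \<rho> (gamma_minus \<rho> \<mu>) p)"
      if "p \<in> interior (ellipse \<rho>)" for p
      by (rule v_fun_subsolution[OF \<rho>(1) r1 ex0.ser.intK[OF that] gamma_minus_equation(1)[OF \<rho> \<mu>]])
    show "\<mu> * exp (ex0.u \<mu> p) \<le> - laplacian (ex0.u \<mu>) p" if "p \<in> interior (ellipse \<rho>)" for p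
      using Q that by (simp add: solves_Q_def)
    show "v_fun \<rho> (gamma_minus \<rho> \<mu>) p \<le> ex0.u \<mu> p" if "p \<in> ellipse \<rho>" "p \<notin> interior (ellipse \<rho>)" for p
      using v_fun_props(2)[OF \<rho>(1) that] C20_D(3)[OF C that(2)] by simp
  qed (use \<mu> v_minus_small[OF \<rho> \<mu>] in auto)
  moreover have "ex0.u \<mu> p \<le> v_fun \<rho> (gamma_plus \<rho> \<mu>) p" if p: "p \<in> ellipse \<rho>" for p
  proof (rule ex0.u_le_supersolution[OF refl _ _ v_fun_props(1)[OF \<rho>(1)] v_fun_derivatives(1) _ _ p])
    show "\<mu> * exp (v_fun \<rho> (gamma_plus \<rho> \<mu>) p) \<le> - laplacian (v_fun \<rho> (gamma_plus \<rho> \<mu>)) p"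
      if "p \<in> interior (ellipse \<rho>)" for p
      by (rule v_fun_supersolution[OF \<rho>(1) r1 ex0.ser.intK[OF that] gamma_plus_equation(1)[OF \<rho> \<mu>]])
    show "0 \<le> v_fun \<rho> (gamma_plus \<rho> \<mu>) p" if "p \<in> ellipse \<rho>" "p \<notin> interior (ellipse \<rho>)" for p
      using v_fun_props(2)[OF \<rho>(1) that] by simp
  qed (use \<mu> small_mu[OF \<mu>] in auto)
  ultimately show "solves_Q \<mu> (ellipse \<rho>) (ex0.u \<mu>) \<and>
     (\<forall>p\<in>ellipse \<rho>. v_fun \<rho> (gamma_minus \<rho> \<mu>) p \<le> ex0.u \<mu> p \<and> ex0.u \<mu> p \<le> v_fun \<rho> (gamma_plus \<rho> \<mu>) p)"
    using Q by blast
  fix w assume w: "solves_Q \<mu> (ellipse \<rho>) w \<and>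
     (\<forall>p\<in>ellipse \<rho>. v_fun \<rho> (gamma_minus \<rho> \<mu>) p \<le> w p \<and> w p \<le> v_fun \<rho> (gamma_plus \<rho> \<mu>) p)"
  show "w = ex0.u \<mu>"
  proof (rule solves_Q_unique[OF \<rho>(1) _ _ Q])
    fix p assume p: "p \<in> ellipse \<rho>"
    have "\<mu> * exp (w p) \<le> \<mu> * exp (v_fun \<rho> (gamma_plus \<rho> \<mu>) p)"
      using w p \<mu> by (intro mult_left_mono) auto
    then show "\<mu> * exp (w p) \<le> 33/20" using v_plus_small[OF \<rho> \<mu>, of p] by linarith
  qed (use w \<mu> u_small in auto)
qed

lemma u_sub_super_unique:
  assumes \<mu>: "0 < \<mu>" "\<mu> \<le> mu_bar \<rho>" and w: "solves_Q \<mu> (ellipse \<rho>) w"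
    and small: "\<And>p. p \<in> ellipse \<rho> \<Longrightarrow> \<mu> * exp (w p) \<le> 33/20"
  shows "u_sub_super \<rho> \<mu> = w"
  unfolding u_sub_super_eq[OF \<mu>]
  by (rule solves_Q_unique[OF \<rho>(1) _ u_solves[OF \<mu>] w u_small[OF \<mu>] small]) (use \<mu> in auto)

lemma integrable_exp:
  assumes "w \<in> C20 (ellipse \<rho>)"
  shows "(\<lambda>p. exp (w p)) integrable_on ellipse \<rho>"
  by (intro integrable_on_ellipse \<rho> continuous_intros C20_D(1)[OF assms])

lemma integral_exp_lower:
  assumes w: "w \<in> C20 (ellipse \<rho>)" and c: "\<And>p. p \<in> ellipse \<rho> \<Longrightarrow> c \<le> w p"
  shows "exp c * (pi / \<rho>) \<le> integral (ellipse \<rho>) (\<lambda>p. exp (w p))"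
proof -
  have "integral (ellipse \<rho>) (\<lambda>p. exp c) \<le> integral (ellipse \<rho>) (\<lambda>p. exp (w p))"
    using c by (intro integral_le integrable_exp[OF w] integrable_on_ellipse[OF \<rho>(1)]) auto
  then show ?thesis unfolding integral_const_ellipse[OF \<rho>(1)] .
qed

text \<open>The factor \<mu> increases strictly, and the integral does not decrease because the
  series in \<mu> has nonnegative coefficients. This makes the \<mu> in \<open>u_of_lambda\<close>
  unique.\<close>

lemma lambda_of_mu_strict_mono:
  assumes "0 < \<mu>1" "\<mu>1 < \<mu>2" "\<mu>2 \<le> mu_bar \<rho>"
  shows "lambda_of_mu \<rho> \<mu>1 < lambda_of_mu \<rho> \<mu>2"
proof -
  have m: "0 < \<mu>1" "\<mu>1 \<le> mu_bar \<rho>" "0 < \<mu>2" "\<mu>2 \<le> mu_bar \<rho>" using assms by auto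
  have C: "ex0.u \<mu>1 \<in> C20 (ellipse \<rho>)" "ex0.u \<mu>2 \<in> C20 (ellipse \<rho>)"
    using u_solves m by (auto simp: solves_Q_def)
  let ?I = "\<lambda>\<mu>. integral (ellipse \<rho>) (\<lambda>p. exp (ex0.u \<mu> p))"
  have le: "?I \<mu>1 \<le> ?I \<mu>2"
    by (intro integral_le integrable_exp C)
      (use assms small_mu(1)[OF m(3,4)] in \<open>auto intro!: ex0.u_mono\<close>)
  have "0 \<le> ex0.u \<mu>1 p" if "p \<in> ellipse \<rho>" for p
  proof (rule sums_le[OF _ sums_zero ex0.u_sums])
    show "0 \<le> \<mu>1 ^ k * ex0.z k p" for k using m(1) ex0.z_nonneg[OF refl that] by simp
    show "\<bar>\<mu>1\<bar> * (exp 1 / 2) < 1" using small_mu(1)[OF m(1,2)] m(1) by simp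
  qed (rule that)
  then have "exp 0 * (pi / \<rho>) \<le> ?I \<mu>1" by (rule integral_exp_lower[OF C(1)])
  then have "0 < ?I \<mu>1" using \<rho> by (auto intro: less_le_trans[rotated])
  then have "\<mu>1 * ?I \<mu>1 < \<mu>2 * ?I \<mu>1" using assms by simp
  also have "\<dots> \<le> \<mu>2 * ?I \<mu>2" using le m by (intro mult_left_mono) auto
  finally show ?thesis unfolding lambda_of_mu_def u_sub_super_eq[OF m(1,2)] u_sub_super_eq[OF m(3,4)] .
qed

text \<open>The passage from solutions found by other means to the branch: smallness forces w to be
  \<open>u_sub_super\<close>, and injectivity of \<open>lambda_of_mu\<close> recovers \<mu> from
  l.\<close>

lemma u_of_lambda_eq:
  assumes \<mu>: "0 < \<mu>" "\<mu> \<le> mu_bar \<rho>" and w: "solves_Q \<mu> (ellipse \<rho>) w"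
    and small: "\<And>p. p \<in> ellipse \<rho> \<Longrightarrow> \<mu> * exp (w p) \<le> 33/20"
    and l: "l = \<mu> * integral (ellipse \<rho>) (\<lambda>p. exp (w p))" "0 < l"
  shows "u_of_lambda \<rho> l = w" "l \<le> lambda_1 \<rho>"
proof -
  have us: "u_sub_super \<rho> \<mu> = w" by (rule u_sub_super_unique[OF \<mu> w small])
  then have lam: "lambda_of_mu \<rho> \<mu> = l" by (simp add: lambda_of_mu_def l)
  have "(THE \<mu>. \<mu> \<in> {0<..mu_bar \<rho>} \<and> lambda_of_mu \<rho> \<mu> = l) = \<mu>"
  proof (rule the_equality)
    fix \<nu> assume \<nu>: "\<nu> \<in> {0<..mu_bar \<rho>} \<and> lambda_of_mu \<rho> \<nu> = l"
    then show "\<nu> = \<mu>"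
      using lambda_of_mu_strict_mono[of \<nu> \<mu>] lambda_of_mu_strict_mono[of \<mu> \<nu>] \<mu> lam
      by (cases \<nu> \<mu> rule: linorder_cases) auto
  qed (use \<mu> lam in auto)
  then show "u_of_lambda \<rho> l = w" unfolding u_of_lambda_def using l(2) us by simp
  show "l \<le> lambda_1 \<rho>"
    using lambda_of_mu_strict_mono[of \<mu> "mu_bar \<rho>"] \<mu> lam unfolding lambda_1_def
    by (cases "\<mu> = mu_bar \<rho>") auto
qed

interpretation ex1: convergent_expansion \<rho> 1 1 48
  using convergent_expansion_1 \<rho> by simp

text \<open>1/96 is half the proved radius 1/48, so the terms are at most 1/96 times 2^(-k).\<close>

lemma abs_u_le:
  assumes s: "\<bar>s\<bar> \<le> 1/96" and p: "p \<in> ellipse \<rho>"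
  shows "\<bar>ex1.u s p\<bar> \<le> 1/48"
proof -
  have S: "\<bar>s\<bar> * 48 < 1" using s by simp
  have "norm (s ^ k * ex1.z k p) \<le> 1/96 * (1/2) ^ k" for k
  proof -
    have "norm (s ^ k * ex1.z k p) \<le> (1/96) ^ k * (1/96 * 48 ^ k)"
      using ex1.z_bound_E[OF p, of k] s unfolding norm_mult norm_power ex1.E_def
      by (intro mult_mono power_mono) auto
    also have "\<dots> = 1/96 * ((1/96) * 48) ^ k" unfolding power_mult_distrib by simp
    finally show ?thesis by simp
  qed
  moreover have gs: "(\<lambda>k. 1/96 * (1/2) ^ k) sums (1/48 :: real)"
    using sums_mult[OF geometric_sums[of "1/2 :: real"], of "1/96"] by simp
  ultimately have "norm (\<Sum>k. s ^ k * ex1.z k p) \<le> (\<Sum>k. 1/96 * (1/2) ^ k)"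
    by (intro norm_suminf_le sums_summable[OF gs])
  also have "\<dots> = 1/48" by (rule sums_unique[OF gs, symmetric])
  finally show ?thesis using ex1.u_sums[OF S p] by (simp add: sums_iff)
qed

text \<open>Let I be the integral of exp w. Since the right-hand side has average 1, G s = pi /
  (\<rho> I), so w solves Q with \<mu> = s G s = l / I, which is P. As |w| <= 1/48, this \<mu> is at
  most 1/32, below \<open>mu_bar\<close>, and w is small enough to lie on the branch.\<close>

lemma lambda_solution:
  assumes l: "0 \<le> l" "l * \<rho> / pi \<le> 1/96"
  defines "w \<equiv> ex1.u (l * \<rho> / pi)"
  shows "solves_P l (ellipse \<rho>) w" "u_of_lambda \<rho> l = w" "l \<le> lambda_1 \<rho>"
proof -
  define s where "s = l * \<rho> / pi"
  have s: "0 \<le> s" "s \<le> 1/96" unfolding s_def using l \<rho> by auto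
  then have S: "\<bar>s\<bar> * 48 < 1" by simp
  have w: "w = ex1.u s" by (simp add: w_def s_def)
  have C: "w \<in> C20 (ellipse \<rho>)" unfolding w by (rule ex1.u_C20[OF S])
  have bd: "\<bar>w p\<bar> \<le> 1/48" if "p \<in> ellipse \<rho>" for p
    unfolding w using s by (intro abs_u_le that) simp
  define I where "I = integral (ellipse \<rho>) (\<lambda>p. exp (w p))"
  have Ipos: "exp (- 1/48) * (pi / \<rho>) \<le> I"
    unfolding I_def by (rule integral_exp_lower[OF C]) (use bd in \<open>force simp: abs_le_iff\<close>)
  moreover have "0 < exp (- 1/48) * (pi / \<rho>)" using \<rho> by simp
  ultimately have I0: "0 < I" by linarith
  have "avg \<rho> (\<lambda>p. exp (w p) * ex1.G s) = 1"
    unfolding w by (rule ex1.avg_rhs[OF S ex1.avg_f[OF refl]])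
  then have "\<rho> / pi * (I * ex1.G s) = 1"
    unfolding avg_eq[OF \<rho>(1)] I_def by simp
  then have G: "ex1.G s = pi / \<rho> / I" using I0 \<rho> by (simp add: field_simps)
  define \<mu> where "\<mu> = s * ex1.G s"
  have \<mu>: "\<mu> = l / I" unfolding \<mu>_def G unfolding s_def using \<rho> by simp
  have Q: "solves_Q \<mu> (ellipse \<rho>) w"
    unfolding w \<mu>_def by (rule ex1.u_solves_Q[OF S])
  then show "solves_P l (ellipse \<rho>) w"
    unfolding solves_Q_def solves_P_def I_def[symmetric] \<mu> by simp
  have e2: "exp (1/48) \<le> (3::real)"
    using exp_le order.trans[of "exp (1/48)" "exp 1" "3::real"] by simp
  have "\<mu> \<le> l / (exp (- 1/48) * (pi / \<rho>))"
    unfolding \<mu>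
    by (rule divide_left_mono[OF Ipos l(1) mult_pos_pos[OF I0 \<open>0 < exp (- 1/48) * (pi / \<rho>)\<close>]])
  also have "\<dots> = s * exp (1/48)" unfolding s_def by (simp add: exp_minus field_simps)
  also have "\<dots> \<le> 1/96 * 3" using s e2 by (intro mult_mono) auto
  finally have \<mu>le: "\<mu> \<le> 1/32" by simp
  then have \<mu>bar: "\<mu> \<le> mu_bar \<rho>" using mu_bar_bounds(2)[OF \<rho>] by simp
  have \<mu>0: "0 \<le> \<mu>" unfolding \<mu> using l I0 by simp
  have small: "\<mu> * exp (w p) \<le> 33/20" if "p \<in> ellipse \<rho>" for p
  proof -
    have "exp (w p) \<le> exp (1/48)" using bd[OF that] by simp
    then have "exp (w p) \<le> 3" using e2 by linarith
    then have "\<mu> * exp (w p) \<le> 1/32 * 3" using \<mu>le \<mu>0 by (intro mult_mono) auto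
    then show ?thesis by simp
  qed
  have main: "u_of_lambda \<rho> l = w \<and> l \<le> lambda_1 \<rho>" if "0 < l"
  proof -
    have "0 < \<mu>" unfolding \<mu> using that I0 by simp
    moreover have "l = \<mu> * I" unfolding \<mu> using I0 by simp
    ultimately show ?thesis using u_of_lambda_eq[OF _ \<mu>bar Q small] that unfolding I_def by blast
  qed
  \<comment> \<open>At l = 0 there is no \<mu> > 0 to identify: the branch is 0 there by definition,
    and the series reduces to z 0 = 0.\<close>
  have zero: "u_of_lambda \<rho> 0 = w" if "l = 0"
  proof -
    have "w p = 0" for p
    proof (cases "p \<in> ellipse \<rho>")
      case True
      have "(\<lambda>k. s ^ k * ex1.z k p) = (\<lambda>k. 0)"
        using that by (auto simp: fun_eq_iff s_def power_0_left ex1.z_0)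
      then show ?thesis using ex1.u_sums[OF S True] w sums_unique2 sums_zero by metis
    next
      case False
      then have "p \<notin> interior (ellipse \<rho>)" using interior_subset by blast
      then show ?thesis by (rule C20_D(3)[OF C])
    qed
    then show ?thesis by (auto simp: u_of_lambda_def)
  qed
  show "u_of_lambda \<rho> l = w" using main zero l(1) by (cases "l = 0") auto
  have "0 \<le> lambda_1 \<rho>"
  proof -
    have b: "0 < mu_bar \<rho>" using mu_bar_bounds(2)[OF \<rho>] by simp
    have "0 \<le> integral (ellipse \<rho>) (\<lambda>p. exp (u_sub_super \<rho> (mu_bar \<rho>) p))"
      by (intro integral_nonneg integrable_exp)
        (use u_solves[OF b] u_sub_super_eq[OF b] in \<open>auto simp: solves_Q_def\<close>)
    then show ?thesis unfolding lambda_1_def lambda_of_mu_def using b by simp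
  qed
  then show "l \<le> lambda_1 \<rho>" using main l(1) by (cases "l = 0") auto
qed

end

subsection \<open>The expansion in powers of \<open>\<lambda>\<close>\<close>

text \<open>The solution and the three functions of its decomposition all have coefficients of this
  form, so one estimate covers the four curves. The extra multiple of a 1 allows a quadratic term in
  \<lambda> to be moved between them.\<close>

lemma (in ellipse_series) geometric_combination:
  assumes bound: "\<And>k. \<bar>\<alpha> k\<bar> * N k + \<bar>\<beta> k\<bar> * N 1 \<le> B * A ^ k" and "0 \<le> A" "A * R < 1" "1 \<le> R"
  shows "geometric_series \<rho> (\<lambda>k p. \<alpha> k * a k p + \<beta> k * a 1 p) B A R"
proof unfold_locales
  let ?y = "\<lambda>k p. \<alpha> k * a k p + \<beta> k * a 1 p"
  have le: "\<bar>\<alpha> k * s + \<beta> k * t\<bar> \<le> B * A ^ k" if "\<bar>s\<bar> \<le> N k" "\<bar>t\<bar> \<le> N 1" for k s t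
  proof -
    have "\<bar>\<alpha> k * s + \<beta> k * t\<bar> \<le> \<bar>\<alpha> k\<bar> * \<bar>s\<bar> + \<bar>\<beta> k\<bar> * \<bar>t\<bar>"
      by (rule order.trans[OF abs_triangle_ineq]) (simp add: abs_mult)
    also have "\<dots> \<le> \<bar>\<alpha> k\<bar> * N k + \<bar>\<beta> k\<bar> * N 1"
      using that by (intro add_mono mult_left_mono) auto
    finally show ?thesis using bound[of k] by linarith
  qed
  have d: "a k differentiable (at p)" "partial c (a k) differentiable (at p)" for k c p
    using poly poly1 polyfun_differentiable by blast+
  have p1: "partial b (?y k) = (\<lambda>p. \<alpha> k * partial b (a k) p + \<beta> k * partial b (a 1) p)" for b k
    by (intro ext partial_lincomb d)
  have p2: "partial c (partial b (?y k)) p = \<alpha> k * partial c (partial b (a k)) p + \<beta> k * partial c (partial b (a 1)) p" for b c k p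
    unfolding p1 by (intro partial_lincomb d)
  show "0 < \<rho>" by (rule \<rho>)
  show "\<exists>n. polyfun n (?y k)" for k
  proof -
    obtain n m where "polyfun n (a k)" "polyfun m (a 1)" using poly by metis
    then have "polyfun (n + m) (a k)" "polyfun (n + m) (a 1)" by (auto elim: polyfun_mono)
    then show ?thesis by (intro exI[of _ "n + m"] polyfun.add polyfun_scale)
  qed
  show "?y k p = 0" if "quad \<rho> p = 1" for k p using bdry[OF that] by simp
  show "\<bar>?y k p\<bar> \<le> B * A ^ k" if "p \<in> K" for k p by (intro le N0 that)
  show "\<bar>partial b (?y k) p\<bar> \<le> B * A ^ k" if "p \<in> K" "b \<in> Basis" for k p b
    unfolding p1 by (intro le N1 that)
  show "\<bar>partial b (partial c (?y k)) p\<bar> \<le> B * A ^ k" if "p \<in> K" "b \<in> Basis" "c \<in> Basis" for k p b c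
    unfolding p2 by (intro le N2 that)
qed (use assms in auto)

context geometric_series
begin

lemma curve_sums: "\<bar>l\<bar> \<le> R \<Longrightarrow> p \<in> K \<Longrightarrow> (\<lambda>k. l ^ k * a k p) sums curve 0 l p"
  using summable_sums[OF summable_bounded[OF admissible_power_deriv[of l 0] N0]]
  by (simp add: curve_def series_fun_eq power_deriv_def)

lemma curve_C20: "\<bar>l\<bar> \<le> R \<Longrightarrow> curve j l \<in> C20 K"
  unfolding curve_def by (intro series_fun_C20 admissible_power_deriv)

end

text \<open>Halving the radius absorbs the Markov factor: k^6 48^k is at most a constant times
  96^k.\<close>

lemma power_exponential_bound: "\<exists>B. \<forall>k. real k ^ m * (1/2) ^ k \<le> B"
proof -
  have "(\<lambda>k. real k ^ m * (1/2 :: real) ^ k) \<longlonglongrightarrow> 0"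
    by (rule summable_LIMSEQ_zero[OF summable_power_times]) simp
  then have "Bseq (\<lambda>k. real k ^ m * (1/2 :: real) ^ k)"
    by (intro convergent_imp_Bseq convergentI)
  then obtain B where "\<And>k. norm (real k ^ m * (1/2 :: real) ^ k) \<le> B" by (auto simp: Bseq_def)
  then show ?thesis by (intro exI[of _ B]) (auto intro: order.trans[OF abs_ge_self])
qed

definition mu_lead :: "real \<Rightarrow> real \<Rightarrow> real" where
  "mu_lead l \<rho> = l / pi - l\<^sup>2 / (4 * pi\<^sup>2) * \<rho>"

lemma smooth_mu_lead: "smooth_near S (\<lambda>(l, \<rho>). mu_lead l \<rho>)"
proof -
  have "polyfun 3 (\<lambda>p. (1 / pi) * fst p ^ 1 * snd p ^ 0 + (- 1 / (4 * pi\<^sup>2)) * fst p ^ 2 * snd p ^ 1)"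
    by (intro polyfun.intros) auto
  moreover have "(\<lambda>p. (1 / pi) * fst p ^ 1 * snd p ^ 0 + (- 1 / (4 * pi\<^sup>2)) * fst p ^ 2 * snd p ^ 1)
    = (\<lambda>(l, \<rho>). mu_lead l \<rho>)"
    by (auto simp: mu_lead_def)
  ultimately have "polyfun 3 (\<lambda>(l, \<rho>). mu_lead l \<rho>)" by simp
  then show ?thesis unfolding smooth_near_def
    by (intro exI[of _ UNIV]) (auto intro: polyfun_Ck)
qed

lemma deriv_mu_lead:
  "deriv (\<lambda>t. mu_lead t \<rho>) = (\<lambda>l. 1 / pi - l / (2 * pi\<^sup>2) * \<rho>)"
  "deriv (deriv (\<lambda>t. mu_lead t \<rho>)) l = - 1 / (2 * pi\<^sup>2) * \<rho>"
proof -
  define c where "c = \<rho> / (4 * pi\<^sup>2)"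
  have m: "mu_lead t \<rho> = t / pi - c * t\<^sup>2" for t by (simp add: mu_lead_def c_def)
  have 2: "deriv (\<lambda>t. mu_lead t \<rho>) = (\<lambda>l. 1 / pi - 2 * c * l)"
    unfolding m by (intro ext DERIV_imp_deriv) (auto intro!: derivative_eq_intros)
  then show "deriv (\<lambda>t. mu_lead t \<rho>) = (\<lambda>l. 1 / pi - l / (2 * pi\<^sup>2) * \<rho>)"
    by (simp add: c_def mult.commute)
  have "deriv (\<lambda>l. 1 / pi - 2 * c * l) l = - 2 * c"
    by (intro DERIV_imp_deriv) (auto intro!: derivative_eq_intros)
  then show "deriv (deriv (\<lambda>t. mu_lead t \<rho>)) l = - 1 / (2 * pi\<^sup>2) * \<rho>"
    unfolding 2 by (simp add: c_def)
qed

text \<open>A is chosen with A lbar = 1/2, so the series in l converge on |l| <= lbar with constants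
  depending on lbar alone. The bound on \<rho> gives 96 \<rho> <= A, which turns \<rho>^k 96^k into
  A^k, and s <= 1/96. In B the factor 96^2 / A^2 pays for the two powers of \<rho> divided out in
  \<phi>1, and 2 for its two summands; in M, 21 = 3 * 7 for three norms.\<close>

lemma branch_expansion:
  fixes lbar B0 :: real
  assumes lbar: "1 \<le> lbar" and B0: "\<And>k. real k ^ 6 * (1/2) ^ k \<le> B0"
    and \<rho>: "0 < \<rho>" "\<rho> \<le> 1/10" "\<rho> \<le> 1 / (1000 * lbar)"
  defines "A \<equiv> 1 / (2 * lbar)"
  defines "B \<equiv> 2 * 96\<^sup>2 * (4096 / 96 * B0) / A\<^sup>2"
  defines "M \<equiv> \<lambda>j. 21 * (\<Sum>k. (real k ^ j * lbar ^ k) * (B * A ^ k))"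
  shows "\<exists>u \<phi>0 \<phi>1 \<phi>2 :: real \<Rightarrow> plane \<Rightarrow> real.
        (\<forall>l \<in> {0..<lbar}.
          solves_P l (ellipse \<rho>) (u l) \<and>
          {\<phi>0 l, \<phi>1 l, \<phi>2 l} \<subseteq> C20 (ellipse \<rho>) \<and>
          (\<forall>p \<in> ellipse \<rho>. u l p = \<rho> * \<phi>0 l p + \<rho>\<^sup>2 * \<phi>1 l p + \<rho>^3 * \<phi>2 l p) \<and>
          (\<forall>p \<in> ellipse \<rho>. \<phi>0 l p = mu_lead l \<rho> * psi0 \<rho> p)) \<and>
        (\<forall>k \<in> {0, 1, 2}. \<exists>D0 D1 D2.
          curve_deriv (ellipse \<rho>) {0..<lbar} k \<phi>0 D0 \<and>
          curve_deriv (ellipse \<rho>) {0..<lbar} k \<phi>1 D1 \<and>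
          curve_deriv (ellipse \<rho>) {0..<lbar} k \<phi>2 D2 \<and>
          (\<forall>l \<in> {0..<lbar}.
            C2_norm (ellipse \<rho>) (D0 l) + C2_norm (ellipse \<rho>) (D1 l)
              + C2_norm (ellipse \<rho>) (D2 l) \<le> M k)) \<and>
        smooth_curve (ellipse \<rho>) {0..<lbar} u \<and>
        {(l, u l) | l. l \<in> {0..<lbar}} = {(l, w) \<in> branch_G1 \<rho>. l < lbar}"
proof -
  interpret ex: convergent_expansion \<rho> 1 1 48
    using convergent_expansion_1 \<rho> by simp
  define N where "N = (\<lambda>k. 4096 * real k ^ 6 * ex.E k)"
  define C where "C = 4096 / 96 * B0"
  have N: "0 \<le> N k" "N k \<le> C * 96 ^ k" for k
  proof -
    show "0 \<le> N k" unfolding N_def using ex.E_nonneg[of k] by simp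
    have "48 ^ k = (96::real) ^ k * (1/2) ^ k" by (simp flip: power_mult_distrib)
    then have "N k = 4096 / 96 * (real k ^ 6 * (1/2) ^ k) * 96 ^ k"
      unfolding N_def ex.E_def by (simp only:) simp
    also have "\<dots> \<le> C * 96 ^ k"
      unfolding C_def by (intro mult_right_mono mult_left_mono B0) auto
    finally show "N k \<le> C * 96 ^ k" .
  qed
  have C0: "0 \<le> C" using N[of 0] by simp
  have A: "0 < A" "A \<le> 1" "A * lbar < 1" unfolding A_def using lbar by (auto simp: field_simps)
  have rA: "96 * \<rho> \<le> A" unfolding A_def using \<rho>(3) lbar by (simp add: field_simps)
  have B: "B = 2 * 96\<^sup>2 * C / A\<^sup>2" unfolding B_def C_def ..
  have B_nonneg: "0 \<le> B" unfolding B using C0 by simp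
  have A2: "1 \<le> 1 / A\<^sup>2" using A by (simp add: power_le_one)
  have CB: "C \<le> B" "96\<^sup>2 * C / A\<^sup>2 \<le> B"
  proof -
    show "96\<^sup>2 * C / A\<^sup>2 \<le> B" unfolding B using C0 A by (simp add: divide_right_mono)
    have "C * 1 \<le> (2 * 96\<^sup>2 * C) * (1 / A\<^sup>2)" using C0 A2 by (intro mult_mono) auto
    then show "C \<le> B" unfolding B by simp
  qed
  have pi1: "1 / pi \<le> 1" "1 \<le> pi" using pi_gt3 by auto
  have geom: "geometric_series \<rho> (\<lambda>k p. \<alpha> k * ex.z k p + \<beta> k * ex.z 1 p) B A lbar"
    if "\<And>k. \<bar>\<alpha> k\<bar> * N k + \<bar>\<beta> k\<bar> * N 1 \<le> B * A ^ k" for \<alpha> \<beta>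
    by (rule ex.ser.geometric_combination) (use that A lbar in \<open>auto simp: N_def\<close>)
  \<comment> \<open>The prescribed \<open>mu_lead\<close> puts -l^2 \<rho> / (4 pi^2) times z 1 into
    \<phi>0, a term that the series of u does not contain. \<open>\<beta>1\<close> cancels it after
    multiplication by \<rho>^2, while \<open>\<alpha>1\<close> carries the terms k >= 2 of u divided
    by \<rho>^2.\<close>
  define \<alpha>u where "\<alpha>u = (\<lambda>k. (\<rho> / pi) ^ k)"
  define \<beta>0 where "\<beta>0 = (\<lambda>k::nat. if k = 1 then 1 / pi else if k = 2 then - \<rho> / (4 * pi\<^sup>2) else 0)"
  define \<alpha>1 where "\<alpha>1 = (\<lambda>k::nat. if 2 \<le> k then \<rho> ^ (k - 2) / pi ^ k else 0)"
  define \<beta>1 where "\<beta>1 = (\<lambda>k::nat. if k = 2 then 1 / (4 * pi\<^sup>2) else 0)"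
  have pow: "\<rho> ^ k * 96 ^ k \<le> A ^ k" for k
    unfolding power_mult_distrib[symmetric] using rA \<rho> by (intro power_mono) (auto simp: mult.commute)
  have N1: "c * N 1 \<le> B * A\<^sup>2" if "c \<le> 1" for c
  proof -
    have "c * N 1 \<le> 1 * (C * 96 ^ 1)" using that N[of 1] by (intro order.trans[OF mult_right_mono mult_left_mono]) auto
    also have "\<dots> \<le> 2 * 96\<^sup>2 * C" using C0 by simp
    also have "\<dots> = B * A\<^sup>2" unfolding B using A by simp
    finally show ?thesis .
  qed
  have bu: "\<bar>\<alpha>u k\<bar> * N k + \<bar>0\<bar> * N 1 \<le> B * A ^ k" for k
  proof -
    have "\<bar>\<alpha>u k\<bar> \<le> \<rho> ^ k"
      unfolding \<alpha>u_def using \<rho> pi1 by (auto simp: power_abs divide_le_eq intro!: power_mono)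
    then have "\<bar>\<alpha>u k\<bar> * N k \<le> \<rho> ^ k * (C * 96 ^ k)"
      using N[of k] \<rho> by (intro mult_mono) auto
    also have "\<dots> \<le> C * A ^ k" using mult_left_mono[OF pow[of k] C0] by (simp add: mult_ac)
    also have "\<dots> \<le> B * A ^ k" using CB A by (intro mult_right_mono) auto
    finally show ?thesis by simp
  qed
  have b0: "\<bar>0\<bar> * N k + \<bar>\<beta>0 k\<bar> * N 1 \<le> B * A ^ k" for k
  proof -
    have "A\<^sup>2 \<le> A ^ 1" using A by (intro power_decreasing) auto
    then have "B * A\<^sup>2 \<le> B * A ^ 1" using B_nonneg by (rule mult_left_mono)
    moreover have "\<rho> / (4 * pi\<^sup>2) \<le> 1" using \<rho> one_le_power[OF pi1(2), of 2] by (simp add: divide_le_eq)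
    ultimately show ?thesis
      using N1[OF pi1(1)] N1[of "\<rho> / (4 * pi\<^sup>2)"] \<rho> B_nonneg A by (auto simp: \<beta>0_def)
  qed
  have b1: "\<bar>\<alpha>1 k\<bar> * N k + \<bar>\<beta>1 k\<bar> * N 1 \<le> B * A ^ k" for k
  proof (cases "2 \<le> k")
    case True
    define m where "m = k - 2"
    have k: "k = m + 2" using True by (simp add: m_def)
    have "\<rho> ^ m / pi ^ k \<le> \<rho> ^ m / 1" using \<rho> pi1 by (intro divide_left_mono one_le_power) auto
    then have "\<bar>\<alpha>1 k\<bar> * N k \<le> \<rho> ^ m * (C * 96 ^ k)"
      using N[of k] \<rho> unfolding \<alpha>1_def k by (intro mult_mono) auto
    also have "\<dots> = 96\<^sup>2 * C * (\<rho> ^ m * 96 ^ m)" by (simp add: k power_add)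
    also have "\<dots> \<le> 96\<^sup>2 * C * A ^ m" using C0 by (intro mult_left_mono pow) auto
    finally have 1: "\<bar>\<alpha>1 k\<bar> * N k \<le> 96\<^sup>2 * C * A ^ m" .
    have "\<bar>\<beta>1 k\<bar> * N 1 \<le> 96\<^sup>2 * C * A ^ m"
    proof (cases "k = 2")
      case True
      have "1 / (4 * pi\<^sup>2) \<le> 1" using one_le_power[OF pi1(2), of 2] by (simp add: divide_le_eq)
      then have "1 / (4 * pi\<^sup>2) * N 1 \<le> 1 * (C * 96 ^ 1)" using N[of 1] by (intro mult_mono) auto
      also have "\<dots> \<le> 96\<^sup>2 * C" using C0 by simp
      finally show ?thesis using True k by (simp add: \<beta>1_def)
    next
      case False
      then show ?thesis using C0 A by (simp add: \<beta>1_def)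
    qed
    then have "\<bar>\<alpha>1 k\<bar> * N k + \<bar>\<beta>1 k\<bar> * N 1 \<le> 2 * 96\<^sup>2 * C * A ^ m" using 1 by linarith
    also have "\<dots> = B * A ^ k" unfolding B k power_add using A by simp
    finally show ?thesis .
  next
    case False
    then show ?thesis using B_nonneg A by (simp add: \<alpha>1_def \<beta>1_def)
  qed
  interpret gu: geometric_series \<rho> "\<lambda>k p. \<alpha>u k * ex.z k p + 0 * ex.z 1 p" B A lbar
    by (rule geom[OF bu])
  interpret g0: geometric_series \<rho> "\<lambda>k p. 0 * ex.z k p + \<beta>0 k * ex.z 1 p" B A lbar
    by (rule geom[OF b0])
  interpret g1: geometric_series \<rho> "\<lambda>k p. \<alpha>1 k * ex.z k p + \<beta>1 k * ex.z 1 p" B A lbar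
    by (rule geom[OF b1])
  interpret g2: geometric_series \<rho> "\<lambda>k p. 0 * ex.z k p + 0 * ex.z 1 p" B A lbar
    by (rule geom) (use B_nonneg A in simp)
  have labs: "\<bar>l\<bar> \<le> lbar" if "l \<in> {0..<lbar}" for l using that by simp
  have u_eq: "gu.curve 0 l = ex.u (l * \<rho> / pi)" for l
    unfolding gu.curve_def gu.series_fun_def ex.u_def ex.ser.series_fun_def
    by (intro ext if_cong suminf_cong refl)
      (simp add: power_deriv_def \<alpha>u_def power_mult_distrib power_divide)
  have small: "l * \<rho> / pi \<le> 1/96" if "l \<in> {0..<lbar}" for l
  proof -
    have "l * \<rho> \<le> lbar * (1 / (1000 * lbar))" using that \<rho> by (intro mult_mono) auto
    also have "\<dots> = 1 / 1000" using lbar by simp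
    finally have "l * \<rho> / pi \<le> 1 / 1000 / 1" using pi1 by (intro frac_le) auto
    also have "\<dots> \<le> 1/96" by simp
    finally show ?thesis .
  qed
  have sol: "solves_P l (ellipse \<rho>) (gu.curve 0 l)" "u_of_lambda \<rho> l = gu.curve 0 l" "l \<le> lambda_1 \<rho>"
    if l: "l \<in> {0..<lbar}" for l
    unfolding u_eq using lambda_solution[OF \<rho>(1,2) _ small[OF l]] l by auto
  have decomp: "gu.curve 0 l p = \<rho> * g0.curve 0 l p + \<rho>\<^sup>2 * g1.curve 0 l p + \<rho> ^ 3 * g2.curve 0 l p"
    if l: "l \<in> {0..<lbar}" and p: "p \<in> ellipse \<rho>" for l p
  proof -
    have "(\<lambda>k. \<rho> * (l ^ k * (0 * ex.z k p + \<beta>0 k * ex.z 1 p))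
        + \<rho>\<^sup>2 * (l ^ k * (\<alpha>1 k * ex.z k p + \<beta>1 k * ex.z 1 p))
        + \<rho> ^ 3 * (l ^ k * (0 * ex.z k p + 0 * ex.z 1 p)))
      sums (\<rho> * g0.curve 0 l p + \<rho>\<^sup>2 * g1.curve 0 l p + \<rho> ^ 3 * g2.curve 0 l p)"
      by (intro sums_add sums_mult g0.curve_sums g1.curve_sums g2.curve_sums labs[OF l] p)
    moreover have "\<rho> * (l ^ k * (0 * ex.z k p + \<beta>0 k * ex.z 1 p))
        + \<rho>\<^sup>2 * (l ^ k * (\<alpha>1 k * ex.z k p + \<beta>1 k * ex.z 1 p))
        + \<rho> ^ 3 * (l ^ k * (0 * ex.z k p + 0 * ex.z 1 p))
      = l ^ k * (\<alpha>u k * ex.z k p + 0 * ex.z 1 p)" for k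
    proof -
      consider "k = 0" | "k = 1" | m where "k = m + 2" by (metis One_nat_def add_2_eq_Suc' not0_implies_Suc)
      then show ?thesis
      proof cases
        case 1
        then show ?thesis by (simp add: \<beta>0_def \<alpha>1_def \<beta>1_def ex.z_0)
      next
        case 2
        then show ?thesis by (simp add: \<beta>0_def \<alpha>1_def \<beta>1_def \<alpha>u_def)
      next
        case 3
        then show ?thesis
          by (cases "m = 0") (auto simp: \<beta>0_def \<alpha>1_def \<beta>1_def \<alpha>u_def power_add power_divide power2_eq_square field_simps)
      qed
    qed
    ultimately show ?thesis
      using gu.curve_sums[OF labs[OF l] p] sums_unique2 by simp
  qed
  have lead: "g0.curve 0 l p = mu_lead l \<rho> * psi0 \<rho> p" if l: "l \<in> {0..<lbar}" and p: "p \<in> ellipse \<rho>" for l p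
  proof -
    have "(\<lambda>k. l ^ k * (0 * ex.z k p + \<beta>0 k * ex.z 1 p)) sums (\<Sum>k\<in>{1, 2}. l ^ k * (0 * ex.z k p + \<beta>0 k * ex.z 1 p))"
      by (rule sums_finite) (auto simp: \<beta>0_def)
    also have "(\<Sum>k\<in>{1, 2}. l ^ k * (0 * ex.z k p + \<beta>0 k * ex.z 1 p)) = mu_lead l \<rho> * ex.z 1 p"
      by (simp add: \<beta>0_def mu_lead_def algebra_simps)
    finally show ?thesis
      using g0.curve_sums[OF labs[OF l] p] sums_unique2 unfolding ex.z_first_eq[OF p] by blast
  qed
  have branch: "{(l, gu.curve 0 l) | l. l \<in> {0..<lbar}} = {(l, w) \<in> branch_G1 \<rho>. l < lbar}"
    using sol(2,3) unfolding branch_G1_def by auto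
  have norm: "C2_norm (ellipse \<rho>) (g0.curve k l) + C2_norm (ellipse \<rho>) (g1.curve k l)
    + C2_norm (ellipse \<rho>) (g2.curve k l) \<le> M k" if "l \<in> {0..<lbar}" for k l
    using g0.C2_norm_curve[OF labs[OF that], of k] g1.C2_norm_curve[OF labs[OF that], of k]
      g2.C2_norm_curve[OF labs[OF that], of k] unfolding M_def by linarith
  show ?thesis
  proof (rule exI[of _ "gu.curve 0"], rule exI[of _ "g0.curve 0"], rule exI[of _ "g1.curve 0"],
      rule exI[of _ "g2.curve 0"], intro conjI ballI)
    fix k :: nat
    show "\<exists>D0 D1 D2.
          curve_deriv (ellipse \<rho>) {0..<lbar} k (g0.curve 0) D0 \<and>
          curve_deriv (ellipse \<rho>) {0..<lbar} k (g1.curve 0) D1 \<and>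
          curve_deriv (ellipse \<rho>) {0..<lbar} k (g2.curve 0) D2 \<and>
          (\<forall>l \<in> {0..<lbar}.
            C2_norm (ellipse \<rho>) (D0 l) + C2_norm (ellipse \<rho>) (D1 l)
              + C2_norm (ellipse \<rho>) (D2 l) \<le> M k)"
      by (rule exI[of _ "g0.curve k"], rule exI[of _ "g1.curve k"], rule exI[of _ "g2.curve k"])
        (intro conjI ballI norm g0.curve_deriv_curve g1.curve_deriv_curve g2.curve_deriv_curve labs)
  next
    show "smooth_curve (ellipse \<rho>) {0..<lbar} (gu.curve 0)" by (rule gu.smooth_curve_curve[OF labs])
  qed (use sol decomp lead branch g0.curve_C20[OF labs] g1.curve_C20[OF labs] g2.curve_C20[OF labs] in simp_all)
qed

theorem theorem1p20:
  fixes lbar :: real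
  assumes "lbar \<ge> 8 * pi"
  shows "\<exists>\<rho>0 > 0. \<exists>C > 0. \<exists>M :: nat \<Rightarrow> real. \<exists>\<mu>0 :: real \<Rightarrow> real \<Rightarrow> real.
    smooth_near ({0..<lbar} \<times> {0<..<\<rho>0}) (\<lambda>(l, \<rho>). \<mu>0 l \<rho>) \<and>
    (\<forall>\<rho>. 0 < \<rho> \<and> \<rho> \<le> 1 \<and> \<rho> < \<rho>0 \<longrightarrow>
      (\<forall>l \<in> {0..<lbar}.
        \<bar>\<mu>0 l \<rho> - (l / pi - l\<^sup>2 / (4 * pi\<^sup>2) * \<rho>)\<bar> \<le> C * \<rho>\<^sup>2 \<and>
        \<bar>deriv (\<lambda>t. \<mu>0 t \<rho>) l - (1 / pi - l / (2 * pi\<^sup>2) * \<rho>)\<bar> \<le> C * \<rho>\<^sup>2 \<and>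
        \<bar>deriv (deriv (\<lambda>t. \<mu>0 t \<rho>)) l - (- 1 / (2 * pi\<^sup>2) * \<rho>)\<bar> \<le> C * \<rho>\<^sup>2) \<and>
      (\<exists>u \<phi>0 \<phi>1 \<phi>2 :: real \<Rightarrow> plane \<Rightarrow> real.
        (\<forall>l \<in> {0..<lbar}.
          solves_P l (ellipse \<rho>) (u l) \<and>
          {\<phi>0 l, \<phi>1 l, \<phi>2 l} \<subseteq> C20 (ellipse \<rho>) \<and>
          (\<forall>p \<in> ellipse \<rho>. u l p = \<rho> * \<phi>0 l p + \<rho>\<^sup>2 * \<phi>1 l p + \<rho>^3 * \<phi>2 l p) \<and>
          (\<forall>p \<in> ellipse \<rho>. \<phi>0 l p = \<mu>0 l \<rho> * psi0 \<rho> p)) \<and>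
        (\<forall>k \<in> {0, 1, 2}. \<exists>D0 D1 D2.
          curve_deriv (ellipse \<rho>) {0..<lbar} k \<phi>0 D0 \<and>
          curve_deriv (ellipse \<rho>) {0..<lbar} k \<phi>1 D1 \<and>
          curve_deriv (ellipse \<rho>) {0..<lbar} k \<phi>2 D2 \<and>
          (\<forall>l \<in> {0..<lbar}.
            C2_norm (ellipse \<rho>) (D0 l) + C2_norm (ellipse \<rho>) (D1 l)
              + C2_norm (ellipse \<rho>) (D2 l) \<le> M k)) \<and>
        smooth_curve (ellipse \<rho>) {0..<lbar} u \<and>
        {(l, u l) | l. l \<in> {0..<lbar}} = {(l, w) \<in> branch_G1 \<rho>. l < lbar}))"
proof -
  have lbar: "10 \<le> lbar" using assms pi_gt3 by linarith
  obtain B0 where B0: "\<And>k. real k ^ 6 * (1/2) ^ k \<le> B0"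
    using power_exponential_bound[of 6] by blast
  define \<rho>0 where "\<rho>0 = 1 / (1000 * lbar)"
  have \<rho>0: "0 < \<rho>0" "\<rho>0 \<le> 1/10" unfolding \<rho>0_def using lbar by (auto simp: field_simps)
  define M where "M = (\<lambda>j. 21 * (\<Sum>k. (real k ^ j * lbar ^ k)
    * (2 * 96\<^sup>2 * (4096 / 96 * B0) / (1 / (2 * lbar))\<^sup>2 * (1 / (2 * lbar)) ^ k)))"
  show ?thesis
  proof (rule exI[of _ \<rho>0], rule conjI[OF \<rho>0(1)], rule exI[of _ 1], rule conjI[OF zero_less_one],
      rule exI[of _ M], rule exI[of _ mu_lead], intro conjI allI impI ballI, goal_cases)
    case 1
    show ?case by (rule smooth_mu_lead)
  next
    case (5 \<rho>)
    then have \<rho>: "0 < \<rho>" "\<rho> \<le> 1/10" "\<rho> \<le> 1 / (1000 * lbar)"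
      using \<rho>0(2) \<rho>0_def by linarith+
    have "1 \<le> lbar" using lbar by simp
    from branch_expansion[OF this B0 \<rho>] show ?case unfolding M_def .
  next
    case (3 \<rho> l)
    show ?case unfolding deriv_mu_lead(1) by simp
  next
    case (4 \<rho> l)
    show ?case unfolding deriv_mu_lead(2) by simp
  qed (simp add: mu_lead_def)
qed

end
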